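(* Let $F$ be an irreducible finite-dimensional $\mathfrak g_0$-module with highest weight $\mu$ (with respect to $(h_x,h_y,t,C)$), extended to $\mathfrak g_{\ge 0}$ by letting $\mathfrak g_{>0}$ act trivially. A vector $\vec m\in \mathrm{Ind}(F)$ is a nontrivial highest weight singular vector of degree $3$ if and only if $\vec m$ is, up to a (nonzero) scalar, one of the following vectors: (a) $\mu=\left(1,0,\frac52,-\frac12\right)$ and $\vec m=w_{11}w_{22}w_{21}\otimes x_1+w_{21}w_{12}w_{11}\otimes x_2$; (b) $\mu=\left(0,1,\frac52,\frac12\right)$ and $\vec m=w_{11}w_{22}w_{12}\otimes y_1+w_{12}w_{21}w_{11}\otimes y_2$.
   Context: Everything is over $\mathbb C$. Let $\Lambda(4)$ be the Grassmann superalgebra in the odd variables $\xi_1,\xi_2,\xi_3,\xi_4$, let $t$ be an even variable, $\partial_i=\partial/\partial\xi_i$ (left derivative), $p$ the parity. $K(1,4)_+$ is the space $\mathbb C[t]\otimes\Lambda(4)$ with Lie superbracket $$[f,g]=\Big(2f-\sum_{i}\xi_i\partial_i f\Big)\partial_t g-\partial_t f\Big(2g-\sum_i\xi_i\partial_i g\Big)+(-1)^{p(f)}\sum_{i}\partial_i f\,\partial_i g .$$ Write $\xi_{i_1\cdots i_r}=\xi_{i_1}\cdots\xi_{i_r}$. Let $\mathfrak g=K(1,4)_+\oplus\mathbb C C$ be the central extension (with $C$ even and central) with bracket $[a,b]_{\mathfrak g}=[a,b]+\psi(a,b)C$, where $\psi$ is the bilinear form with $\psi(a,b)=-(-1)^{p(a)p(b)}\psi(b,a)$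 determined by $\psi(1,\xi_{1234})=-2$, $\psi(\xi_i,\partial_i\xi_{1234})=-1$ for $i=1,\dots,4$, all other values on pairs of basis monomials $t^m\xi_{i_1\cdots i_r}$ ($i_1<\dots<i_r$) being zero up to skew-symmetry. ($\mathfrak g$ is the annihilation superalgebra of the conformal superalgebra $K'_4$.) $\mathfrak g$ is $\mathbb Z$-graded by $\deg(t^m\xi_{i_1\cdots i_r})=2m+r-2$, $\deg C=0$; $\mathfrak g_{>0}$, $\mathfrak g_{\ge0}$, $\mathfrak g_{<0}$ denote the sums of the corresponding components. So $\mathfrak g_{-2}=\langle 1\rangle$, $\mathfrak g_{-1}=\langle\xi_1,\dots,\xi_4\rangle$, $\mathfrak g_0=\langle C,t,\xi_{ij}\rangle\cong\mathfrak{so}(4)\oplus\mathbb Ct\oplus\mathbb CC$. In $\mathfrak g_0$ put $h_x=-i\xi_{12}+i\xi_{34}$, $h_y=-i\xi_{12}-i\xi_{34}$, $e_x=\frac12(-\xi_{13}-\xi_{24}-i\xi_{14}+i\xi_{23})$, $f_x=\frac12(\xi_{13}+\xi_{24}-i\xi_{14}+i\xi_{23})$, $e_y=\frac12(-\xi_{13}+\xi_{24}+i\xi_{14}+i\xi_{23})$, $f_y=\frac12(\xi_{13}-\xi_{24}+i\xi_{14}+i\xi_{23})$; $\{e_x,h_x,f_x\}$ and $\{e_y,h_y,f_y\}$ are two commuting $\mathfrak{sl}_2$-triples. Weights are written $\mu=(m,n,\mu_t,\mu_C)$ with respect to $h_x,h_y,t,C$. The irreducible $\mathfrak g_0$-module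 of highest weight $(m,n,\mu_t,\mu_C)$ is realized as the space of polynomials in $x_1,x_2,y_1,y_2$ homogeneous of degree $m$ in $x_1,x_2$ and of degree $n$ in $y_1,y_2$, with $e_x=x_1\partial_{x_2}$, $f_x=x_2\partial_{x_1}$, $h_x=x_1\partial_{x_1}-x_2\partial_{x_2}$, $e_y=y_1\partial_{y_2}$, $f_y=y_2\partial_{y_1}$, $h_y=y_1\partial_{y_1}-y_2\partial_{y_2}$, and $t,C$ acting by the scalars $\mu_t,\mu_C$. $\mathrm{Ind}(F)=U(\mathfrak g)\otimes_{U(\mathfrak g_{\ge0})}F\cong U(\mathfrak g_{<0})\otimes F$ as a vector space, graded by $\mathbb Z_{\ge 0}$ via minus the degree of $U(\mathfrak g_{<0})$. Let $\eta_i$ be the image of $\xi_i$ in $U(\mathfrak g_{<0})$ and $w_{11}=\eta_2+i\eta_1$, $w_{22}=\eta_2-i\eta_1$, $w_{12}=-\eta_4+i\eta_3$, $w_{21}=\eta_4+i\eta_3$ (products are taken in $U(\mathfrak g_{<0})$). A singular vector is a vector annihilated by $\mathfrak g_{>0}$; it is nontrivial if it is nonzero of positive degree; it is a highest weight singular vector if moreover it is annihilated by $e_x$ and $e_y$. *)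

theory Defs
  imports
    "HOL-Analysis.Finite_Cartesian_Product"
    "HOL-Analysis.Product_Vector"
    "HOL-Computational_Algebra.Polynomial"
    "HOL-Library.Poly_Mapping"
begin

section \<open>The Lie superalgebra $K(1,4)_+ \oplus \mathbf{C}\,C$\<close>

datatype idx = I1 | I2 | I3 | I4

primrec pos :: "idx \<Rightarrow> nat" where
  "pos I1 = 1" | "pos I2 = 2" | "pos I3 = 3" | "pos I4 = 4"

lemma UNIV_idx: "UNIV = {I1, I2, I3, I4}"
  using idx.exhaust by auto

instance idx :: finite
  by standard (simp add: UNIV_idx)

text \<open>An element of $\mathbf{C}[t] \otimes \Lambda(4)$ is the family of its coefficients in
  $\mathbf{C}[t]$ with respect to the monomials $\xi_S$, where $S$ is a set of indices and the
  factors of $\xi_S$ are taken in increasing order.\<close>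

type_synonym grass = "(complex poly, idx set) vec"

definition tmon :: "nat \<Rightarrow> idx set \<Rightarrow> grass" where
  "tmon m S = (\<chi> T. if T = S then monom 1 m else 0)"

abbreviation xi :: "idx set \<Rightarrow> grass" where
  "xi S \<equiv> tmon 0 S"

text \<open>The sign in $\xi_S\xi_T = \pm\xi_{S\cup T}$ for disjoint $S$, $T$.\<close>

definition xi_sign :: "idx set \<Rightarrow> idx set \<Rightarrow> complex poly" where
  "xi_sign S T = (-1) ^ card {(i, j). i \<in> S \<and> j \<in> T \<and> pos j < pos i}"

definition gmul :: "grass \<Rightarrow> grass \<Rightarrow> grass" where
  "gmul f g = (\<chi> U. \<Sum>S\<in>Pow U. xi_sign S (U - S) * f $ S * g $ (U - S))"

text \<open>The left derivative: $\partial_i(\xi_i\xi_S) = \xi_S$ for $i \notin S$.\<close>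

definition pd :: "idx \<Rightarrow> grass \<Rightarrow> grass" where
  "pd i f = (\<chi> S. if i \<in> S then 0 else xi_sign {i} S * f $ insert i S)"

definition dt :: "grass \<Rightarrow> grass" where
  "dt f = (\<chi> S. pderiv (f $ S))"

text \<open>The linear map $f \mapsto (-1)^{p(f)} f$.\<close>

definition parity_twist :: "grass \<Rightarrow> grass" where
  "parity_twist f = (\<chi> S. (-1) ^ card S * f $ S)"

definition euler :: "grass \<Rightarrow> grass" where
  "euler f = (\<Sum>i\<in>UNIV. gmul (xi {i}) (pd i f))"

definition Kbr :: "grass \<Rightarrow> grass \<Rightarrow> grass" where
  "Kbr f g = gmul (2 *s f - euler f) (dt g) - gmul (dt f) (2 *s g - euler g)
     + (\<Sum>i\<in>UNIV. gmul (pd i (parity_twist f)) (pd i g))"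

text \<open>The cocycle; here $\partial_i\xi_{1234} = \pm\xi_{1234\setminus i}$ with sign
  \<open>(-1) ^ (pos i - 1)\<close>.\<close>

definition psi :: "grass \<Rightarrow> grass \<Rightarrow> complex" where
  "psi f g = (let c = (\<lambda>h S. coeff (h $ S) 0) in
     - 2 * c f {} * c g UNIV + 2 * c f UNIV * c g {}
     - (\<Sum>i\<in>UNIV. (-1) ^ (pos i - 1) *
          (c f {i} * c g (UNIV - {i}) + c f (UNIV - {i}) * c g {i})))"

text \<open>The pair \<open>(f, z)\<close> stands for $f + zC$.\<close>

type_synonym ann = "grass \<times> complex"

definition ascale :: "complex \<Rightarrow> ann \<Rightarrow> ann" where
  "ascale c a = ((\<chi> S. smult c (fst a $ S)), c * snd a)"

definition abr :: "ann \<Rightarrow> ann \<Rightarrow> ann" where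
  "abr a b = (Kbr (fst a) (fst b), psi (fst a) (fst b))"

abbreviation elt :: "grass \<Rightarrow> ann" where
  "elt f \<equiv> (f, 0)"

definition central :: ann where
  "central = (0, 1)"

text \<open>Homogeneous elements of parity \<open>p\<close> (0 even, 1 odd).\<close>

definition parity_part :: "nat \<Rightarrow> ann set" where
  "parity_part p = {(f, z). (\<forall>S. f $ S \<noteq> 0 \<longrightarrow> card S mod 2 = p) \<and> (z \<noteq> 0 \<longrightarrow> p = 0)}"

text \<open>The sum of the components whose degree satisfies \<open>P\<close>.\<close>

definition deg_part :: "(int \<Rightarrow> bool) \<Rightarrow> ann set" where
  "deg_part P = {(f, z). (\<forall>S m. coeff (f $ S) m \<noteq> 0 \<longrightarrow> P (2 * int m + int (card S) - 2))
     \<and> (z \<noteq> 0 \<longrightarrow> P 0)}"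

abbreviation "g_deg d \<equiv> deg_part (\<lambda>k. k = d)"
abbreviation "g_pos \<equiv> deg_part (\<lambda>k. k > 0)"

abbreviation (input) xi2 :: "idx \<Rightarrow> idx \<Rightarrow> ann" where
  "xi2 i j \<equiv> elt (xi {i, j})"

definition hx :: ann where
  "hx = ascale (-\<i>) (xi2 I1 I2) + ascale \<i> (xi2 I3 I4)"
definition hy :: ann where
  "hy = ascale (-\<i>) (xi2 I1 I2) - ascale \<i> (xi2 I3 I4)"
definition ex :: ann where
  "ex = ascale (1/2) (- xi2 I1 I3 - xi2 I2 I4 - ascale \<i> (xi2 I1 I4) + ascale \<i> (xi2 I2 I3))"
definition fx :: ann where
  "fx = ascale (1/2) (xi2 I1 I3 + xi2 I2 I4 - ascale \<i> (xi2 I1 I4) + ascale \<i> (xi2 I2 I3))"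
definition ey :: ann where
  "ey = ascale (1/2) (- xi2 I1 I3 + xi2 I2 I4 + ascale \<i> (xi2 I1 I4) + ascale \<i> (xi2 I2 I3))"
definition fy :: ann where
  "fy = ascale (1/2) (xi2 I1 I3 - xi2 I2 I4 + ascale \<i> (xi2 I1 I4) + ascale \<i> (xi2 I2 I3))"
definition tt :: ann where
  "tt = elt (tmon 1 {})"

lemma psi_1_xi1234: "psi (xi {}) (xi UNIV) = -2"
proof -
  have "{i} \<noteq> UNIV" for i :: idx
    by (cases i) (use UNIV_idx in auto)
  then have "coeff (xi {} $ {i}) 0 = 0 \<and> coeff (xi UNIV $ {i}) 0 = 0" for i
    by (simp add: tmon_def)
  then show ?thesis
    by (simp add: psi_def Let_def) (simp add: tmon_def)
qed

lemma psi_xi_pd: "psi (xi {i}) (pd i (xi UNIV)) = -1"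
proof -
  have c: "coeff (pd i (xi UNIV) $ S) 0 = (if S = UNIV - {i} then (-1) ^ (pos i - 1) else 0)" for S
  proof -
    have 1: "insert i S = UNIV \<and> i \<notin> S \<longleftrightarrow> S = UNIV - {i}" by auto
    have 2: "xi_sign {i} (UNIV - {i}) = (-1) ^ (pos i - 1)"
    proof -
      have "{(k, j). k \<in> {i} \<and> j \<in> UNIV - {i} \<and> pos j < pos k} = Pair i ` {j. pos j < pos i}"
        by auto
      moreover have "card (Pair i ` {j. pos j < pos i}) = card {j. pos j < pos i}"
        by (rule card_image) (simp add: inj_on_def)
      moreover have "card {j. pos j < pos i} = pos i - 1"
      proof -
        have "{j. pos j < pos i} = set (filter (\<lambda>j. pos j < pos i) [I1, I2, I3, I4])"
        proof (rule set_eqI)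
          fix j
          show "j \<in> {j. pos j < pos i} \<longleftrightarrow>
            j \<in> set (filter (\<lambda>j. pos j < pos i) [I1, I2, I3, I4])"
            by (cases j) auto
        qed
        then show ?thesis by (cases i) simp_all
      qed
      ultimately show ?thesis
        by (simp only: xi_sign_def)
    qed
    have 3: "coeff ((-1) ^ n :: complex poly) 0 = (-1) ^ n" for n :: nat
      by (induction n) (auto simp: coeff_mult)
    show ?thesis
    proof (cases "S = UNIV - {i}")
      case True
      then have "insert i S = UNIV" "i \<notin> S" by auto
      with True show ?thesis by (simp add: pd_def tmon_def 2 3 flip: One_nat_def)
    next
      case False
      with 1 show ?thesis by (auto simp: pd_def tmon_def)
    qed
  qed
  have ne: "UNIV \<noteq> {i}" "UNIV - {j} \<noteq> {i}" "{} \<noteq> UNIV - {i}" for j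
  proof -
    have U: "card (UNIV :: idx set) = 4"
      by (simp add: UNIV_idx)
    have U': "card (UNIV - {k}) = 3" for k :: idx
      using U by (simp add: card_Diff_subset)
    show "UNIV \<noteq> {i}"
    proof
      assume "UNIV = {i}"
      then have "card (UNIV :: idx set) = card {i}" by (rule arg_cong)
      with U show False by simp
    qed
    show "UNIV - {j} \<noteq> {i}"
    proof
      assume "UNIV - {j} = {i}"
      with U'[of j] show False by simp
    qed
    show "{} \<noteq> UNIV - {i}"
    proof
      assume "{} = UNIV - {i}"
      with U'[of i] show False by (metis card.empty zero_neq_numeral)
    qed
  qed
  have d: "coeff (xi {i} $ S) 0 = (if S = {i} then 1 else 0)" for S
    by (simp add: tmon_def)
  have "(\<Sum>j\<in>UNIV. (-1) ^ (pos j - 1) *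
          ((if {j} = {i} then 1 else 0) * (if UNIV - {j} = UNIV - {i} then (-1) ^ (pos i - 1) else 0)
           + (if UNIV - {j} = {i} then 1 else 0) * (if {j} = UNIV - {i} then (-1) ^ (pos i - 1) else 0)))
        = (\<Sum>j\<in>UNIV. if j = i then 1 else (0::complex))"
    by (rule sum.cong) (auto simp: ne simp flip: power_add mult_2)
  then show ?thesis
    unfolding psi_def Let_def c d using ne by simp
qed

section \<open>The universal enveloping algebra\<close>

text \<open>The free monoid; a finitely supported complex function on it is an element of the free
  associative algebra.\<close>

datatype 'a gword = Word "'a list"

instantiation gword :: (type) monoid_add
begin
definition "0 = Word []"
primrec plus_gword :: "'a gword \<Rightarrow> 'a gword \<Rightarrow> 'a gword" where
  "plus_gword (Word xs) w = (case w of Word ys \<Rightarrow> Word (xs @ ys))"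
instance
proof
  fix a b c :: "'a gword"
  show "a + b + c = a + (b + c)" by (cases a; cases b; cases c) simp
  show "0 + a = a" by (cases a) (simp add: zero_gword_def)
  show "a + 0 = a" by (cases a) (simp add: zero_gword_def)
qed
end

type_synonym free_alg = "ann gword \<Rightarrow>\<^sub>0 complex"

definition letter :: "ann \<Rightarrow> free_alg" where
  "letter a = Poly_Mapping.single (Word [a]) 1"

definition fscal :: "complex \<Rightarrow> free_alg" where
  "fscal c = Poly_Mapping.single 0 c"

text \<open>The free algebra on the set \<open>ann\<close> modulo the first two families of relations is the tensor
  algebra of the vector space \<open>ann\<close>.\<close>

inductive_set env_ideal :: "free_alg set" where
  zero: "0 \<in> env_ideal"
| add: "p \<in> env_ideal \<Longrightarrow> q \<in> env_ideal \<Longrightarrow> p + q \<in> env_ideal"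
| lin_add: "p * (letter (a + b) - letter a - letter b) * q \<in> env_ideal"
| lin_scale: "p * (letter (ascale c a) - fscal c * letter a) * q \<in> env_ideal"
| bracket: "a \<in> parity_part i \<Longrightarrow> b \<in> parity_part j \<Longrightarrow>
    p * (letter a * letter b - (-1) ^ (i * j) * letter b * letter a - letter (abr a b)) * q
      \<in> env_ideal"

lemma env_ideal_mult_left: "x \<in> env_ideal \<Longrightarrow> r * x \<in> env_ideal"
proof (induction rule: env_ideal.induct)
  case zero
  show ?case by (simp only: mult_zero_right env_ideal.zero)
next
  case (add p q)
  then show ?case by (simp only: distrib_left env_ideal.add)
next
  case (lin_add p a b q)
  show ?case using env_ideal.lin_add[of "r * p" a b q] by (simp only: mult.assoc)
next
  case (lin_scale p c a q)
  show ?case using env_ideal.lin_scale[of "r * p" c a q] by (simp only: mult.assoc)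
next
  case (bracket a i b j p q)
  then show ?case using env_ideal.bracket[of a i b j "r * p" q] by (simp only: mult.assoc)
qed

lemma env_ideal_mult_right: "x \<in> env_ideal \<Longrightarrow> x * r \<in> env_ideal"
proof (induction rule: env_ideal.induct)
  case zero
  show ?case by (simp only: mult_zero_left env_ideal.zero)
next
  case (add p q)
  then show ?case by (simp only: distrib_right env_ideal.add)
next
  case (lin_add p a b q)
  show ?case using env_ideal.lin_add[of p a b "q * r"] by (simp only: mult.assoc)
next
  case (lin_scale p c a q)
  show ?case using env_ideal.lin_scale[of p c a "q * r"] by (simp only: mult.assoc)
next
  case (bracket a i b j p q)
  then show ?case using env_ideal.bracket[of a i b j p "q * r"] by (simp only: mult.assoc)
qed

lemma env_ideal_uminus: "x \<in> env_ideal \<Longrightarrow> - x \<in> env_ideal"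
  using env_ideal_mult_left[of x "-1"] by simp

lemma env_ideal_diff: "x \<in> env_ideal \<Longrightarrow> y \<in> env_ideal \<Longrightarrow> x - y \<in> env_ideal"
  using env_ideal.add[OF _ env_ideal_uminus, of x y] by simp

quotient_type env = "free_alg" / "\<lambda>p q. p - q \<in> env_ideal"
proof (rule equivpI)
  show "reflp (\<lambda>p q. p - q \<in> env_ideal)"
    by (simp add: reflp_def env_ideal.zero)
  show "symp (\<lambda>p q. p - q \<in> env_ideal)"
    by (rule sympI) (use env_ideal_uminus in \<open>force simp: minus_diff_eq\<close>)
  show "transp (\<lambda>p q. p - q \<in> env_ideal)"
  proof (rule transpI)
    fix p q r :: free_alg
    assume "p - q \<in> env_ideal" "q - r \<in> env_ideal"
    then have "(p - q) + (q - r) \<in> env_ideal" by (rule env_ideal.add)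
    then show "p - r \<in> env_ideal" by simp
  qed
qed

lemma lookup_mult_0:
  fixes p q :: free_alg
  shows "Poly_Mapping.lookup (p * q) 0 = Poly_Mapping.lookup p 0 * Poly_Mapping.lookup q 0"
proof -
  have *: "0 = l + m \<longleftrightarrow> l = 0 \<and> m = 0" for l m :: "ann gword"
    by (cases l; cases m) (auto simp: zero_gword_def)
  have "Poly_Mapping.lookup (p * q) 0 = (\<Sum>l. Poly_Mapping.lookup p l * (\<Sum>m. Poly_Mapping.lookup q m when 0 = l + m))"
    by (simp add: lookup_mult)
  also have "\<dots> = (\<Sum>l. Poly_Mapping.lookup p l * Poly_Mapping.lookup q 0 when l = 0)"
    unfolding * by (intro Sum_any.cong) (auto simp: when_def)
  finally show ?thesis by simp
qed

lemma env_ideal_augmentation: "x \<in> env_ideal \<Longrightarrow> Poly_Mapping.lookup x 0 = 0"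
proof (induction rule: env_ideal.induct)
  have l: "Poly_Mapping.lookup (letter a) 0 = 0" for a
    by (simp add: letter_def lookup_single zero_gword_def)
  case (lin_add p a b q)
  then show ?case by (simp only: lookup_mult_0 lookup_minus l) simp
next
  have l: "Poly_Mapping.lookup (letter a) 0 = 0" for a
    by (simp add: letter_def lookup_single zero_gword_def)
  case (lin_scale p c a q)
  then show ?case by (simp only: lookup_mult_0 lookup_minus l) simp
next
  have l: "Poly_Mapping.lookup (letter a) 0 = 0" for a
    by (simp add: letter_def lookup_single zero_gword_def)
  case (bracket a i b j p q)
  then show ?case by (simp only: lookup_mult_0 lookup_minus l) simp
qed (simp_all add: lookup_add)

instantiation env :: ring_1
begin
lift_definition zero_env :: env is 0 .
lift_definition one_env :: env is 1 .
lift_definition plus_env :: "env \<Rightarrow> env \<Rightarrow> env" is "(+)"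
proof -
  fix a b c d :: "free_alg"
  assume "a - b \<in> env_ideal" "c - d \<in> env_ideal"
  then have "(a - b) + (c - d) \<in> env_ideal" by (rule env_ideal.add)
  then show "a + c - (b + d) \<in> env_ideal" by (simp add: algebra_simps)
qed
lift_definition uminus_env :: "env \<Rightarrow> env" is uminus
proof -
  fix a b :: "free_alg"
  assume "a - b \<in> env_ideal"
  then have "- (a - b) \<in> env_ideal" by (rule env_ideal_uminus)
  then show "- a - - b \<in> env_ideal" by simp
qed
lift_definition minus_env :: "env \<Rightarrow> env \<Rightarrow> env" is "(-)"
proof -
  fix a b c d :: free_alg
  assume "a - b \<in> env_ideal" "c - d \<in> env_ideal"
  then have "(a - b) - (c - d) \<in> env_ideal" by (rule env_ideal_diff)
  then show "a - c - (b - d) \<in> env_ideal" by (simp add: algebra_simps)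
qed
lift_definition times_env :: "env \<Rightarrow> env \<Rightarrow> env" is "(*)"
proof -
  fix a b c d :: free_alg
  assume "a - b \<in> env_ideal" "c - d \<in> env_ideal"
  then have "(a - b) * c + b * (c - d) \<in> env_ideal"
    using env_ideal.add[OF env_ideal_mult_right env_ideal_mult_left] by blast
  then show "a * c - b * d \<in> env_ideal" by (simp add: algebra_simps)
qed
instance
proof
  show "(0 :: env) \<noteq> 1"
  proof transfer
    have "Poly_Mapping.lookup (0 - 1 :: free_alg) 0 \<noteq> 0" by (simp add: lookup_minus lookup_one)
    then show "0 - 1 \<notin> env_ideal" using env_ideal_augmentation by blast
  qed
qed (transfer; simp add: algebra_simps env_ideal.zero)+
end

lift_definition embed :: "ann \<Rightarrow> env" is letter .
lift_definition scalar :: "complex \<Rightarrow> env" is fscal .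

text \<open>The subspace of degree \<open>- d\<close> of $U(\mathfrak g_{<0})$.\<close>

inductive_set neg_env :: "nat \<Rightarrow> env set" for d where
  zero: "0 \<in> neg_env d"
| add: "u \<in> neg_env d \<Longrightarrow> w \<in> neg_env d \<Longrightarrow> u + w \<in> neg_env d"
| prod: "list_all2 (\<lambda>a k. k > 0 \<and> a \<in> g_deg (- int k)) as ks \<Longrightarrow> sum_list ks = d \<Longrightarrow>
    scalar c * prod_list (map embed as) \<in> neg_env d"

definition eta :: "idx \<Rightarrow> env" where
  "eta i = embed (elt (xi {i}))"

definition w11 :: env where "w11 = eta I2 + scalar \<i> * eta I1"
definition w22 :: env where "w22 = eta I2 - scalar \<i> * eta I1"
definition w12 :: env where "w12 = - eta I4 + scalar \<i> * eta I3"
definition w21 :: env where "w21 = eta I4 + scalar \<i> * eta I3"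

section \<open>Modules over the degree zero component\<close>

text \<open>A module $F$ is the universe of a type of this class; \<open>act0 a\<close> is only meaningful
  for \<open>a \<in> g_deg 0\<close>, which is purely even.\<close>

class g0_module = ab_group_add +
  fixes fscale :: "complex \<Rightarrow> 'a \<Rightarrow> 'a"
    and act0 :: "ann \<Rightarrow> 'a \<Rightarrow> 'a"
  assumes fscale_add_right: "fscale c (v + w) = fscale c v + fscale c w"
    and fscale_add_left: "fscale (c + d) v = fscale c v + fscale d v"
    and fscale_fscale: "fscale c (fscale d v) = fscale (c * d) v"
    and fscale_one: "fscale 1 v = v"
    and act0_add_right: "a \<in> g_deg 0 \<Longrightarrow> act0 a (v + w) = act0 a v + act0 a w"
    and act0_scale_right: "a \<in> g_deg 0 \<Longrightarrow> act0 a (fscale c v) = fscale c (act0 a v)"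
    and act0_add_left: "a \<in> g_deg 0 \<Longrightarrow> b \<in> g_deg 0 \<Longrightarrow> act0 (a + b) v = act0 a v + act0 b v"
    and act0_scale_left: "a \<in> g_deg 0 \<Longrightarrow> act0 (ascale c a) v = fscale c (act0 a v)"
    and act0_bracket: "a \<in> g_deg 0 \<Longrightarrow> b \<in> g_deg 0 \<Longrightarrow>
      act0 (abr a b) v = act0 a (act0 b v) - act0 b (act0 a v)"

lemma vector_space_fscale: "vector_space (fscale :: complex \<Rightarrow> 'f::g0_module \<Rightarrow> 'f)"
  by standard (simp_all add: fscale_add_right fscale_add_left fscale_fscale fscale_one)

definition finite_dimensional :: "'f::g0_module itself \<Rightarrow> bool" where
  "finite_dimensional _ \<longleftrightarrow> (\<exists>B :: 'f set. finite B \<and> module.span fscale B = UNIV)"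

definition irreducible_module :: "'f::g0_module itself \<Rightarrow> bool" where
  "irreducible_module _ \<longleftrightarrow> (UNIV :: 'f set) \<noteq> {0} \<and>
     (\<forall>W :: 'f set. module.subspace fscale W \<and> (\<forall>a\<in>g_deg 0. \<forall>v\<in>W. act0 a v \<in> W)
        \<longrightarrow> W = {0} \<or> W = UNIV)"

definition highest_weight ::
    "'f::g0_module itself \<Rightarrow> complex \<times> complex \<times> complex \<times> complex \<Rightarrow> bool" where
  "highest_weight _ = (\<lambda>(m, n, mt, mC). \<exists>v :: 'f. v \<noteq> 0 \<and> act0 ex v = 0 \<and> act0 ey v = 0
     \<and> act0 hx v = fscale m v \<and> act0 hy v = fscale n v
     \<and> act0 tt v = fscale mt v \<and> act0 central v = fscale mC v)"

subsection \<open>The polynomial realization\<close>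

datatype var = X1 | X2 | Y1 | Y2

type_synonym xypoly = "(var \<Rightarrow>\<^sub>0 nat) \<Rightarrow>\<^sub>0 complex"

definition V :: "var \<Rightarrow> xypoly" where
  "V x = Poly_Mapping.single (Poly_Mapping.single x 1) 1"

definition D :: "var \<Rightarrow> xypoly \<Rightarrow> xypoly" where
  "D x p = (\<Sum>k\<in>Poly_Mapping.keys p. Poly_Mapping.single (k - Poly_Mapping.single x 1)
     (of_nat (Poly_Mapping.lookup k x) * Poly_Mapping.lookup p k))"

definition bihom :: "nat \<Rightarrow> nat \<Rightarrow> xypoly set" where
  "bihom m n = {p. \<forall>k\<in>Poly_Mapping.keys p.
     Poly_Mapping.lookup k X1 + Poly_Mapping.lookup k X2 = m \<and>
     Poly_Mapping.lookup k Y1 + Poly_Mapping.lookup k Y2 = n}"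

text \<open>\<open>\<phi>\<close> identifies the model of highest weight \<open>(m, n, mt, mC)\<close> with $F$.\<close>

definition realization ::
    "nat \<Rightarrow> nat \<Rightarrow> complex \<Rightarrow> complex \<Rightarrow> (xypoly \<Rightarrow> 'f::g0_module) \<Rightarrow> bool" where
  "realization m n mt mC \<phi> \<longleftrightarrow> bij_betw \<phi> (bihom m n) UNIV
     \<and> (\<forall>p\<in>bihom m n. \<forall>q\<in>bihom m n. \<phi> (p + q) = \<phi> p + \<phi> q)
     \<and> (\<forall>c. \<forall>p\<in>bihom m n. \<phi> (Poly_Mapping.single 0 c * p) = fscale c (\<phi> p))
     \<and> (\<forall>p\<in>bihom m n.
          act0 ex (\<phi> p) = \<phi> (V X1 * D X2 p)
        \<and> act0 fx (\<phi> p) = \<phi> (V X2 * D X1 p)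
        \<and> act0 hx (\<phi> p) = \<phi> (V X1 * D X1 p - V X2 * D X2 p)
        \<and> act0 ey (\<phi> p) = \<phi> (V Y1 * D Y2 p)
        \<and> act0 fy (\<phi> p) = \<phi> (V Y2 * D Y1 p)
        \<and> act0 hy (\<phi> p) = \<phi> (V Y1 * D Y1 p - V Y2 * D Y2 p)
        \<and> act0 tt (\<phi> p) = fscale mt (\<phi> p)
        \<and> act0 central (\<phi> p) = fscale mC (\<phi> p))"

section \<open>The induced module\<close>

text \<open>$U(\mathfrak g) \otimes_{U(\mathfrak g_{\ge 0})} F$ is the free abelian group on
  $U(\mathfrak g) \times F$ modulo biadditivity and balancing. The latter is imposed for the
  scalars and for $\mathfrak g_{\ge 0} = \mathfrak g_0 \oplus \mathfrak g_{>0}$, which generate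
  the ring $U(\mathfrak g_{\ge 0})$; the summand $\mathfrak g_{>0}$ acts on $F$ by zero.\<close>

inductive_set ind_rel :: "(env \<times> 'f::g0_module \<Rightarrow>\<^sub>0 int) set" where
  zero: "0 \<in> ind_rel"
| diff: "p \<in> ind_rel \<Longrightarrow> q \<in> ind_rel \<Longrightarrow> p - q \<in> ind_rel"
| add_left: "frag_of (u + w, v) - frag_of (u, v) - frag_of (w, v) \<in> ind_rel"
| add_right: "frag_of (u, v + v') - frag_of (u, v) - frag_of (u, v') \<in> ind_rel"
| scalar: "frag_of (u * scalar c, v) - frag_of (u, fscale c v) \<in> ind_rel"
| balance: "a \<in> g_deg 0 \<Longrightarrow> b \<in> g_pos \<Longrightarrow>
    frag_of (u * embed (a + b), v) - frag_of (u, act0 a v) \<in> ind_rel"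

lemma ind_rel_uminus: "p \<in> ind_rel \<Longrightarrow> - p \<in> ind_rel"
  using ind_rel.diff[OF ind_rel.zero, of p] by simp

lemma ind_rel_add: "p \<in> ind_rel \<Longrightarrow> q \<in> ind_rel \<Longrightarrow> p + q \<in> ind_rel"
  using ind_rel.diff[OF _ ind_rel_uminus, of p q] by simp

quotient_type (overloaded) 'f ind = "env \<times> 'f::g0_module \<Rightarrow>\<^sub>0 int" / "\<lambda>p q. p - q \<in> ind_rel"
proof (rule equivpI)
  show "reflp (\<lambda>p q :: env \<times> 'f \<Rightarrow>\<^sub>0 int. p - q \<in> ind_rel)"
    by (simp add: reflp_def ind_rel.zero)
  show "symp (\<lambda>p q :: env \<times> 'f \<Rightarrow>\<^sub>0 int. p - q \<in> ind_rel)"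
    by (rule sympI) (use ind_rel_uminus in \<open>force simp: minus_diff_eq\<close>)
  show "transp (\<lambda>p q :: env \<times> 'f \<Rightarrow>\<^sub>0 int. p - q \<in> ind_rel)"
  proof (rule transpI)
    fix p q r :: "env \<times> 'f \<Rightarrow>\<^sub>0 int"
    assume "p - q \<in> ind_rel" "q - r \<in> ind_rel"
    then have "(p - q) + (q - r) \<in> ind_rel" by (rule ind_rel_add)
    then show "p - r \<in> ind_rel" by simp
  qed
qed

instantiation ind :: (g0_module) ab_group_add
begin
lift_definition zero_ind :: "'a ind" is 0 .
lift_definition plus_ind :: "'a ind \<Rightarrow> 'a ind \<Rightarrow> 'a ind" is "(+)"
proof -
  fix a b c d :: "env \<times> 'a \<Rightarrow>\<^sub>0 int"
  assume "a - b \<in> ind_rel" "c - d \<in> ind_rel"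
  then have "(a - b) + (c - d) \<in> ind_rel" by (rule ind_rel_add)
  then show "a + c - (b + d) \<in> ind_rel" by (simp add: algebra_simps)
qed
lift_definition uminus_ind :: "'a ind \<Rightarrow> 'a ind" is uminus
proof -
  fix a b :: "env \<times> 'a \<Rightarrow>\<^sub>0 int"
  assume "a - b \<in> ind_rel"
  then have "- (a - b) \<in> ind_rel" by (rule ind_rel_uminus)
  then show "- a - - b \<in> ind_rel" by simp
qed
lift_definition minus_ind :: "'a ind \<Rightarrow> 'a ind \<Rightarrow> 'a ind" is "(-)"
proof -
  fix a b c d :: "env \<times> 'a \<Rightarrow>\<^sub>0 int"
  assume "a - b \<in> ind_rel" "c - d \<in> ind_rel"
  then have "(a - b) - (c - d) \<in> ind_rel" by (rule ind_rel.diff)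
  then show "a - c - (b - d) \<in> ind_rel" by (simp add: algebra_simps)
qed
instance
  by standard (transfer; simp add: algebra_simps ind_rel.zero)+
end

text \<open>The first argument is not to be lifted along \<open>env\<close>.\<close>

lifting_forget env.lifting

lift_definition tensor :: "env \<Rightarrow> 'f::g0_module \<Rightarrow> 'f ind" (infix "\<otimes>" 68) is
  "\<lambda>u v. frag_of (u, v)" .

lift_definition uact :: "env \<Rightarrow> 'f::g0_module ind \<Rightarrow> 'f ind" (infixr "\<cdot>" 67) is
  "\<lambda>u. frag_extend (\<lambda>(w, v). frag_of (u * w, v))"
proof -
  fix u :: env and p q :: "env \<times> 'f \<Rightarrow>\<^sub>0 int"
  let ?L = "frag_extend (\<lambda>(w, v :: 'f). frag_of (u * w, v))"
  assume "p - q \<in> ind_rel"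
  moreover have "?L r \<in> ind_rel" if "r \<in> ind_rel" for r :: "env \<times> 'f \<Rightarrow>\<^sub>0 int"
    using that
  proof induction
    case zero
    show ?case by (simp add: ind_rel.zero)
  next
    case (diff p q)
    then show ?case by (simp add: frag_extend_diff ind_rel.diff)
  next
    case (add_left w w' v)
    show ?case
      using ind_rel.add_left[of "u * w" "u * w'" v] by (simp add: frag_extend_diff distrib_left)
  next
    case (add_right w v v')
    show ?case
      using ind_rel.add_right[of "u * w" v v'] by (simp add: frag_extend_diff)
  next
    case (scalar w c v)
    show ?case
      using ind_rel.scalar[of "u * w" c v] by (simp add: frag_extend_diff mult.assoc)
  next
    case (balance a b w v)
    then show ?case
      using ind_rel.balance[of a b "u * w" v] by (simp add: frag_extend_diff mult.assoc)
  qed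
  ultimately have "?L (p - q) \<in> ind_rel" by blast
  then show "?L p - ?L q \<in> ind_rel"
    by (simp add: frag_extend_diff)
qed

unbundle env.lifting

inductive_set ind_deg :: "nat \<Rightarrow> 'f::g0_module ind set" for d where
  zero: "0 \<in> ind_deg d"
| add: "x \<in> ind_deg d \<Longrightarrow> y \<in> ind_deg d \<Longrightarrow> x + y \<in> ind_deg d"
| tensor: "u \<in> neg_env d \<Longrightarrow> u \<otimes> v \<in> ind_deg d"

definition singular :: "'f::g0_module ind \<Rightarrow> bool" where
  "singular x \<longleftrightarrow> (\<forall>a\<in>g_pos. embed a \<cdot> x = 0)"

definition nontrivial_singular :: "'f::g0_module ind \<Rightarrow> bool" where
  "nontrivial_singular x \<longleftrightarrow> singular x \<and> x \<noteq> 0 \<and> (\<exists>d>0. x \<in> ind_deg d)"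

definition nontrivial_hw_singular :: "'f::g0_module ind \<Rightarrow> bool" where
  "nontrivial_hw_singular x \<longleftrightarrow>
     nontrivial_singular x \<and> embed ex \<cdot> x = 0 \<and> embed ey \<cdot> x = 0"

end

theory Submission
  imports Defs
begin

text \<open>$\mathrm{Ind}(F)$ is identified with an explicit model, iterated pairs of polynomials in one
  variable with coefficients in $F$, on which the isotropic basis $w_{11}, w_{12}, w_{21}, w_{22}$ of
  $\mathfrak g_{-1}$ acts by left multiplication. The action $\rho$ of $\mathfrak g$ on the model is
  determined by its values on the vacuum vectors and by
  $\rho(a) w = w \rho((-1)^{p(a)} a) + \rho([a, w])$. The defect of the bracket relation commutes with
  the $w$'s up to defects of other brackets, so it vanishes because it vanishes on the vacuum; hence the
  model is a module and the natural map from $\mathrm{Ind}(F)$ to it has an inverse. This replaces the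
  Poincare-Birkhoff-Witt theorem.

  In the model the condition that the components $\langle t\xi_i, \xi_{ijk} \rangle$ of
  $\mathfrak g_1$ (which generate $\mathfrak g_{>0}$) and $e_x$, $e_y$ kill a vector of degree 3 is a
  sparse linear system over the eight coefficients in $F$. It forces two of them to span $F$ as a doublet
  of one of the two copies of $\mathfrak{sl}_2$ and fixes the eigenvalues of $t$ and $C$.\<close>

section \<open>The Grassmann superalgebra\<close>

text \<open>Two obstacles shape the construction. An element of degree -1 carries a space built from
  only some of the generators out of itself, so at each stage the action is a bilinear map from the
  space adjoined so far into the full model; source and target coincide only at the end. And the
  Jacobi identity is never expanded for three arbitrary arguments: one argument always has degree
  -1, where the bracket with xi_k is the explicit superderivation \<open>adxi\<close>. The isotropic
  basis is chosen because its members square to zero, so that adjoining one of them just doubles the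
  space; the pairs w11, w22 and w12, w21 then produce the even generator zeta.

  The constants of the theorem come from an overdetermined eigenvalue. With tau and gamma the
  scalars of t and C, three equations give h_x - h_y on the coefficient b12 as 2 tau - 4, 2 + 2
  gamma and -2 gamma, which for nonzero b12 forces tau = 5/2 and gamma = -1/2. The coefficient b21
  gives the mirror case gamma = 1/2, so the two cannot be nonzero together.\<close>

lemma finite_idx_set [simp]: "finite (S :: idx set)"
  by simp

lemma pos_inject [simp]: "pos i = pos j \<longleftrightarrow> i = j"
  by (cases i; cases j) auto

section \<open>Signs of reordered monomials\<close>

lemma xi_sign_empty [simp]: "xi_sign {} T = 1" "xi_sign S {} = 1"
  by (simp_all add: xi_sign_def)

lemma xi_sign_Un_left:
  assumes "S \<inter> S' = {}"
  shows "xi_sign (S \<union> S') T = xi_sign S T * xi_sign S' T"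
proof -
  have "{(i, j). i \<in> S \<union> S' \<and> j \<in> T \<and> pos j < pos i} =
      {(i, j). i \<in> S \<and> j \<in> T \<and> pos j < pos i} \<union> {(i, j). i \<in> S' \<and> j \<in> T \<and> pos j < pos i}"
    by auto
  moreover have "{(i, j). i \<in> S \<and> j \<in> T \<and> pos j < pos i} \<inter>
      {(i, j). i \<in> S' \<and> j \<in> T \<and> pos j < pos i} = {}"
    using assms by auto
  ultimately show ?thesis
    by (simp add: xi_sign_def card_Un_disjoint power_add)
qed

lemma xi_sign_Un_right:
  assumes "T \<inter> T' = {}"
  shows "xi_sign S (T \<union> T') = xi_sign S T * xi_sign S T'"
proof -
  have "{(i, j). i \<in> S \<and> j \<in> T \<union> T' \<and> pos j < pos i} =
      {(i, j). i \<in> S \<and> j \<in> T \<and> pos j < pos i} \<union> {(i, j). i \<in> S \<and> j \<in> T' \<and> pos j < pos i}"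
    by auto
  moreover have "{(i, j). i \<in> S \<and> j \<in> T \<and> pos j < pos i} \<inter>
      {(i, j). i \<in> S \<and> j \<in> T' \<and> pos j < pos i} = {}"
    using assms by auto
  ultimately show ?thesis
    by (simp add: xi_sign_def card_Un_disjoint power_add)
qed

text \<open>The sign in xi_k xi_S = +-xi_{insert k S} for \<open>k\<close> outside \<open>S\<close>.
  Peeling off one index at a time with \<open>lsign_insert\<close> evaluates signs on explicit sets
  without counting inversions.\<close>

definition lsign :: "idx \<Rightarrow> idx set \<Rightarrow> complex poly" where
  "lsign k S = xi_sign {k} S"

lemma xi_sign_insert_left: "k \<notin> S \<Longrightarrow> xi_sign (insert k S) T = lsign k T * xi_sign S T"
  using xi_sign_Un_left[of "{k}" S T] by (simp add: lsign_def)

lemma lsign_empty [simp]: "lsign k {} = 1"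
  by (simp add: lsign_def)

lemma lsign_insert: "j \<notin> S \<Longrightarrow> lsign k (insert j S) = (if pos j < pos k then - 1 else 1) * lsign k S"
proof -
  have "{(i, l). i \<in> {k} \<and> l \<in> {j} \<and> pos l < pos i} = (if pos j < pos k then {(k, j)} else {})"
    by auto
  then show "j \<notin> S \<Longrightarrow> ?thesis"
    using xi_sign_Un_right[of "{j}" S "{k}"] by (simp add: lsign_def xi_sign_def)
qed

lemma lsign_Un: "S \<inter> T = {} \<Longrightarrow> lsign k (S \<union> T) = lsign k S * lsign k T"
  by (simp add: lsign_def xi_sign_Un_right)

lemma xi_sign_square [simp]: "xi_sign S T * xi_sign S T = 1" "xi_sign S T * (xi_sign S T * p) = p"
proof -
  show 1: "xi_sign S T * xi_sign S T = 1"
    by (simp add: xi_sign_def power_add [symmetric] mult_2 [symmetric])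
  then show "xi_sign S T * (xi_sign S T * p) = p"
    by (metis mult.assoc mult.left_neutral)
qed

lemma xi_sign_cases: "xi_sign S T = 1 \<or> xi_sign S T = - 1"
  using xi_sign_square(1)[of S T] square_eq_1_iff by blast

lemma lsign_square [simp]: "lsign k T * lsign k T = 1" "lsign k T * (lsign k T * p) = p"
  by (simp_all add: lsign_def)

text \<open>Every \<open>i\<close> in \<open>S\<close> lies either before or after \<open>k\<close>,
  so the inversions counted by \<open>xi_sign S {k}\<close> and by \<open>lsign k S\<close> together
  number \<open>card S\<close>.\<close>

lemma xi_sign_insert_right:
  assumes "k \<notin> S" "k \<notin> T"
  shows "xi_sign S (insert k T) = (-1) ^ card S * lsign k S * xi_sign S T"
proof -
  have "xi_sign S {k} = (-1) ^ card S * lsign k S"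
    using finite[of S] assms(1)
  proof (induction S rule: finite_induct)
    case (insert i S)
    then show ?case
      by (auto simp: xi_sign_insert_left lsign_insert not_less order_le_less)
  qed simp
  then show ?thesis
    using xi_sign_Un_right[of "{k}" T S] assms by simp
qed

lemma pderiv_sign [simp]: "pderiv (xi_sign S T * p) = xi_sign S T * pderiv p"
  using xi_sign_cases[of S T] by (auto simp: pderiv_minus)

lemma pderiv_lsign [simp]: "pderiv (lsign k T * p) = lsign k T * pderiv p"
  by (simp add: lsign_def)

lemma pderiv_sign2 [simp]: "pderiv (xi_sign S T * p * q) = xi_sign S T * pderiv (p * q)"
  by (simp add: mult.assoc)

lemma pderiv_neg_one_power [simp]: "pderiv ((-1) ^ n * p :: complex poly) = (-1) ^ n * pderiv p"
  by (cases "even n") (auto simp: pderiv_minus)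

section \<open>Operators on polynomials in t with values in the Grassmann algebra\<close>

lemma grass_induct [case_names axis add]:
  assumes "\<And>p S. P (axis S p :: grass)" "\<And>f g. P f \<Longrightarrow> P g \<Longrightarrow> P (f + g)"
  shows "P f"
proof -
  have "axis {} 0 = (0 :: grass)" by (simp add: vec_eq_iff axis_def)
  then have P0: "P 0" using assms(1)[of "{}" 0] by (simp only:)
  have "f = (\<Sum>S\<in>UNIV. axis S (f $ S))"
    by (simp add: vec_eq_iff axis_def sum.delta)
  moreover have "P (\<Sum>S\<in>A. axis S (f $ S))" for A
    by (induction A rule: infinite_finite_induct) (use assms P0 in auto)
  ultimately show ?thesis by metis
qed

text \<open>Equal to \<open>gmul (xi {k})\<close> by \<open>gmul_xi_left\<close>, but given by
  coefficients in the same shape as \<open>pd\<close>. The Clifford relations of these two operators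
  carry the sign bookkeeping of all brackets with xi_k.\<close>

definition ximul :: "idx \<Rightarrow> grass \<Rightarrow> grass" where
  "ximul k f = (\<chi> S. if k \<in> S then lsign k (S - {k}) * f $ (S - {k}) else 0)"

lemma axis_add: "axis S (p + q) = axis S p + (axis S q :: grass)"
  by (simp add: vec_eq_iff axis_def)

lemma axis_uminus: "axis S (- p) = - (axis S p :: grass)"
  by (simp add: vec_eq_iff axis_def)

lemma axis_zero: "axis S 0 = (0 :: grass)"
  by (simp add: vec_eq_iff axis_def)

lemma ximul_add: "ximul k (f + g) = ximul k f + ximul k g"
  by (simp add: ximul_def vec_eq_iff algebra_simps)
lemma pd_add: "pd k (f + g) = pd k f + pd k g"
  by (simp add: pd_def vec_eq_iff algebra_simps)
lemma dt_add: "dt (f + g) = dt f + dt g"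
  by (simp add: dt_def vec_eq_iff pderiv_add)
lemma parity_twist_add: "parity_twist (f + g) = parity_twist f + parity_twist g"
  by (simp add: parity_twist_def vec_eq_iff algebra_simps)
lemma gmul_add_left: "gmul (f + g) h = gmul f h + gmul g h"
  by (simp add: gmul_def vec_eq_iff algebra_simps sum.distrib)
lemma gmul_add_right: "gmul h (f + g) = gmul h f + gmul h g"
  by (simp add: gmul_def vec_eq_iff algebra_simps sum.distrib)

lemma ximul_axis: "ximul k (axis S p) = (if k \<in> S then 0 else axis (insert k S) (lsign k S * p))"
proof -
  have "T - {k} = S \<and> k \<in> T \<longleftrightarrow> T = insert k S \<and> k \<notin> S" for T
    by auto
  then show ?thesis
    by (auto simp: ximul_def vec_eq_iff axis_def)
qed

lemma pd_axis: "pd k (axis S p) = (if k \<in> S then axis (S - {k}) (lsign k (S - {k}) * p) else 0)"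
proof -
  have "insert k T = S \<and> k \<notin> T \<longleftrightarrow> T = S - {k} \<and> k \<in> S" for T
    by auto
  then show ?thesis
    by (auto simp: pd_def vec_eq_iff axis_def lsign_def)
qed

lemma pd_axis_insert: "k \<notin> S \<Longrightarrow> pd k (axis (insert k S) p) = axis S (lsign k S * p)"
  by (simp add: pd_axis)

lemma pd_axis_notin: "k \<notin> S \<Longrightarrow> pd k (axis S p) = 0"
  by (simp add: pd_axis)

lemma dt_axis: "dt (axis S p) = axis S (pderiv p)"
  by (simp add: dt_def vec_eq_iff axis_def)

lemma parity_twist_axis: "parity_twist (axis S p) = axis S ((-1) ^ card S * p)"
  by (simp add: parity_twist_def vec_eq_iff axis_def)

lemma gmul_axis:
  "gmul (axis S p) (axis T q) =
    (if S \<inter> T = {} then axis (S \<union> T) (xi_sign S T * p * q) else 0)"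
proof -
  have "(\<Sum>A\<in>Pow U. xi_sign A (U - A) * axis S p $ A * axis T q $ (U - A)) =
      (\<Sum>A\<in>Pow U. if A = S then xi_sign S (U - S) * p * axis T q $ (U - S) else 0)" for U
    by (intro sum.cong refl) (simp add: axis_def)
  also have "\<dots> U = (if S \<subseteq> U then xi_sign S (U - S) * p * axis T q $ (U - S) else 0)" for U
    by (simp add: sum.delta)
  also have "\<dots> U = (if S \<inter> T = {} then axis (S \<union> T) (xi_sign S T * p * q) else 0) $ U" for U
  proof -
    have "S \<subseteq> U \<and> U - S = T \<longleftrightarrow> U = S \<union> T \<and> S \<inter> T = {}" by auto
    then show ?thesis by (auto simp: axis_def)
  qed
  finally show ?thesis by (simp add: gmul_def vec_eq_iff)
qed

lemmas grass_add = ximul_add pd_add dt_add parity_twist_add gmul_add_left gmul_add_right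
lemmas grass_axis = ximul_axis pd_axis dt_axis parity_twist_axis gmul_axis

lemma gmul_zero [simp]: "gmul 0 f = 0" "gmul f 0 = 0"
  by (simp_all add: gmul_def vec_eq_iff)
lemma ximul_zero [simp]: "ximul k 0 = 0" by (simp add: ximul_def vec_eq_iff)
lemma pd_zero [simp]: "pd k 0 = 0" by (simp add: pd_def vec_eq_iff)
lemma dt_zero [simp]: "dt 0 = 0" by (simp add: dt_def vec_eq_iff)
lemma parity_twist_zero [simp]: "parity_twist 0 = 0" by (simp add: parity_twist_def vec_eq_iff)

lemma ximul_ximul: "ximul i (ximul j f) = - ximul j (ximul i f)"
proof (induction f rule: grass_induct)
  case (axis p S)
  consider "pos i < pos j" | "pos j < pos i" | "i = j"
    using linorder_neqE_nat pos_inject by blast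
  then show ?case
    by cases (auto simp: grass_axis axis_uminus[symmetric] insert_commute lsign_insert algebra_simps)
qed (simp add: grass_add)

lemma pd_ximul: "pd i (ximul j f) = (if i = j then f else 0) - ximul j (pd i f)"
proof (induction f rule: grass_induct)
  case (axis p S)
  consider "i = j" | "pos i < pos j" "i \<in> S" "j \<notin> S" | "pos j < pos i" "i \<in> S" "j \<notin> S"
    | "i \<noteq> j" "i \<notin> S \<or> j \<in> S"
    using linorder_neqE_nat pos_inject by blast
  then show ?case
  proof cases
    case 1
    then show ?thesis
      by (auto simp: grass_axis insert_absorb)
  next
    case 2
    then obtain T where T: "S = insert i T" "i \<notin> T" by (meson mk_disjoint_insert)
    with 2 show ?thesis
      by (auto simp: ximul_axis pd_axis_insert insert_commute[of j i] lsign_insert axis_uminus[symmetric] mult_ac)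
  next
    case 3
    then obtain T where T: "S = insert i T" "i \<notin> T" by (meson mk_disjoint_insert)
    with 3 show ?thesis
      by (auto simp: ximul_axis pd_axis_insert insert_commute[of j i] lsign_insert axis_uminus[symmetric] mult_ac)
  qed (auto simp: grass_axis)
qed (auto simp: grass_add)

lemma ximul_twist: "ximul k (parity_twist f) = - parity_twist (ximul k f)"
  by (induction f rule: grass_induct) (auto simp: grass_axis grass_add axis_uminus[symmetric] algebra_simps)

lemma pd_twist: "pd k (parity_twist f) = - parity_twist (pd k f)"
proof (induction f rule: grass_induct)
  case (axis p S)
  show ?case
  proof (cases "k \<in> S")
    case True
    then obtain T where T: "S = insert k T" "k \<notin> T" by (meson mk_disjoint_insert)
    then show ?thesis by (simp add: parity_twist_axis pd_axis_insert axis_uminus[symmetric] algebra_simps)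
  qed (simp add: grass_axis)
qed (simp add: grass_add)

lemma dt_twist: "dt (parity_twist f) = parity_twist (dt f)"
  by (induction f rule: grass_induct) (simp_all add: grass_axis grass_add)

lemma twist_twist [simp]: "parity_twist (parity_twist f) = f"
  by (simp add: parity_twist_def vec_eq_iff power_add[symmetric] mult.assoc[symmetric] mult_2[symmetric])

lemma dt_ximul: "dt (ximul k f) = ximul k (dt f)"
  by (induction f rule: grass_induct) (simp_all add: grass_axis grass_add)

lemma dt_pd: "dt (pd k f) = pd k (dt f)"
  by (induction f rule: grass_induct) (simp_all add: grass_axis grass_add)

lemma grass_uminus: "ximul k (- f) = - ximul k f" "pd k (- f) = - pd k f" "dt (- f) = - dt f"
  "parity_twist (- f) = - parity_twist f" "gmul (- f) g = - gmul f g" "gmul f (- g) = - gmul f g"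
  by (simp_all add: ximul_def pd_def dt_def parity_twist_def gmul_def vec_eq_iff pderiv_minus sum_negf)

lemma grass_diff: "ximul k (f - g) = ximul k f - ximul k g" "pd k (f - g) = pd k f - pd k g"
  "dt (f - g) = dt f - dt g" "parity_twist (f - g) = parity_twist f - parity_twist g"
  "gmul (f - g) h = gmul f h - gmul g h" "gmul h (f - g) = gmul h f - gmul h g"
  by (simp_all only: diff_conv_add_uminus grass_add grass_uminus)

lemma gmul_ximul_left: "gmul (ximul k f) g = ximul k (gmul f g)"
proof (induction f rule: grass_induct)
  case (axis p S)
  show ?case
  proof (induction g rule: grass_induct)
    case (axis q T)
    show ?case
      by (auto simp: grass_axis xi_sign_insert_left xi_sign_insert_right lsign_Un algebra_simps)
  qed (simp add: grass_add)
qed (simp add: grass_add)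

text \<open>Moving xi_k leftwards past a homogeneous \<open>f\<close> costs (-1)^p(f); putting the
  twist on \<open>f\<close> keeps the identity additive in \<open>f\<close>.\<close>

lemma gmul_ximul_right: "gmul (parity_twist f) (ximul k g) = ximul k (gmul f g)"
proof (induction f rule: grass_induct)
  case (axis p S)
  show ?case
  proof (induction g rule: grass_induct)
    case (axis q T)
    show ?case
      by (auto simp: grass_axis xi_sign_insert_left xi_sign_insert_right lsign_Un
        power_add[symmetric] mult_2[symmetric] algebra_simps)
  qed (simp add: grass_add)
qed (simp add: grass_add)

lemma pd_gmul: "pd k (gmul f g) = gmul (pd k f) g + gmul (parity_twist f) (pd k g)"
proof (induction f rule: grass_induct)
  case (axis p S)
  show ?case
  proof (induction g rule: grass_induct)
    case (axis q T)
    have ins: "\<exists>A'. A = insert k A' \<and> k \<notin> A'" if "k \<in> A" for A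
      using that by (meson mk_disjoint_insert)
    consider "S \<inter> T = {}" "k \<notin> S" "k \<notin> T" | "S \<inter> T = {}" "k \<in> S" "k \<notin> T"
      | "S \<inter> T = {}" "k \<notin> S" "k \<in> T" | "k \<in> S" "k \<in> T" | "S \<inter> T \<noteq> {}" "k \<notin> S \<inter> T"
      by blast
    then show ?case
    proof cases
      case 2
      then obtain S' where S: "S = insert k S'" "k \<notin> S'" using ins by blast
      with 2 show ?thesis
        by (simp add: gmul_axis parity_twist_axis pd_axis_insert pd_axis_notin xi_sign_insert_left[of k S']
          lsign_Un algebra_simps)
    next
      case 3
      then obtain T' where T: "T = insert k T'" "k \<notin> T'" using ins by blast
      with 3 show ?thesis
        by (simp add: gmul_axis parity_twist_axis pd_axis_insert pd_axis_notin xi_sign_insert_right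
          lsign_Un algebra_simps)
    next
      \<comment> \<open>The product itself vanishes. On the right, dropping xi_k from either factor
        leaves the same monomial with opposite signs.\<close>
      case 4
      then obtain S' T' where S: "S = insert k S'" "k \<notin> S'" "T = insert k T'" "k \<notin> T'" using ins by metis
      then show ?thesis
        by (simp add: gmul_axis parity_twist_axis pd_axis_insert pd_axis_notin xi_sign_insert_left
           xi_sign_insert_right lsign_insert axis_uminus[symmetric] axis_add[symmetric] axis_zero algebra_simps)
    next
      \<comment> \<open>An overlap at an index other than \<open>k\<close> makes all three products
        vanish.\<close>
      case 5
      then have "(S - {k}) \<inter> T \<noteq> {}" "S \<inter> (T - {k}) \<noteq> {}" by auto
      with 5 show ?thesis by (simp add: grass_axis)
    qed (auto simp: grass_axis)
  qed (simp add: grass_add)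
qed (simp add: grass_add)

lemma parity_twist_gmul: "parity_twist (gmul f g) = gmul (parity_twist f) (parity_twist g)"
proof (induction f rule: grass_induct)
  case (axis p S)
  show ?case
    by (induction g rule: grass_induct) (simp_all add: grass_axis grass_add card_Un_disjoint power_add algebra_simps)
qed (simp add: grass_add)

lemma dt_gmul: "dt (gmul f g) = gmul (dt f) g + gmul f (dt g)"
proof (induction f rule: grass_induct)
  case (axis p S)
  show ?case
    by (induction g rule: grass_induct)
      (simp_all add: grass_axis grass_add axis_add[symmetric], simp_all add: pderiv_mult algebra_simps)
qed (simp add: grass_add)

lemma gmul_xi_left: "gmul (xi {k}) f = ximul k f"
proof -
  have "xi {k} = axis {k} 1" by (simp add: tmon_def axis_def fun_eq_iff)
  then show ?thesis
    by (induction f rule: grass_induct) (auto simp: grass_axis grass_add lsign_def)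
qed

lemma gmul_one: "gmul (xi {}) f = f" "gmul f (xi {}) = f"
proof -
  have x: "xi {} = axis {} 1" by (simp add: tmon_def axis_def fun_eq_iff)
  show "gmul (xi {}) f = f"
    by (induction f rule: grass_induct) (auto simp: grass_axis grass_add x)
  show "gmul f (xi {}) = f"
    by (induction f rule: grass_induct) (auto simp: grass_axis grass_add x)
qed

section \<open>The bracket with xi_k as a superderivation\<close>

lemma euler_nth: "euler f $ S = of_nat (card S) * f $ S"
proof -
  have "euler f $ S = (\<Sum>i\<in>UNIV. ximul i (pd i f) $ S)"
    by (simp add: euler_def gmul_xi_left)
  also have "\<dots> = (\<Sum>i\<in>UNIV. if i \<in> S then f $ S else 0)"
    by (intro sum.cong refl) (simp add: ximul_def pd_def insert_absorb lsign_def)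
  also have "\<dots> = (\<Sum>i\<in>S. f $ S)"
    by (simp add: sum.If_cases)
  finally show ?thesis by simp
qed

lemma sum_idx: "(\<Sum>i\<in>UNIV. h i) = h I1 + h I2 + h I3 + (h I4 :: 'a::comm_monoid_add)"
  by (simp add: UNIV_idx add.assoc)

text \<open>The operator [xi_k, -]: on xi_k the factor 2 - euler is 1, the t-derivative vanishes,
  and the sum over i reduces to i = k with sign (-1)^p(xi_k) = -1.\<close>

definition adxi :: "idx \<Rightarrow> grass \<Rightarrow> grass" where
  "adxi k f = ximul k (dt f) - pd k f"

lemma euler_xi: "2 *s xi {k} - euler (xi {k}) = xi {k}"
  by (auto simp: vec_eq_iff euler_nth tmon_def)

lemma dt_xi: "dt (xi S) = 0"
  by (simp add: vec_eq_iff dt_def tmon_def monom_0 pderiv_pCons)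

lemma tmon_axis: "tmon m S = axis S (monom 1 m)"
  by (simp add: tmon_def axis_def fun_eq_iff)

lemma pd_twist_xi: "pd i (parity_twist (xi {k})) = (if i = k then - xi {} else 0)"
  by (auto simp: tmon_axis grass_axis axis_uminus grass_uminus)

lemma Kbr_xi_left: "Kbr (xi {k}) g = adxi k g"
proof -
  have "(\<Sum>i\<in>UNIV. gmul (pd i (parity_twist (xi {k}))) (pd i g)) =
      (\<Sum>i\<in>UNIV. if i = k then - pd i g else 0)"
    by (intro sum.cong refl) (simp add: pd_twist_xi grass_uminus gmul_one)
  then show ?thesis
    by (simp add: Kbr_def euler_xi dt_xi gmul_xi_left adxi_def)
qed

lemma euler_diff: "euler (f - g) = euler f - euler g"
  by (simp add: vec_eq_iff euler_nth algebra_simps)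

lemma euler_ximul: "euler (ximul k f) = ximul k (euler f) + ximul k f"
proof -
  have "of_nat (card S) * (l * p) = l * (of_nat (card (S - {k})) * p) + l * p"
    if "k \<in> S" for S and l p :: "complex poly"
  proof -
    have "card S = Suc (card (S - {k}))" using that by (intro card.remove finite)
    then show ?thesis by (simp only: of_nat_Suc) (simp only: algebra_simps mult_1_left)
  qed
  then show ?thesis
    by (simp add: vec_eq_iff euler_nth ximul_def del: card_Diff_insert)
qed

lemma euler_pd: "euler (pd k f) = pd k (euler f) - pd k f"
  by (auto simp: vec_eq_iff euler_nth pd_def algebra_simps)

lemma dt_euler: "dt (euler f) = euler (dt f)"
proof -
  have "pderiv (of_nat n * p) = of_nat n * pderiv p" for n and p :: "complex poly"
    by (induction n) (auto simp: algebra_simps pderiv_add)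
  then show ?thesis
    by (simp add: vec_eq_iff euler_nth dt_def)
qed

lemma pd_pd: "pd i (pd j f) = - pd j (pd i f)"
proof -
  have *: "pd i (pd j (axis S p)) = - pd j (pd i (axis S p))" if "pos i < pos j" for i j S p
  proof (cases "i \<in> S \<and> j \<in> S")
    case True
    have "i \<noteq> j" using that by auto
    define T where "T = S - {i, j}"
    have T: "S = insert i (insert j T)" "S = insert j (insert i T)" "i \<notin> T" "j \<notin> T"
      using True by (auto simp: T_def)
    have "pd j (axis S p) = axis (insert i T) (lsign j (insert i T) * p)"
      unfolding T(2) using T(3,4) \<open>i \<noteq> j\<close> by (simp add: pd_axis_insert)
    moreover have "pd i (axis S p) = axis (insert j T) (lsign i (insert j T) * p)"
      unfolding T(1) using T(3,4) \<open>i \<noteq> j\<close> by (simp add: pd_axis_insert)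
    ultimately show ?thesis
      using T(3,4) that by (simp add: pd_axis_insert lsign_insert axis_uminus[symmetric] mult_ac)
  qed (auto simp: grass_axis)
  show ?thesis
  proof (induction f rule: grass_induct)
    case (axis p S)
    consider "pos i < pos j" | "pos j < pos i" | "i = j"
      using linorder_neqE_nat pos_inject by blast
    then show ?case
      by cases (use *[of i j S p] *[of j i S p] in \<open>auto simp: grass_axis\<close>)
  qed (simp add: grass_add)
qed

lemma pd_adxi: "pd i (adxi k f) = (if i = k then dt f else 0) - adxi k (pd i f)"
  by (simp add: adxi_def grass_diff pd_ximul dt_pd pd_pd[of i k])

lemma dt_adxi: "dt (adxi k f) = adxi k (dt f)"
  by (simp add: adxi_def grass_diff dt_ximul dt_pd)

lemma twist_adxi: "parity_twist (adxi k f) = - adxi k (parity_twist f)"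
  by (simp add: adxi_def grass_diff dt_twist ximul_twist pd_twist)

lemma euler_adxi: "euler (adxi k f) = adxi k (euler f) + (ximul k (dt f) + pd k f)"
  by (simp add: adxi_def euler_diff euler_ximul euler_pd grass_diff dt_euler)

lemma adxi_add: "adxi k (f + g) = adxi k f + adxi k g"
  by (simp add: adxi_def grass_add)

lemma adxi_diff: "adxi k (f - g) = adxi k f - adxi k g"
  by (simp add: adxi_def grass_diff)

lemma adxi_uminus: "adxi k (- f) = - adxi k f"
  by (simp add: adxi_def grass_uminus)

lemma adxi_zero [simp]: "adxi k 0 = 0" by (simp add: adxi_def)

lemma adxi_sum: "adxi k (\<Sum>i\<in>A. h i) = (\<Sum>i\<in>A. adxi k (h i))"
  by (induction A rule: infinite_finite_induct) (simp_all add: adxi_add)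

lemma adxi_gmul: "adxi k (gmul f g) = gmul (adxi k f) g + gmul (parity_twist f) (adxi k g)"
  by (simp add: adxi_def dt_gmul grass_add pd_gmul grass_diff gmul_ximul_left gmul_ximul_right gmul_ximul_right[of "dt f"])

lemma twist_euler: "parity_twist (euler f) = euler (parity_twist f)"
  by (simp add: vec_eq_iff euler_nth parity_twist_def)

lemma vec_smult2: "2 *s f = f + (f :: grass)"
  by (simp add: vec_eq_iff)

lemma adxi_smult2: "adxi k (2 *s f) = 2 *s adxi k f"
  by (simp only: vec_smult2 adxi_add)

lemma twist_smult2: "parity_twist (2 *s f) = 2 *s parity_twist f"
  by (simp only: vec_smult2 parity_twist_add)

text \<open>The Jacobi identity with xi_k as one argument. All constituents of \<open>Kbr\<close>
  commute or anticommute with \<open>adxi k\<close>, except that 2 - euler and the derivatives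
  \<open>pd i\<close> leave corrections, and these cancel each other.\<close>

lemma adxi_Kbr: "adxi k (Kbr f g) = Kbr (adxi k f) g + Kbr (parity_twist f) (adxi k g)"
proof -
  let ?s = parity_twist
  have gxs: "gmul (?s f') (ximul k h) = gmul (ximul k f') h" for f' h
    by (simp add: gmul_ximul_left gmul_ximul_right)
  define N where "N f = 2 *s f - euler f" for f :: grass
  have N: "adxi k (N f) = N (adxi k f) + (ximul k (dt f) + pd k f)" "?s (N f) = N (?s f)" for f
    by (simp_all add: N_def adxi_smult2 adxi_diff euler_adxi twist_smult2 grass_diff twist_euler)
  have "(\<Sum>i\<in>UNIV. adxi k (gmul (pd i (?s f)) (pd i g))) =
      (\<Sum>i\<in>UNIV. gmul (pd i (?s (adxi k f))) (pd i g) + gmul (pd i f) (pd i (adxi k g))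
        + (if i = k then gmul (?s (dt f)) (pd i g) - gmul (pd i f) (dt g) else 0))"
    by (intro sum.cong refl)
      (simp add: adxi_gmul adxi_uminus pd_twist twist_adxi[of k f] pd_adxi grass_uminus grass_diff grass_add pd_adxi[of _ k "?s f"] dt_twist algebra_simps)
  \<comment> \<open>The two terms left over from i = k cancel the \<open>pd k\<close> parts of the
    corrections that \<open>N\<close> contributes; the \<open>ximul\<close> parts of the latter
    cancel among themselves by \<open>gxs\<close>.\<close>
  then have 2: "(\<Sum>i\<in>UNIV. adxi k (gmul (pd i (?s f)) (pd i g))) =
      (\<Sum>i\<in>UNIV. gmul (pd i (?s (adxi k f))) (pd i g)) + (\<Sum>i\<in>UNIV. gmul (pd i f) (pd i (adxi k g)))
        + gmul (?s (dt f)) (pd k g) - gmul (pd k f) (dt g)"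
    by (simp add: sum.distrib algebra_simps)
  have "adxi k (Kbr f g) = adxi k (gmul (N f) (dt g)) - adxi k (gmul (dt f) (N g))
      + (\<Sum>i\<in>UNIV. adxi k (gmul (pd i (?s f)) (pd i g)))"
    by (simp only: Kbr_def N_def adxi_add adxi_diff adxi_sum)
  also have "\<dots> = Kbr (adxi k f) g + Kbr (?s f) (adxi k g)"
    unfolding 2 Kbr_def N_def[symmetric]
    by (simp add: adxi_gmul N dt_adxi dt_twist grass_add grass_diff gxs algebra_simps)
  finally show ?thesis .
qed

lemma sum_Pow_insert:
  assumes "k \<notin> U"
  shows "sum h (Pow (insert k U)) = sum h (Pow U) + (\<Sum>S\<in>Pow (U :: idx set). h (insert k S))"
proof -
  have "inj_on (insert k) (Pow U)" using assms by (auto simp: inj_on_def)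
  moreover have "Pow U \<inter> insert k ` Pow U = {}" using assms by auto
  ultimately show ?thesis
    by (simp add: Pow_insert sum.union_disjoint sum.reindex)
qed

text \<open>On an argument of degree -1 the cocycle is the Berezin integral of the product at t = 0:
  it reads off the coefficient of xi_1234 in xi_k f. This form transforms well under
  \<open>adxi\<close> and \<open>parity_twist\<close>.\<close>

lemma psi_xi_left: "psi (xi {k}) f = - poly (ximul k f $ UNIV) 0"
proof -
  have U: "UNIV \<noteq> {i :: idx}" "{i} \<noteq> UNIV - {j :: idx}" for i j
  proof -
    have c: "card (UNIV :: idx set) = 4" by (simp add: UNIV_idx)
    then have c': "card (UNIV - {j :: idx}) = 3" by (simp add: card_Diff_subset)
    show "UNIV \<noteq> {i}" using c by (metis card_1_singleton_iff numeral_eq_one_iff One_nat_def semiring_norm(83))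
    show "{i} \<noteq> UNIV - {j}" using c' by (metis card_1_singleton_iff numeral_eq_one_iff One_nat_def semiring_norm(84))
  qed
  have l: "poly (lsign k (UNIV - {k})) 0 = (-1) ^ (pos k - 1)"
  proof -
    have "UNIV - {I1} = {I2, I3, I4}" "UNIV - {I2} = {I1, I3, I4}" "UNIV - {I3} = {I1, I2, I4}" "UNIV - {I4} = {I1, I2, I3}"
      by (auto simp: UNIV_idx)
    then show ?thesis by (cases k) (simp_all add: lsign_insert)
  qed
  have c: "coeff (xi {k} $ T) 0 = (if T = {k} then 1 else 0)" for T
    by (simp add: tmon_def)
  have "(\<Sum>i\<in>UNIV. (-1) ^ (pos i - 1) * (coeff (xi {k} $ {i}) 0 * coeff (f $ (UNIV - {i})) 0 +
        coeff (xi {k} $ (UNIV - {i})) 0 * coeff (f $ {i}) 0)) =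
      (\<Sum>i\<in>UNIV. if i = k then (-1) ^ (pos k - 1) * coeff (f $ (UNIV - {k})) 0 else 0)"
    unfolding c using U(2) by (intro sum.cong refl) auto
  then have "psi (xi {k}) f = - ((-1) ^ (pos k - 1) * coeff (f $ (UNIV - {k})) 0)"
    using U(1)[of k] by (simp add: psi_def Let_def c)
  then show ?thesis
    by (simp add: ximul_def l flip: poly_0_coeff_0)
qed

text \<open>The cocycle condition with xi_k as one argument. Since \<open>psi\<close> sees only
  constant terms in t, both sides are polynomials in the values at 0 of the coefficients of
  \<open>f\<close> and \<open>g\<close> and of their first derivatives.\<close>

lemma psi_adxi: "psi (xi {k}) (Kbr f g) = psi (adxi k f) g + psi (parity_twist f) (adxi k g)"
proof -
  have D: "UNIV - {I1} = {I2, I3, I4}" "UNIV - {I2} = {I1, I3, I4}" "UNIV - {I3} = {I1, I2, I4}" "UNIV - {I4} = {I1, I2, I3}"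
    by (auto simp: UNIV_idx)
  have i: "insert I2 (insert I1 S) = insert I1 (insert I2 S)" "insert I3 (insert I1 S) = insert I1 (insert I3 S)"
    "insert I4 (insert I1 S) = insert I1 (insert I4 S)" "insert I3 (insert I2 S) = insert I2 (insert I3 S)"
    "insert I4 (insert I2 S) = insert I2 (insert I4 S)" "insert I4 (insert I3 S) = insert I3 (insert I4 S)" for S
    by auto
  \<comment> \<open>Evaluation at 0 is a ring homomorphism, so it passes through the products and
    sums inside \<open>gmul\<close>.\<close>
  have p: "coeff p 0 = poly p 0" for p :: "complex poly" by (simp add: poly_0_coeff_0)
  have u: "poly (ximul k f $ UNIV) 0 = poly (lsign k (UNIV - {k})) 0 * poly (f $ (UNIV - {k})) 0" for k f
    by (simp add: ximul_def)
  note conc = lsign_insert xi_sign_insert_left D i sum_idx insert_Diff_if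
  have psi: "psi f g = - 2 * poly (f $ {}) 0 * poly (g $ {I1, I2, I3, I4}) 0 + 2 * poly (f $ {I1, I2, I3, I4}) 0 * poly (g $ {}) 0
    - (poly (f $ {I1}) 0 * poly (g $ {I2, I3, I4}) 0 + poly (f $ {I2, I3, I4}) 0 * poly (g $ {I1}) 0)
    + (poly (f $ {I2}) 0 * poly (g $ {I1, I3, I4}) 0 + poly (f $ {I1, I3, I4}) 0 * poly (g $ {I2}) 0)
    - (poly (f $ {I3}) 0 * poly (g $ {I1, I2, I4}) 0 + poly (f $ {I1, I2, I4}) 0 * poly (g $ {I3}) 0)
    + (poly (f $ {I4}) 0 * poly (g $ {I1, I2, I3}) 0 + poly (f $ {I1, I2, I3}) 0 * poly (g $ {I4}) 0)" for f g
    by (simp add: psi_def Let_def sum_idx p UNIV_idx insert_Diff_if algebra_simps)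
  have K: "poly (Kbr f g $ U) 0 = poly (gmul (2 *s f - euler f) (dt g) $ U) 0
      - poly (gmul (dt f) (2 *s g - euler g) $ U) 0
     + poly (gmul (pd I1 (parity_twist f)) (pd I1 g) $ U) 0
     + poly (gmul (pd I2 (parity_twist f)) (pd I2 g) $ U) 0
     + poly (gmul (pd I3 (parity_twist f)) (pd I3 g) $ U) 0
     + poly (gmul (pd I4 (parity_twist f)) (pd I4 g) $ U) 0" for U
    by (simp add: Kbr_def sum_idx)
  have L: "poly (adxi k f $ S) 0 = poly (ximul k (dt f) $ S) 0 - poly (pd k f $ S) 0" for k f S
    by (simp add: adxi_def)
  have tw: "poly (parity_twist f $ S) 0 = (-1) ^ card S * poly (f $ S) 0" for f S
    by (simp add: parity_twist_def)
  have dt: "poly (dt f $ S) 0 = poly (pderiv (f $ S)) 0" for f S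
    by (simp add: dt_def)
  have e: "poly ((2 *s f - euler f) $ S) 0 = (2 - of_nat (card S)) * poly (f $ S) 0" for f S
    by (simp add: euler_nth algebra_simps)
  have pd: "poly (pd k f $ S) 0 = (if k \<in> S then 0 else poly (lsign k S) 0 * poly (f $ insert k S) 0)" for k f S
    by (simp add: pd_def lsign_def)
  have ximul: "poly (ximul k f $ S) 0 = (if k \<in> S then poly (lsign k (S - {k})) 0 * poly (f $ (S - {k})) 0 else 0)" for k f S
    by (simp add: ximul_def)
  have gm: "poly (gmul f g $ U) 0 = (\<Sum>S\<in>Pow U. poly (xi_sign S (U - S)) 0 * poly (f $ S) 0 * poly (g $ (U - S)) 0)" for f g U
    by (simp add: gmul_def poly_sum)
  show ?thesis
    unfolding psi_xi_left u
    by (cases k; simp only: psi D K L;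
        simp add: gm sum_Pow_insert conc tw dt e pd ximul del: vector_minus_component vector_add_component; algebra)
qed

section \<open>The Lie superalgebra\<close>

text \<open>The parity automorphism. Writing (-1)^p(a) a as \<open>atwist a\<close> turns sign rules
  into identities that are linear in \<open>a\<close> and hold for inhomogeneous elements.\<close>

definition atwist :: "ann \<Rightarrow> ann" where
  "atwist a = (parity_twist (fst a), snd a)"

lemma ascale_add_right: "ascale c (a + b) = ascale c a + ascale c b"
  by (simp add: ascale_def vec_eq_iff smult_add_right algebra_simps)
lemma ascale_add_left: "ascale (c + d) a = ascale c a + ascale d a"
  by (simp add: ascale_def vec_eq_iff smult_add_left algebra_simps)
lemma ascale_ascale [simp]: "ascale c (ascale d a) = ascale (c * d) a"
  by (simp add: ascale_def vec_eq_iff)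
lemma ascale_one [simp]: "ascale 1 a = a"
  by (simp add: ascale_def vec_eq_iff prod_eq_iff)
lemma ascale_zero [simp]: "ascale 0 a = 0" "ascale c 0 = 0"
  by (simp_all add: ascale_def vec_eq_iff prod_eq_iff)
lemma ascale_minus_one: "ascale (-1) a = - a"
  by (simp add: ascale_def vec_eq_iff prod_eq_iff)
lemma ascale_uminus: "ascale c (- a) = - ascale c a" "ascale (- c) a = - ascale c a"
  by (simp_all add: ascale_def vec_eq_iff prod_eq_iff)
lemma ascale_sum: "ascale c (\<Sum>i\<in>A. h i) = (\<Sum>i\<in>A. ascale c (h i))"
  by (induction A rule: infinite_finite_induct) (simp_all add: ascale_add_right)

lemma atwist_add: "atwist (a + b) = atwist a + atwist b"
  by (simp add: atwist_def parity_twist_add)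
lemma atwist_ascale: "atwist (ascale c a) = ascale c (atwist a)"
  by (simp add: atwist_def ascale_def parity_twist_def vec_eq_iff)
lemma atwist_atwist [simp]: "atwist (atwist a) = a"
  by (simp add: atwist_def)
lemma atwist_zero [simp]: "atwist 0 = 0"
  by (simp add: atwist_def zero_prod_def)
lemma atwist_uminus: "atwist (- a) = - atwist a"
  using atwist_ascale[of "-1" a] by (simp add: ascale_minus_one)
lemma atwist_sum: "atwist (\<Sum>i\<in>A. h i) = (\<Sum>i\<in>A. atwist (h i))"
  by (induction A rule: infinite_finite_induct) (simp_all add: atwist_add)

lemma Kbr_add: "Kbr (f + g) h = Kbr f h + Kbr g h" "Kbr h (f + g) = Kbr h f + Kbr h g"
proof -
  define N where "N f = 2 *s f - euler f" for f :: grass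
  have N: "N (f + g) = N f + N g"
    by (simp add: N_def vec_eq_iff euler_nth algebra_simps)
  show "Kbr (f + g) h = Kbr f h + Kbr g h" "Kbr h (f + g) = Kbr h f + Kbr h g"
    unfolding Kbr_def N_def[symmetric] N by (simp_all add: grass_add sum.distrib algebra_simps)
qed

lemma abr_add_left: "abr (a + b) c = abr a c + abr b c"
  by (simp add: abr_def Kbr_add psi_def Let_def sum_idx algebra_simps)
lemma abr_add_right: "abr c (a + b) = abr c a + abr c b"
  by (simp add: abr_def Kbr_add psi_def Let_def sum_idx algebra_simps)

abbreviation gscale :: "complex \<Rightarrow> grass \<Rightarrow> grass" where
  "gscale c f \<equiv> (\<chi> S. smult c (f $ S))"

lemma smult_sum_right: "smult c (\<Sum>i\<in>A. h i) = (\<Sum>i\<in>A. smult c (h i))"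
  by (induction A rule: infinite_finite_induct) (simp_all add: smult_add_right)

lemma gscale_ops: "dt (gscale c f) = gscale c (dt f)" "pd k (gscale c f) = gscale c (pd k f)" "ximul k (gscale c f) = gscale c (ximul k f)"
  "parity_twist (gscale c f) = gscale c (parity_twist f)"
  "2 *s gscale c f - euler (gscale c f) = gscale c (2 *s f - euler f)"
  "gmul (gscale c f) g = gscale c (gmul f g)" "gmul f (gscale c g) = gscale c (gmul f g)"
  by (simp_all add: dt_def pd_def ximul_def parity_twist_def gmul_def euler_nth vec_eq_iff pderiv_smult smult_diff_right smult_sum_right)

lemma Kbr_gscale: "Kbr (gscale c f) g = gscale c (Kbr f g)" "Kbr f (gscale c g) = gscale c (Kbr f g)"
proof -
  have a: "gscale c f' - gscale c g' + (\<Sum>i\<in>UNIV. gscale c (h i)) = gscale c (f' - g' + (\<Sum>i\<in>UNIV. h i))" for f' g' and h :: "idx \<Rightarrow> grass"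
    by (simp add: vec_eq_iff sum_idx smult_diff_right smult_add_right)
  show "Kbr (gscale c f) g = gscale c (Kbr f g)" "Kbr f (gscale c g) = gscale c (Kbr f g)"
    unfolding Kbr_def gscale_ops a[symmetric] by simp_all
qed

lemma abr_ascale_left: "abr (ascale c a) b = ascale c (abr a b)"
proof -
  have "psi (gscale c f) g = c * psi f g" for f g
    by (simp add: psi_def Let_def sum_idx algebra_simps)
  then show ?thesis by (simp add: abr_def ascale_def Kbr_gscale)
qed
lemma abr_ascale_right: "abr a (ascale c b) = ascale c (abr a b)"
proof -
  have "psi f (gscale c g) = c * psi f g" for f g
    by (simp add: psi_def Let_def sum_idx algebra_simps)
  then show ?thesis by (simp add: abr_def ascale_def Kbr_gscale)
qed
lemma abr_uminus: "abr (- a) b = - abr a b" "abr a (- b) = - abr a b"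
  using abr_ascale_left[of "-1" a b] abr_ascale_right[of a "-1" b] by (simp_all add: ascale_minus_one)
lemma abr_elt_uminus: "abr (elt (- f)) b = - abr (elt f) b" "abr a (elt (- f)) = - abr a (elt f)"
  using abr_uminus[of "elt f" b] abr_uminus(2)[of a "elt f"] by simp_all
lemma abr_diff: "abr (a - a') b = abr a b - abr a' b" "abr a (b - b') = abr a b - abr a b'"
  using abr_add_left[of a "- a'" b] abr_add_right[of a b "- b'"] by (simp_all add: abr_uminus)
lemma abr_zero [simp]: "abr 0 a = 0" "abr a 0 = 0"
  using abr_ascale_left[of 0 a a] abr_ascale_right[of a 0 a] by simp_all
lemma abr_sum_right: "abr a (\<Sum>i\<in>A. h i) = (\<Sum>i\<in>A. abr a (h i))"
  by (induction A rule: infinite_finite_induct) (simp_all add: abr_add_right)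

lemma abr_central [simp]: "abr central a = 0" "abr a central = 0"
proof -
  have "Kbr 0 f = 0" "Kbr f 0 = 0" for f
    by (simp_all add: Kbr_def euler_def)
  then show "abr central a = 0" "abr a central = 0"
    by (simp_all add: abr_def central_def psi_def zero_prod_def)
qed

lemma twist_Kbr: "parity_twist (Kbr f g) = Kbr (parity_twist f) (parity_twist g)"
proof -
  have s: "parity_twist (\<Sum>i\<in>UNIV. h i) = (\<Sum>i\<in>UNIV. parity_twist (h i))" for h :: "idx \<Rightarrow> grass"
    by (simp add: sum_idx parity_twist_add)
  show ?thesis
    by (simp add: Kbr_def s grass_add grass_diff parity_twist_gmul dt_twist twist_smult2 twist_euler pd_twist grass_uminus)
qed

lemma psi_twist: "psi (parity_twist f) (parity_twist g) = psi f g"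
proof -
  have c: "coeff (parity_twist f $ S) 0 = (-1) ^ card S * coeff (f $ S) 0" for f S
    by (simp add: parity_twist_def flip: poly_0_coeff_0)
  have U: "card (UNIV :: idx set) = 4" by (simp add: UNIV_idx)
  then have U': "card (UNIV - {k :: idx}) = 3" for k by (simp add: card_Diff_subset)
  show ?thesis unfolding psi_def Let_def c U U' by simp
qed

lemma atwist_abr: "atwist (abr a b) = abr (atwist a) (atwist b)"
  by (simp add: atwist_def abr_def twist_Kbr psi_twist)

lemma psi_twist_xi: "psi (xi {k}) (parity_twist f) = - psi (xi {k}) f"
proof -
  have U: "card (UNIV :: idx set) = 4" by (simp add: UNIV_idx)
  then show ?thesis
    by (simp add: psi_xi_left ximul_twist) (simp add: parity_twist_def)
qed

text \<open>Right brackets are the natural ones here: moving \<open>a\<close> to the right past an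
  odd generator w in Ind(F) replaces a w by +-w a + [a, w].\<close>

definition brxi :: "idx \<Rightarrow> ann \<Rightarrow> ann" where
  "brxi k a = abr a (elt (xi {k}))"

lemma abr_xi_left: "abr (elt (xi {k})) a = (adxi k (fst a), psi (xi {k}) (fst a))"
  by (simp add: abr_def Kbr_xi_left)

lemma psi_xi_right: "psi f (xi {k}) = psi (xi {k}) f"
proof -
  have *: "UNIV \<noteq> {k}" by (metis card_1_singleton_iff idx.distinct(1) insertI1 singletonD UNIV_I)
  show ?thesis using * by (simp add: psi_def Let_def tmon_def algebra_simps)
qed

lemma Kbr_xi_right: "Kbr f (xi {k}) = - adxi k (parity_twist f)"
proof -
  have "gmul g (xi {k}) = ximul k (parity_twist g)" for g
  proof -
    have "ximul k (xi {}) = xi {k}" by (simp add: tmon_axis grass_axis)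
    then show ?thesis using gmul_ximul_right[of "parity_twist g" k "xi {}"] by (simp add: gmul_one)
  qed
  moreover have "pd i (xi {k}) = (if i = k then xi {} else 0)" for i
    by (simp add: tmon_axis grass_axis)
  then have "(\<Sum>i\<in>UNIV. gmul (pd i (parity_twist f)) (pd i (xi {k}))) = (\<Sum>i\<in>UNIV. if i = k then pd i (parity_twist f) else 0)"
    by (intro sum.cong refl) (simp add: gmul_one)
  ultimately show ?thesis
    by (simp add: Kbr_def dt_xi euler_xi adxi_def dt_twist)
qed

text \<open>Super skew-symmetry with an odd second argument: the sign is -(-1)^p(a).\<close>

lemma brxi_eq: "brxi k a = - abr (elt (xi {k})) (atwist a)"
  by (simp add: brxi_def abr_xi_left abr_def[of a] Kbr_xi_right atwist_def psi_xi_right psi_twist_xi)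

lemma abr_xi_eq: "abr (elt (xi {k})) a = - brxi k (atwist a)"
  by (simp add: brxi_eq)

lemma atwist_xi: "atwist (elt (xi {k})) = - elt (xi {k})"
  by (simp add: atwist_def tmon_axis grass_axis axis_uminus)

lemma lbr_abr: "abr (elt (xi {k})) (abr a b) =
    abr (abr (elt (xi {k})) a) b + abr (atwist a) (abr (elt (xi {k})) b)"
  by (simp add: abr_xi_left) (simp add: abr_def atwist_def adxi_Kbr psi_adxi)

text \<open>Jacobi in terms of right brackets; the twist sits on \<open>b\<close>, the element that
  xi_k has to cross in order to reach \<open>a\<close>.\<close>

lemma brxi_abr: "brxi k (abr a b) = abr (brxi k a) (atwist b) + abr a (brxi k b)"
  by (simp add: brxi_eq atwist_abr lbr_abr abr_uminus)

lemma brxi_add: "brxi k (a + b) = brxi k a + brxi k b"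
  by (simp add: brxi_def abr_add_left)
lemma brxi_ascale: "brxi k (ascale c a) = ascale c (brxi k a)"
  by (simp add: brxi_def abr_ascale_left)
lemma brxi_uminus: "brxi k (- a) = - brxi k a"
  by (simp add: brxi_def abr_uminus)
lemma brxi_sum: "brxi k (\<Sum>i\<in>A. h i) = (\<Sum>i\<in>A. brxi k (h i))"
  by (induction A rule: infinite_finite_induct) (simp_all add: brxi_add, simp_all add: brxi_def)

lemma abr_one_right: "abr a (elt (xi {})) = (- (2 *s dt (fst a)), 2 * poly (fst a $ UNIV) 0)"
  and abr_one_left: "abr (elt (xi {})) a = (2 *s dt (fst a), - (2 * poly (fst a $ UNIV) 0))"
proof -
  let ?f = "fst a"
  have pd: "pd i (xi {}) = 0" for i by (simp add: tmon_axis grass_axis)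
  have e: "2 *s xi {} - euler (xi {}) = 2 *s xi {}" by (auto simp: vec_eq_iff euler_nth tmon_def)
  have g: "gmul g (2 *s xi {}) = 2 *s g" "gmul (2 *s xi {}) g = 2 *s g" for g
    by (simp_all only: vec_smult2 grass_add gmul_one)
  have t: "parity_twist (xi {}) = xi {}" by (simp add: tmon_axis grass_axis)
  have U: "UNIV - {i} \<noteq> {}" for i :: idx by (cases i) (auto simp: UNIV_idx)
  have psi: "psi ?f (xi {}) = 2 * poly (?f $ UNIV) 0" "psi (xi {}) ?f = - (2 * poly (?f $ UNIV) 0)"
    using U by (simp_all add: psi_def Let_def tmon_def poly_0_coeff_0)
  show "abr a (elt (xi {})) = (- (2 *s dt ?f), 2 * poly (?f $ UNIV) 0)"
    "abr (elt (xi {})) a = (2 *s dt ?f, - (2 * poly (?f $ UNIV) 0))"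
    by (simp_all add: abr_def psi Kbr_def dt_xi pd e g t)
qed

text \<open>Jacobi with two odd arguments together with [xi_j, xi_k] = -delta_jk. The first
  components follow from the Clifford relations of \<open>ximul\<close> and \<open>pd\<close>, the
  central ones from \<open>psi_xi_left\<close>.\<close>

lemma brxi_brxi: "brxi j (brxi k a) + brxi k (brxi j a) =
    (if j = k then abr a (elt (- xi {})) else 0)"
proof -
  let ?f = "fst a"
  have 1: "brxi j (brxi k a) = - abr (elt (xi {j})) (abr (elt (xi {k})) a)" for j k
    by (simp add: brxi_eq atwist_abr atwist_xi abr_uminus abr_elt_uminus atwist_uminus)
  have 2: "adxi j (adxi k ?f) + adxi k (adxi j ?f) = (if j = k then - (2 *s dt ?f) else 0)"
    by (simp add: adxi_def grass_diff dt_ximul dt_pd pd_ximul ximul_ximul[of j k] pd_pd[of j k] vec_eq_iff)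
  have gp: "ximul j (pd k ?f) $ UNIV = (if j = k then ?f $ UNIV else 0)" for j k
    using pd_ximul[of k j ?f, THEN arg_cong, of "\<lambda>h. h $ UNIV"] by (simp add: pd_def split: if_splits)
  have 3: "psi (xi {j}) (adxi k ?f) + psi (xi {k}) (adxi j ?f) = (if j = k then 2 * poly (?f $ UNIV) 0 else 0)"
    by (simp add: psi_xi_left adxi_def grass_diff gp ximul_ximul[of j k])
  have "brxi j (brxi k a) + brxi k (brxi j a) = - (adxi j (adxi k ?f) + adxi k (adxi j ?f),
      psi (xi {j}) (adxi k ?f) + psi (xi {k}) (adxi j ?f))"
    unfolding 1 by (simp add: abr_xi_left)
  then show ?thesis
    unfolding 2 3 abr_elt_uminus abr_one_right by (simp add: zero_prod_def)
qed

section \<open>The isotropic basis of degree $-1$\<close>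

datatype widx = W11 | W12 | W21 | W22

primrec wcoef :: "widx \<Rightarrow> idx \<Rightarrow> complex" where
  "wcoef W11 k = (case k of I1 \<Rightarrow> \<i> | I2 \<Rightarrow> 1 | _ \<Rightarrow> 0)"
| "wcoef W22 k = (case k of I1 \<Rightarrow> - \<i> | I2 \<Rightarrow> 1 | _ \<Rightarrow> 0)"
| "wcoef W12 k = (case k of I3 \<Rightarrow> \<i> | I4 \<Rightarrow> - 1 | _ \<Rightarrow> 0)"
| "wcoef W21 k = (case k of I3 \<Rightarrow> \<i> | I4 \<Rightarrow> 1 | _ \<Rightarrow> 0)"

definition welt :: "widx \<Rightarrow> ann" where
  "welt j = (\<Sum>k\<in>UNIV. ascale (wcoef j k) (elt (xi {k})))"

text \<open>The sum over \<open>k\<close> takes the values 2, 0, -2. Halving it, with zeta = -2 in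
  compensation, leaves structure constants 1, 0, -1; only w11 with w22 and w12 with w21 pair
  nontrivially.\<close>

definition gram :: "widx \<Rightarrow> widx \<Rightarrow> complex" where
  "gram i j = (\<Sum>k\<in>UNIV. wcoef i k * wcoef j k) / 2"

text \<open>The relations of the $w$'s are $w_iw_j + w_jw_i = \mathrm{gram}(i,j)\,\zeta$, where $\zeta = -2\cdot 1$.\<close>

definition zeta :: ann where
  "zeta = ascale 2 (elt (- xi {}))"

definition brw :: "widx \<Rightarrow> ann \<Rightarrow> ann" where
  "brw j a = abr a (welt j)"

lemma brw_sum: "brw j a = (\<Sum>k\<in>UNIV. ascale (wcoef j k) (brxi k a))"
  by (simp add: brw_def welt_def abr_sum_right abr_ascale_right brxi_def)

lemma brw_add: "brw k (a + b) = brw k a + brw k b"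
  by (simp add: brw_def abr_add_left)
lemma brw_ascale: "brw k (ascale c a) = ascale c (brw k a)"
  by (simp add: brw_def abr_ascale_left)
lemma brw_uminus: "brw k (- a) = - brw k a"
  by (simp add: brw_def abr_uminus)

lemma ascale_sum_left: "ascale (\<Sum>i\<in>A. h i) a = (\<Sum>i\<in>A. ascale (h i) a)"
  by (induction A rule: infinite_finite_induct) (simp_all add: ascale_add_left)

lemma gram_simps [simp]:
  "gram W11 W11 = 0" "gram W11 W12 = 0" "gram W11 W21 = 0" "gram W11 W22 = 1"
  "gram W12 W11 = 0" "gram W12 W12 = 0" "gram W12 W21 = -1" "gram W12 W22 = 0"
  "gram W21 W11 = 0" "gram W21 W12 = -1" "gram W21 W21 = 0" "gram W21 W22 = 0"
  "gram W22 W11 = 1" "gram W22 W12 = 0" "gram W22 W21 = 0" "gram W22 W22 = 0"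
  by (simp_all add: gram_def sum_idx)

lemma gram_self [simp]: "gram k k = 0"
  by (cases k) auto

lemma brw_brw: "brw i (brw j a) + brw j (brw i a) = ascale (gram i j) (abr a zeta)"
proof -
  have e: "brw i (brw j a) = (\<Sum>k\<in>UNIV. \<Sum>l\<in>UNIV. ascale (wcoef i k * wcoef j l) (brxi k (brxi l a)))" for i j
    by (simp add: brw_sum brxi_sum brxi_ascale ascale_sum)
  have "brw j (brw i a) = (\<Sum>k\<in>UNIV. \<Sum>l\<in>UNIV. ascale (wcoef i k * wcoef j l) (brxi l (brxi k a)))"
    unfolding e by (subst sum.swap) (simp add: mult.commute)
  then have "brw i (brw j a) + brw j (brw i a) =
      (\<Sum>k\<in>UNIV. \<Sum>l\<in>UNIV. ascale (wcoef i k * wcoef j l) (brxi k (brxi l a) + brxi l (brxi k a)))"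
    by (simp add: e sum.distrib ascale_add_right)
  also have "\<dots> = (\<Sum>k\<in>UNIV. \<Sum>l\<in>UNIV. if k = l then ascale (wcoef i k * wcoef j k) (abr a (elt (- xi {}))) else 0)"
    unfolding brxi_brxi by (intro sum.cong refl) auto
  also have "\<dots> = ascale (\<Sum>k\<in>UNIV. wcoef i k * wcoef j k) (abr a (elt (- xi {})))"
    by (simp add: ascale_sum_left)
  finally show ?thesis
    by (simp add: gram_def zeta_def abr_ascale_right)
qed

text \<open>Isotropy: \<open>gram k k\<close> is 0, and 2 is invertible.\<close>

lemma brw_self: "brw k (brw k a) = 0"
proof -
  have "ascale 2 (brw k (brw k a)) = 0"
    using brw_brw[of k k a] ascale_add_left[of 1 1 "brw k (brw k a)"] by simp
  then have "ascale (1/2) (ascale 2 (brw k (brw k a))) = 0" by (simp only: ascale_zero)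
  then show ?thesis by simp
qed

lemma atwist_welt: "atwist (welt j) = - welt j"
  by (simp add: welt_def atwist_sum atwist_ascale atwist_xi ascale_uminus(1)[symmetric] flip: sum_negf)

lemma atwist_zeta: "atwist zeta = zeta"
  by (simp add: zeta_def atwist_ascale) (simp add: atwist_def grass_uminus tmon_axis grass_axis)

lemma brw_atwist: "brw k (atwist a) = - atwist (brw k a)"
  by (simp add: brw_def atwist_abr atwist_welt abr_uminus)

lemma abr_welt_left: "abr (welt j) a = - brw j (atwist a)"
proof -
  have s: "abr (\<Sum>k\<in>A. h k) b = (\<Sum>k\<in>A. abr (h k) b)" for A :: "idx set" and h b
    by (induction A rule: infinite_finite_induct) (simp_all add: abr_add_left)
  show ?thesis
    by (simp add: welt_def s abr_ascale_left abr_xi_eq ascale_uminus sum_negf brw_sum)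
qed

lemma brw_abr: "brw k (abr a b) = abr (brw k a) (atwist b) + abr a (brw k b)"
proof -
  have s: "abr (\<Sum>k\<in>A. h k) b = (\<Sum>k\<in>A. abr (h k) b)" for A :: "idx set" and h b
    by (induction A rule: infinite_finite_induct) (simp_all add: abr_add_left)
  show ?thesis
    by (simp add: brw_sum brxi_abr ascale_add_right sum.distrib s abr_sum_right abr_ascale_left abr_ascale_right)
qed

lemma brxi_const: "brxi k (elt (xi {})) = 0"
proof -
  have "Kbr (xi {}) (xi {k}) = 0"
    by (simp add: Kbr_xi_right adxi_def dt_twist dt_xi) (simp add: tmon_axis grass_axis)
  moreover have "psi (xi {}) (xi {k}) = 0"
  proof -
    have "UNIV \<noteq> {k}" by (metis card_1_singleton_iff idx.distinct(1) insertI1 singletonD UNIV_I)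
    moreover have "UNIV - {i} \<noteq> {}" for i :: idx by (cases i) (auto simp: UNIV_idx)
    ultimately show ?thesis by (simp add: psi_def Let_def tmon_def)
  qed
  ultimately show ?thesis by (simp add: brxi_def abr_def zero_prod_def)
qed

lemma brw_zeta: "brw k zeta = 0"
proof -
  have "elt (- xi {}) = - elt (xi {})" by simp
  then have "brxi k (elt (- xi {})) = 0" for k by (simp only: brxi_uminus brxi_const) simp
  then show ?thesis by (simp add: brw_sum zeta_def brxi_ascale)
qed

lemma brxi_xi: "brxi k (elt (xi {j})) = (if j = k then elt (- xi {}) else 0)"
proof -
  have pd: "pd j (xi {k}) = (if j = k then xi {} else 0)"
    by (simp add: tmon_axis grass_axis)
  have "{j, k} \<noteq> UNIV"
  proof
    assume "{j, k} = UNIV"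
    moreover have "card {j, k} \<le> 2" by (simp add: card_insert_if)
    moreover have "card (UNIV :: idx set) = 4" by (simp add: UNIV_idx)
    ultimately show False by simp
  qed
  then have "ximul j (xi {k}) $ UNIV = 0"
    unfolding tmon_axis ximul_axis by (auto simp: axis_def)
  then show ?thesis
    by (simp add: brxi_def abr_xi_left adxi_def dt_xi pd psi_xi_left zero_prod_def)
qed

lemma brw_welt: "brw k (welt j) = ascale (gram j k) zeta"
proof -
  have "brw k (welt j) = (\<Sum>l\<in>UNIV. \<Sum>i\<in>UNIV. if i = l then ascale (wcoef k l * wcoef j l) (elt (- xi {})) else 0)"
    unfolding brw_sum welt_def brxi_sum brxi_ascale brxi_xi ascale_sum by (intro sum.cong refl) auto
  then show ?thesis
    by (simp add: gram_def zeta_def ascale_sum_left[symmetric] mult.commute)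
qed

lemma brw_abr_zeta: "brw k (abr a zeta) = abr (brw k a) zeta"
  by (simp add: brw_abr atwist_zeta brw_zeta)

lemma atwist_abr_zeta: "atwist (abr a zeta) = abr (atwist a) zeta"
  by (simp add: atwist_abr atwist_zeta)

lemma abr_zeta_left: "abr zeta a = - abr a zeta"
  unfolding zeta_def abr_ascale_left abr_ascale_right abr_elt_uminus abr_one_right abr_one_left
  by (simp add: ascale_uminus[symmetric])

section \<open>Adjoining odd generators\<close>

declare split_paired_All [simp del] split_paired_Ex [simp del]

interpretation fs: vector_space "fscale :: complex \<Rightarrow> 'f::g0_module \<Rightarrow> 'f"
  by (rule vector_space_fscale)

text \<open>One scaling \<open>scl\<close> for F[zeta], for its iterated squares and later for
  \<open>ind\<close>, so that linearity of maps between different stages of the model is a single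
  predicate.\<close>

class cspace = ab_group_add +
  fixes scl :: "complex \<Rightarrow> 'a \<Rightarrow> 'a"
  assumes scl_add_right: "scl c (x + y) = scl c x + scl c y"
    and scl_add_left: "scl (c + d) x = scl c x + scl d x"
    and scl_scl [simp]: "scl c (scl d x) = scl (c * d) x"
    and scl_one [simp]: "scl 1 x = x"
begin

lemma scl_zero_left [simp]: "scl 0 x = 0"
  using scl_add_left[of 0 0 x] by simp

lemma scl_zero_right [simp]: "scl c 0 = 0"
  using scl_add_right[of c 0 0] by simp

lemma scl_uminus_left: "scl (- c) x = - scl c x"
  using scl_add_left[of c "- c" x] by (simp add: eq_neg_iff_add_eq_0 add.commute)

lemma scl_uminus_right: "scl c (- x) = - scl c x"
  using scl_add_right[of c x "- x"] by (simp add: eq_neg_iff_add_eq_0 add.commute)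

end

instantiation prod :: (cspace, cspace) cspace
begin
definition "scl c x = (scl c (fst x), scl c (snd x))"
instance
  by standard (simp_all add: scl_prod_def scl_add_right scl_add_left)
end

instantiation poly :: (g0_module) cspace
begin
definition "scl c p = map_poly (fscale c) p"

lemma coeff_scl: "coeff (scl c p) n = fscale c (coeff p n)"
  by (simp add: scl_poly_def coeff_map_poly)

instance
  by standard (simp_all add: poly_eq_iff coeff_scl fs.scale_right_distrib fs.scale_left_distrib)
end

lemma scl_pCons [simp]: "scl c (pCons v p) = pCons (fscale c v) (scl c p)"
  by (simp add: poly_eq_iff coeff_scl coeff_pCons split: nat.split)

lemma scl_Pair [simp]: "scl c (x, y) = (scl c x, scl c y)"
  by (simp add: scl_prod_def)

definition linmap :: "('a::cspace \<Rightarrow> 'b::cspace) \<Rightarrow> bool" where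
  "linmap f \<longleftrightarrow> (\<forall>x y. f (x + y) = f x + f y) \<and> (\<forall>c x. f (scl c x) = scl c (f x))"

lemma linmap_add: "linmap f \<Longrightarrow> f (x + y) = f x + f y"
  and linmap_scl: "linmap f \<Longrightarrow> f (scl c x) = scl c (f x)"
  by (simp_all add: linmap_def)

lemma linmap_zero: "linmap f \<Longrightarrow> f 0 = 0"
  using linmap_scl[of f 0 0] by simp

lemma linmap_uminus: "linmap f \<Longrightarrow> f (- x) = - f x"
  using linmap_scl[of f "-1" x] by (simp add: scl_uminus_left)

lemma linmap_diff: "linmap f \<Longrightarrow> f (x - y) = f x - f y"
  using linmap_add[of f x "- y"] linmap_uminus[of f y] by simp

lemma linmap_sum: "linmap f \<Longrightarrow> f (\<Sum>i\<in>A. h i) = (\<Sum>i\<in>A. f (h i))"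
  by (induction A rule: infinite_finite_induct) (simp_all add: linmap_add linmap_zero)

text \<open>Source and target differ on purpose: \<open>'n\<close> is the space built so far and
  \<open>'m\<close> the full model, since elements of degree -1 lead out of
  \<open>'n\<close>.\<close>

definition bilin :: "(ann \<Rightarrow> 'n::cspace \<Rightarrow> 'm::cspace) \<Rightarrow> bool" where
  "bilin r \<longleftrightarrow> (\<forall>a. linmap (r a)) \<and> (\<forall>a b x. r (a + b) x = r a x + r b x) \<and>
    (\<forall>a c x. r (ascale c a) x = scl c (r a x))"

lemma bilin_linmap: "bilin r \<Longrightarrow> linmap (r a)"
  and bilin_add: "bilin r \<Longrightarrow> r (a + b) x = r a x + r b x"
  and bilin_ascale: "bilin r \<Longrightarrow> r (ascale c a) x = scl c (r a x)"
  by (simp_all add: bilin_def)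

lemma bilin_uminus: "bilin r \<Longrightarrow> r (- a) x = - r a x"
  using bilin_ascale[of r "-1" a x] by (simp add: ascale_minus_one scl_uminus_left)

lemma bilin_zero: "bilin r \<Longrightarrow> r 0 x = 0"
  using bilin_ascale[of r 0 0 x] by simp

lemma bilin_diff: "bilin r \<Longrightarrow> r (a - b) x = r a x - r b x"
  using bilin_add[of r a "- b" x] bilin_uminus[of r b x] by simp

lemma bilin_sum: "bilin r \<Longrightarrow> r (\<Sum>i\<in>A. h i) x = (\<Sum>i\<in>A. r (h i) x)"
  by (induction A rule: infinite_finite_induct) (simp_all add: bilin_add bilin_zero)

text \<open>The rule a w_j = (-1)^p(a) w_j a + [a, w_j] of the enveloping algebra, with
  \<open>e\<close> standing for w_j on the source and \<open>w\<close> for w_j on the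
  target.\<close>

definition equivar :: "widx \<Rightarrow> ('n \<Rightarrow> 'n) \<Rightarrow> ('m \<Rightarrow> 'm) \<Rightarrow> (ann \<Rightarrow> 'n \<Rightarrow> 'm::ab_group_add) \<Rightarrow> bool" where
  "equivar j e w r \<longleftrightarrow> (\<forall>a x. r a (e x) = w (r (atwist a) x) + r (brw j a) x)"

definition zequivar :: "('n \<Rightarrow> 'n) \<Rightarrow> ('m \<Rightarrow> 'm) \<Rightarrow> (ann \<Rightarrow> 'n \<Rightarrow> 'm::ab_group_add) \<Rightarrow> bool" where
  "zequivar z w r \<longleftrightarrow> (\<forall>a x. r a (z x) = w (r a x) + r (abr a zeta) x)"

text \<open>The pair \<open>(x, y)\<close> stands for $x + w_k y$.\<close>

definition adj_act :: "widx \<Rightarrow> ('m \<Rightarrow> 'm) \<Rightarrow> (ann \<Rightarrow> 'n \<Rightarrow> 'm) \<Rightarrow> ann \<Rightarrow> 'n \<times> 'n \<Rightarrow> 'm::ab_group_add" where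
  "adj_act k w r a x = r a (fst x) + w (r (atwist a) (snd x)) + r (brw k a) (snd x)"

text \<open>w_k (x + w_k y) = w_k x, because w_k squares to zero.\<close>

definition adj_new :: "'n \<times> 'n \<Rightarrow> 'n::zero \<times> 'n" where
  "adj_new x = (0, fst x)"

text \<open>w_j (x + w_k y) = w_j x + c zeta y - w_k w_j y with c = gram(j, k), for a w_j already
  present on the old space, where it acts by \<open>e\<close> and zeta by \<open>z\<close>.\<close>

definition adj_old :: "complex \<Rightarrow> ('n \<Rightarrow> 'n) \<Rightarrow> ('n \<Rightarrow> 'n) \<Rightarrow> 'n \<times> 'n \<Rightarrow> 'n::cspace \<times> 'n" where
  "adj_old c z e x = (e (fst x) + scl c (z (snd x)), - e (snd x))"

lemma bilin_adj_act: "linmap w \<Longrightarrow> bilin r \<Longrightarrow> bilin (adj_act k w r)"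
  unfolding bilin_def[of "adj_act k w r"] linmap_def[of "adj_act k w r _"]
  by (simp add: adj_act_def bilin_add bilin_ascale linmap_add[OF bilin_linmap] linmap_scl[OF bilin_linmap]
     linmap_add linmap_scl atwist_add atwist_ascale brw_add brw_ascale scl_prod_def scl_add_right)

lemma linmap_adj_new: "linmap adj_new"
  by (simp add: linmap_def adj_new_def scl_prod_def)

lemma linmap_adj_old: "linmap z \<Longrightarrow> linmap e \<Longrightarrow> linmap (adj_old c z e)"
  by (simp add: linmap_def adj_old_def scl_prod_def scl_add_right scl_uminus_right mult.commute)

lemma linmap_map_prod: "linmap z \<Longrightarrow> linmap (map_prod z z)"
  by (auto simp: linmap_def scl_prod_def)

text \<open>Both w_k w_k on the target and the double bracket with w_k vanish; the two cross terms
  cancel by \<open>brw_atwist\<close>.\<close>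

lemma equivar_adj_new:
  assumes "linmap w" "bilin r" "\<And>x. w (w x) = 0"
  shows "equivar k adj_new w (adj_act k w r)"
  using assms(3) unfolding equivar_def
  by (simp add: adj_act_def adj_new_def bilin_zero[OF assms(2)] linmap_zero[OF bilin_linmap[OF assms(2)]]
     linmap_zero[OF assms(1)] linmap_add[OF assms(1)] brw_self brw_atwist bilin_uminus[OF assms(2)] linmap_uminus[OF assms(1)] linmap_diff[OF assms(1)])

text \<open>Adjoining w_k does not spoil the rule for an older w_j: the anticommutator of w_j and
  w_k on the target and that of \<open>brw j\<close> and \<open>brw k\<close> on the algebra give
  the same multiple of zeta, which \<open>zequivar\<close> moves across \<open>r\<close>.\<close>

lemma equivar_adj_old:
  assumes "linmap w" "linmap w'" "bilin r" "equivar j e w' r" "zequivar z zz r"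
    and ac: "\<And>x. w (w' x) + w' (w x) = scl (gram j k) (zz x)"
  shows "equivar j (adj_old (gram j k) z e) w' (adj_act k w r)"
proof -
  note lin = linmap_diff[OF assms(1)] linmap_diff[OF assms(2)] linmap_add[OF assms(1)] linmap_add[OF assms(2)] linmap_uminus[OF assms(1)] linmap_uminus[OF assms(2)]
    bilin_uminus[OF assms(3)] linmap_add[OF bilin_linmap[OF assms(3)]] linmap_uminus[OF bilin_linmap[OF assms(3)]]
    linmap_scl[OF bilin_linmap[OF assms(3)]]
  have e: "r a (e x) = w' (r (atwist a) x) + r (brw j a) x" for a x
    using assms(4) by (simp add: equivar_def)
  have z: "r a (z x) = zz (r a x) + r (abr a zeta) x" for a x
    using assms(5) by (simp add: zequivar_def)
  have ac': "w (w' x) = scl (gram j k) (zz x) - w' (w x)" for x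
    using ac[of x] by (simp add: algebra_simps)
  have "r (brw j (brw k a) + brw k (brw j a)) x = scl (gram j k) (r (abr a zeta) x)" for a x
    unfolding brw_brw by (rule bilin_ascale[OF assms(3)])
  then have R: "r (brw j (brw k a)) x = scl (gram j k) (r (abr a zeta) x) - r (brw k (brw j a)) x" for a x
    by (simp add: bilin_add[OF assms(3)] algebra_simps)
  show ?thesis
    unfolding equivar_def
    by (auto simp: adj_act_def adj_old_def lin e z brw_atwist ac' R scl_add_right)
qed

lemma zequivar_adj:
  assumes "linmap w" "bilin r" "zequivar z zz r" and c: "\<And>x. w (zz x) = zz (w x)" and "linmap zz"
  shows "zequivar (map_prod z z) zz (adj_act k w r)"
  using assms(3) unfolding zequivar_def
  by (simp add: adj_act_def linmap_add[OF assms(1)] linmap_add[OF assms(5)] c atwist_abr_zeta brw_abr_zeta)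

text \<open>The list v0, v1, ... stands for the sum of zeta^i v_i, and the recursion is a zeta =
  zeta a + [a, zeta]. It replaces \<open>a\<close> by a bracket, so \<open>a\<close> cannot be a
  fixed parameter.\<close>

fun list_act :: "('m::ab_group_add \<Rightarrow> 'm) \<Rightarrow> (ann \<Rightarrow> 'f \<Rightarrow> 'm) \<Rightarrow> ann \<Rightarrow> 'f list \<Rightarrow> 'm" where
  "list_act zz b a [] = 0"
| "list_act zz b a (v # vs) = b a v + zz (list_act zz b a vs) + list_act zz b (abr a zeta) vs"

definition poly_act :: "('m::ab_group_add \<Rightarrow> 'm) \<Rightarrow> (ann \<Rightarrow> 'f \<Rightarrow> 'm) \<Rightarrow> ann \<Rightarrow> 'f::zero poly \<Rightarrow> 'm" where
  "poly_act zz b a q = list_act zz b a (coeffs q)"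

context
  fixes zz :: "'m::cspace \<Rightarrow> 'm" and b :: "ann \<Rightarrow> 'f::g0_module \<Rightarrow> 'm"
  assumes zz: "linmap zz"
    and b_add: "\<And>a v w. b a (v + w) = b a v + b a w" and b_scale: "\<And>a c v. b a (fscale c v) = scl c (b a v)"
    and b_add_left: "\<And>a a' v. b (a + a') v = b a v + b a' v"
    and b_scale_left: "\<And>a c v. b (ascale c a) v = scl c (b a v)"
begin

lemma b_zero: "b a 0 = 0"
  using b_scale[of a 0 0] by simp

lemma poly_act_zero: "poly_act zz b a 0 = 0"
  by (simp add: poly_act_def)

text \<open>\<open>pCons 0 0\<close> has the empty coefficient list; the recursion survives because
  \<open>b a 0\<close> and \<open>zz 0\<close> vanish.\<close>

lemma poly_act_pCons: "poly_act zz b a (pCons v q) = b a v + zz (poly_act zz b a q) + poly_act zz b (abr a zeta) q"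
  by (auto simp: poly_act_def cCons_def b_zero linmap_zero[OF zz])

lemma bilin_poly_act: "bilin (poly_act zz b)"
proof -
  have "poly_act zz b a (p + q) = poly_act zz b a p + poly_act zz b a q" for a p q
    by (induction p q arbitrary: a rule: poly_induct2)
      (simp_all add: poly_act_zero poly_act_pCons b_add linmap_add[OF zz])
  moreover have "poly_act zz b a (scl c q) = scl c (poly_act zz b a q)" for a c q
    by (induction q arbitrary: a)
      (simp_all add: poly_act_zero poly_act_pCons b_scale linmap_scl[OF zz] scl_add_right)
  moreover have "poly_act zz b (a + a') q = poly_act zz b a q + poly_act zz b a' q" for a a' q
    by (induction q arbitrary: a a')
      (simp_all add: poly_act_zero poly_act_pCons b_add_left abr_add_left linmap_add[OF zz])
  moreover have "poly_act zz b (ascale c a) q = scl c (poly_act zz b a q)" for a c q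
    by (induction q arbitrary: a)
      (simp_all add: poly_act_zero poly_act_pCons b_scale_left abr_ascale_left linmap_scl[OF zz] scl_add_right)
  ultimately show ?thesis by (simp add: bilin_def linmap_def)
qed

lemma zequivar_poly_act: "zequivar (pCons 0) zz (poly_act zz b)"
  by (simp add: zequivar_def poly_act_pCons b_zero)

end

section \<open>A model of the induced module\<close>

text \<open>Sixteen copies of F[zeta], one for each product w11^a w12^b w21^c w22^d with exponents 0
  or 1. The outermost pair records the exponent of w11, the innermost that of w22.\<close>

type_synonym 'f model = "((('f poly \<times> 'f poly) \<times> ('f poly \<times> 'f poly)) \<times> (('f poly \<times> 'f poly) \<times> ('f poly \<times> 'f poly))) \<times>
  ((('f poly \<times> 'f poly) \<times> ('f poly \<times> 'f poly)) \<times> (('f poly \<times> 'f poly) \<times> ('f poly \<times> 'f poly)))"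

abbreviation z0 :: "'f::zero poly \<Rightarrow> 'f poly" where "z0 \<equiv> pCons 0"
abbreviation "z1 \<equiv> map_prod z0 z0"
abbreviation "z2 \<equiv> map_prod z1 z1"
abbreviation "z3 \<equiv> map_prod z2 z2"

definition opZ :: "'f::g0_module model \<Rightarrow> 'f model" where
  "opZ = map_prod z3 z3"

text \<open>Left multiplication on ordered monomials: w_j is new at its own level and old at every
  level outside it.\<close>

primrec opW :: "widx \<Rightarrow> 'f::g0_module model \<Rightarrow> 'f model" where
  "opW W11 = adj_new"
| "opW W12 = adj_old (gram W12 W11) z3 adj_new"
| "opW W21 = adj_old (gram W21 W11) z3 (adj_old (gram W21 W12) z2 adj_new)"
| "opW W22 = adj_old (gram W22 W11) z3 (adj_old (gram W22 W12) z2 (adj_old (gram W22 W21) z1 adj_new))"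

definition vac :: "'f::g0_module \<Rightarrow> 'f model" where
  "vac v = (((([:v:], 0), 0), 0), 0)"

lemma linmap_z0: "linmap (z0 :: 'f::g0_module poly \<Rightarrow> 'f poly)"
  by (simp add: linmap_def)

lemma linmap_opZ: "linmap opZ"
  unfolding opZ_def by (intro linmap_map_prod linmap_z0)

lemma linmap_opW: "linmap (opW j)"
  by (cases j) (simp_all only: opW.simps linmap_adj_new linmap_adj_old linmap_map_prod linmap_z0)

lemma vac_add: "vac (v + w) = vac v + vac w"
  by (simp add: vac_def)

lemma vac_scale: "vac (fscale c v) = scl c (vac v)"
  by (simp add: vac_def zero_prod_def)

lemma opW_opZ: "opW j (opZ x) = opZ (opW j x)"
  by (cases j) (simp_all add: opZ_def adj_new_def adj_old_def scl_uminus_left prod_eq_iff)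

lemma opW_opW: "opW i (opW j x) + opW j (opW i x) = scl (gram i j) (opZ x)"
  by (cases i; cases j) (simp_all add: opZ_def adj_new_def adj_old_def scl_uminus_left prod_eq_iff)

lemma opW_self [simp]: "opW j (opW j x) = 0"
  by (cases j) (simp_all add: opZ_def adj_new_def adj_old_def scl_uminus_left prod_eq_iff)

text \<open>Coordinates of the component of degree -1 in the basis w_j, obtained by inverting
  \<open>wcoef\<close>.\<close>

primrec wpart :: "widx \<Rightarrow> ann \<Rightarrow> complex" where
  "wpart W11 a = (coeff (fst a $ {I2}) 0 - \<i> * coeff (fst a $ {I1}) 0) / 2"
| "wpart W22 a = (coeff (fst a $ {I2}) 0 + \<i> * coeff (fst a $ {I1}) 0) / 2"
| "wpart W12 a = (- coeff (fst a $ {I4}) 0 - \<i> * coeff (fst a $ {I3}) 0) / 2"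
| "wpart W21 a = (coeff (fst a $ {I4}) 0 - \<i> * coeff (fst a $ {I3}) 0) / 2"

text \<open>The factor -1/2 is there because zeta is -2 times the unit.\<close>

definition zpart :: "ann \<Rightarrow> complex" where
  "zpart a = - coeff (fst a $ {}) 0 / 2"

definition deg0_part :: "ann \<Rightarrow> ann" where
  "deg0_part a = ((\<chi> S. if S = {} then monom (coeff (fst a $ {}) 1) 1
     else if card S = 2 then [:coeff (fst a $ S) 0:] else 0), snd a)"

lemma UNIV_widx: "UNIV = {W11, W12, W21, W22}"
  using widx.exhaust by auto

instance widx :: finite
  by standard (simp add: UNIV_widx)

lemma sum_widx: "(\<Sum>j\<in>UNIV. h j) = h W11 + h W12 + h W21 + (h W22 :: 'a::comm_monoid_add)"
  by (simp add: UNIV_widx add.assoc)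

text \<open>The value that a (1 tensor v) must have in Ind(F): the component of degree 0 acts on F,
  the negative ones act by the w_j and zeta, and the positive ones act by 0.\<close>

definition vact :: "ann \<Rightarrow> 'f::g0_module \<Rightarrow> 'f model" where
  "vact a v = vac (act0 (deg0_part a) v) + (\<Sum>j\<in>UNIV. scl (wpart j a) (opW j (vac v))) + scl (zpart a) (opZ (vac v))"

lemma deg0_part_deg: "deg0_part a \<in> g_deg 0"
  by (auto simp: deg0_part_def deg_part_def coeff_pCons split: if_splits nat.splits)

lemma deg0_part_add: "deg0_part (a + b) = deg0_part a + deg0_part b"
  by (auto simp: deg0_part_def vec_eq_iff add_monom)

lemma deg0_part_ascale: "deg0_part (ascale c a) = ascale c (deg0_part a)"
  by (auto simp: deg0_part_def vec_eq_iff ascale_def smult_monom)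

lemma wpart_add: "wpart j (a + b) = wpart j a + wpart j b"
  by (cases j) (simp_all add: algebra_simps add_divide_distrib diff_divide_distrib)

lemma wpart_ascale: "wpart j (ascale c a) = c * wpart j a"
  by (cases j) (simp_all add: ascale_def algebra_simps add_divide_distrib diff_divide_distrib)

lemma zpart_add: "zpart (a + b) = zpart a + zpart b"
  by (simp add: zpart_def add_divide_distrib diff_divide_distrib)

lemma zpart_ascale: "zpart (ascale c a) = c * zpart a"
  by (simp add: zpart_def ascale_def)

lemma vact_add: "vact a (v + w) = vact a v + vact a w"
  by (simp add: vact_def act0_add_right deg0_part_deg vac_add linmap_add[OF linmap_opW] linmap_add[OF linmap_opZ]
     scl_add_right sum.distrib algebra_simps)

lemma vact_scale: "vact a (fscale c v) = scl c (vact a v)"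
  by (simp add: vact_def act0_scale_right deg0_part_deg vac_scale linmap_scl[OF linmap_opW] linmap_scl[OF linmap_opZ]
     scl_add_right sum_widx mult.commute)

lemma vact_add_left: "vact (a + b) v = vact a v + vact b v"
  by (simp add: vact_def act0_add_left deg0_part_deg deg0_part_add vac_add wpart_add zpart_add
     scl_add_left sum.distrib algebra_simps)

lemma vact_scale_left: "vact (ascale c a) v = scl c (vact a v)"
  by (simp add: vact_def act0_scale_left deg0_part_deg deg0_part_ascale vac_scale wpart_ascale zpart_ascale
     scl_add_right sum_widx)

definition rho :: "ann \<Rightarrow> 'f::g0_module model \<Rightarrow> 'f model" where
  "rho = adj_act W11 (opW W11) (adj_act W12 (opW W12) (adj_act W21 (opW W21) (adj_act W22 (opW W22)
     (poly_act opZ vact))))"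

lemmas bilin_base = bilin_poly_act[OF linmap_opZ vact_add vact_scale vact_add_left vact_scale_left]
lemmas zequivar_base = zequivar_poly_act[OF linmap_opZ vact_add vact_scale vact_add_left vact_scale_left]

lemma bilin_rho: "bilin rho"
  unfolding rho_def by (intro bilin_adj_act linmap_opW bilin_base)

lemma opW_opW': "opW k (opW j x) + opW j (opW k x) = scl (gram j k) (opZ x)"
  using opW_opW[of j k x] by (simp add: add.commute)

text \<open>When w_j is adjoined its rule is \<open>equivar_adj_new\<close>, and every later
  adjunction preserves it by \<open>equivar_adj_old\<close>. The innermost w22 passes through three
  of these.\<close>

lemma zequivar_rho: "zequivar opZ opZ rho"
  and equivar_rho: "equivar j (opW j) (opW j) rho"
proof -
  note b0 = bilin_base
  note b1 = bilin_adj_act[OF linmap_opW b0, of W22]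
  note b2 = bilin_adj_act[OF linmap_opW b1, of W21]
  note b3 = bilin_adj_act[OF linmap_opW b2, of W12]
  note z0 = zequivar_base
  note z1 = zequivar_adj[OF linmap_opW b0 z0 opW_opZ linmap_opZ, of W22]
  note z2 = zequivar_adj[OF linmap_opW b1 z1 opW_opZ linmap_opZ, of W21]
  note z3 = zequivar_adj[OF linmap_opW b2 z2 opW_opZ linmap_opZ, of W12]
  note z4 = zequivar_adj[OF linmap_opW b3 z3 opW_opZ linmap_opZ, of W11]
  show "zequivar opZ opZ rho"
    using z4 unfolding rho_def by (simp only: opZ_def[symmetric])
  note new = equivar_adj_new[OF linmap_opW _ opW_self]
  note e11 = new[OF b3, of W11]
  note e12 = equivar_adj_old[OF linmap_opW linmap_opW b3 new[OF b2, of W12] z3 opW_opW', of W11]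
  note e21 = equivar_adj_old[OF linmap_opW linmap_opW b2 new[OF b1, of W21] z2 opW_opW', of W12]
  note e21 = equivar_adj_old[OF linmap_opW linmap_opW b3 e21 z3 opW_opW', of W11]
  note e22 = equivar_adj_old[OF linmap_opW linmap_opW b1 new[OF b0, of W22] z1 opW_opW', of W21]
  note e22 = equivar_adj_old[OF linmap_opW linmap_opW b2 e22 z2 opW_opW', of W12]
  note e22 = equivar_adj_old[OF linmap_opW linmap_opW b3 e22 z3 opW_opW', of W11]
  show "equivar j (opW j) (opW j) rho"
    unfolding rho_def
    \<comment> \<open>Only the occurrence of \<open>opW j\<close> on the source is unfolded to its
      \<open>adj\<close> form; the one on the target stays folded, as in the collected
      facts.\<close>
    by (cases j; hypsubst; subst (1) opW.simps; rule e11 e12 e21 e22)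
qed

lemma rho_opW: "rho a (opW j x) = opW j (rho (atwist a) x) + rho (brw j a) x"
  by (rule equivar_rho[unfolded equivar_def, rule_format])

lemma rho_opZ: "rho a (opZ x) = opZ (rho a x) + rho (abr a zeta) x"
  by (rule zequivar_rho[unfolded zequivar_def, rule_format])

lemma adj_act_Pair_zero: "bilin r \<Longrightarrow> adj_act k (opW k) r a (x, 0) = r a x"
  by (simp add: adj_act_def linmap_zero[OF bilin_linmap] linmap_zero[OF linmap_opW])

lemma rho_vac: "rho a (vac v) = vact a v"
proof -
  have z: "linmap opZ" by (rule linmap_opZ)
  have 0: "poly_act opZ vact a 0 = 0" for a by (simp add: poly_act_def)
  have "poly_act opZ vact a [:v:] = vact a v"
    using poly_act_pCons[OF linmap_opZ vact_add vact_scale vact_add_left vact_scale_left, of a v 0]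
    by (simp add: 0 linmap_zero[OF linmap_opZ])
  then show ?thesis
    unfolding rho_def vac_def
    by (simp only: adj_act_Pair_zero bilin_adj_act linmap_opW bilin_base)
qed

text \<open>The vacuum vectors generate the model under the w_j alone, because zeta = w11 w22 + w22
  w11. Pairs are decomposed as x + w_k y, from the innermost level outwards.\<close>

lemma model_induct [case_names vac add W]:
  fixes x :: "'f::g0_module model"
  assumes "\<And>v. P (vac v)" "\<And>x y. P x \<Longrightarrow> P y \<Longrightarrow> P (x + y)"
    "\<And>j x. P x \<Longrightarrow> P (opW j x)"
  shows "P x"
proof -
  have PZ: "P (opZ x)" if "P x" for x
  proof -
    have "opZ x = opW W11 (opW W22 x) + opW W22 (opW W11 x)"
      unfolding opW_opW gram_simps scl_one ..
    with assms(2)[OF assms(3)[OF assms(3)] assms(3)[OF assms(3)], OF that that] show ?thesis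
      by (simp only:)
  qed
  have P0: "P 0" using assms(3)[OF assms(3)[OF assms(1)], of W11 W11] by (simp only: opW_self)
  have a: "P ((((q, 0), 0), 0), 0)" for q
  proof (induction q)
    case (pCons v q)
    have "((((pCons v q, 0), 0), 0), 0) = vac v + opZ ((((q, 0), 0), 0), 0)"
      by (simp add: vac_def opZ_def zero_prod_def)
    with assms(1)[of v] PZ[OF pCons.IH] show ?case by (simp only: assms(2))
  qed (use P0 in \<open>simp add: zero_prod_def\<close>)
  have b: "P (((y, 0), 0), 0)" for y
  proof -
    have "(((y, 0), 0), 0) = ((((fst y, 0), 0), 0), 0) + opW W22 ((((snd y, 0), 0), 0), 0)"
      by (cases y) (simp add: adj_new_def adj_old_def zero_prod_def)
    with a[of "fst y"] assms(3)[OF a[of "snd y"]] show ?thesis by (simp only: assms(2))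
  qed
  have c: "P ((y, 0), 0)" for y
  proof -
    have "((y, 0), 0) = (((fst y, 0), 0), 0) + opW W21 (((snd y, 0), 0), 0)"
      by (cases y) (simp add: adj_new_def adj_old_def zero_prod_def)
    with b[of "fst y"] assms(3)[OF b[of "snd y"]] show ?thesis by (simp only: assms(2))
  qed
  have d: "P (y, 0)" for y
  proof -
    have "(y, 0) = ((fst y, 0), 0) + opW W12 ((snd y, 0), 0)"
      by (cases y) (simp add: adj_new_def adj_old_def zero_prod_def)
    with c[of "fst y"] assms(3)[OF c[of "snd y"]] show ?thesis by (simp only: assms(2))
  qed
  have "x = (fst x, 0) + opW W11 (snd x, 0)"
    by (cases x) (simp add: adj_new_def)
  with d[of "fst x"] assms(3)[OF d[of "snd x"]] show ?thesis by (metis assms(2))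
qed

section \<open>Degrees\<close>

abbreviation "g_nonneg \<equiv> deg_part (\<lambda>k. k \<ge> 0)"

text \<open>A predicate on 2m + |S|, the degree without its shift by -2. With a predicate in place
  of a number, the same lemmas serve single components, g_{>=0} and g_{>0}.\<close>

definition gdeg :: "(int \<Rightarrow> bool) \<Rightarrow> grass \<Rightarrow> bool" where
  "gdeg A f \<longleftrightarrow> (\<forall>S m. coeff (f $ S) m \<noteq> 0 \<longrightarrow> A (2 * int m + int (card S)))"

lemma gdeg_mono: "gdeg A f \<Longrightarrow> (\<And>k. A k \<Longrightarrow> B k) \<Longrightarrow> gdeg B f"
  by (auto simp: gdeg_def)

lemma gdeg_add: "gdeg A f \<Longrightarrow> gdeg A g \<Longrightarrow> gdeg A (f + g)"
  unfolding gdeg_def by (metis add.right_neutral coeff_add vector_add_component)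

lemma gdeg_uminus: "gdeg A f \<Longrightarrow> gdeg A (- f)"
  by (simp add: gdeg_def)

lemma gdeg_diff: "gdeg A f \<Longrightarrow> gdeg A g \<Longrightarrow> gdeg A (f - g)"
  using gdeg_add[of A f "- g"] gdeg_uminus[of A g] by simp

lemma gdeg_zero: "gdeg A 0"
  by (simp add: gdeg_def)

lemma gdeg_sum: "(\<And>i. i \<in> I \<Longrightarrow> gdeg A (h i)) \<Longrightarrow> gdeg A (\<Sum>i\<in>I. h i)"
  by (induction I rule: infinite_finite_induct) (auto simp: gdeg_zero gdeg_add)

lemma coeff_sign_mult: "coeff (xi_sign S T * p) n \<noteq> 0 \<longleftrightarrow> coeff p n \<noteq> 0"
  using xi_sign_cases[of S T] by auto

lemma gdeg_gmul:
  assumes "gdeg A f" "gdeg B g"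
  shows "gdeg (\<lambda>k. \<exists>a b. A a \<and> B b \<and> k = a + b) (gmul f g)"
  unfolding gdeg_def
proof (intro allI impI)
  fix U n assume "coeff (gmul f g $ U) n \<noteq> 0"
  then have "(\<Sum>S\<in>Pow U. coeff (xi_sign S (U - S) * f $ S * g $ (U - S)) n) \<noteq> 0"
    by (simp add: gmul_def coeff_sum)
  then obtain S where S: "S \<subseteq> U" "coeff (xi_sign S (U - S) * f $ S * g $ (U - S)) n \<noteq> 0"
    by (meson PowD sum.not_neutral_contains_not_neutral)
  then have "coeff (f $ S * g $ (U - S)) n \<noteq> 0"
    by (simp only: mult.assoc coeff_sign_mult not_False_eq_True)
  then obtain i where i: "i \<le> n" "coeff (f $ S) i \<noteq> 0" "coeff (g $ (U - S)) (n - i) \<noteq> 0"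
    unfolding coeff_mult by (metis (mono_tags, lifting) atMost_iff mult_eq_0_iff sum.neutral)
  have "card U = card S + card (U - S)"
    using S(1) by (metis card_Un_disjoint Diff_disjoint finite_idx_set sup.absorb_iff2 Un_Diff_cancel)
  then have "2 * int n + int (card U) = (2 * int i + int (card S)) + (2 * int (n - i) + int (card (U - S)))"
    using i(1) by simp
  then show "\<exists>a b. A a \<and> B b \<and> 2 * int n + int (card U) = a + b"
    using assms i(2,3) unfolding gdeg_def by blast
qed

lemma gdeg_dt: "gdeg A f \<Longrightarrow> gdeg (\<lambda>k. A (k + 2)) (dt f)"
  unfolding gdeg_def
proof (intro allI impI)
  fix S m assume f: "\<forall>S m. coeff (f $ S) m \<noteq> 0 \<longrightarrow> A (2 * int m + int (card S))" and "coeff (dt f $ S) m \<noteq> 0"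
  then have "coeff (f $ S) (Suc m) \<noteq> 0" by (simp add: dt_def coeff_pderiv)
  with f have "A (2 * int (Suc m) + int (card S))" by blast
  then show "A (2 * int m + int (card S) + 2)" by (simp add: algebra_simps)
qed

lemma gdeg_pd: "gdeg A f \<Longrightarrow> gdeg (\<lambda>k. A (k + 1)) (pd i f)"
  unfolding gdeg_def
proof (intro allI impI)
  fix S m assume f: "\<forall>S m. coeff (f $ S) m \<noteq> 0 \<longrightarrow> A (2 * int m + int (card S))" and "coeff (pd i f $ S) m \<noteq> 0"
  then have "i \<notin> S" "coeff (f $ insert i S) m \<noteq> 0"
    by (auto simp: pd_def coeff_sign_mult split: if_splits)
  then have "A (2 * int m + int (card (insert i S)))" "card (insert i S) = Suc (card S)"
    using f by (blast, simp)
  then show "A (2 * int m + int (card S) + 1)" by (simp add: algebra_simps)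
qed

lemma gdeg_smult: "gdeg A f \<Longrightarrow> (\<And>S. \<exists>c. g $ S = smult c (f $ S)) \<Longrightarrow> gdeg A g"
  unfolding gdeg_def by (metis coeff_smult mult_zero_right)

lemma gdeg_twist: "gdeg A f \<Longrightarrow> gdeg A (parity_twist f)"
proof (rule gdeg_smult)
  fix S show "\<exists>c. parity_twist f $ S = smult c (f $ S)"
    by (cases "even (card S)") (auto simp: parity_twist_def intro: exI[of _ 1] exI[of _ "-1"])
qed

lemma gdeg_euler: "gdeg A f \<Longrightarrow> gdeg A (2 *s f - euler f)"
proof (rule gdeg_smult)
  fix S show "\<exists>c. (2 *s f - euler f) $ S = smult c (f $ S)"
    by (rule exI[of _ "2 - of_nat (card S)"])
      (simp add: euler_nth smult_diff_left of_nat_poly numeral_poly algebra_simps)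
qed

text \<open>Every term of \<open>Kbr\<close> lowers the total by 2: through one t-derivative, or
  through two odd derivatives by 1 each.\<close>

lemma gdeg_Kbr:
  assumes "gdeg A f" "gdeg B g"
  shows "gdeg (\<lambda>k. \<exists>a b. A a \<and> B b \<and> k = a + b - 2) (Kbr f g)"
  unfolding Kbr_def
proof (intro gdeg_add gdeg_diff gdeg_sum)
  show "gdeg (\<lambda>k. \<exists>a b. A a \<and> B b \<and> k = a + b - 2) (gmul (2 *s f - euler f) (dt g))"
    using gdeg_gmul[OF gdeg_euler[OF assms(1)] gdeg_dt[OF assms(2)]]
    by (rule gdeg_mono) (smt (verit))
  show "gdeg (\<lambda>k. \<exists>a b. A a \<and> B b \<and> k = a + b - 2) (gmul (dt f) (2 *s g - euler g))"
    using gdeg_gmul[OF gdeg_dt[OF assms(1)] gdeg_euler[OF assms(2)]]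
    by (rule gdeg_mono) (smt (verit))
  show "gdeg (\<lambda>k. \<exists>a b. A a \<and> B b \<and> k = a + b - 2) (gmul (pd i (parity_twist f)) (pd i g))" for i
    using gdeg_gmul[OF gdeg_pd[OF gdeg_twist[OF assms(1)]] gdeg_pd[OF assms(2)]]
    by (rule gdeg_mono) (smt (verit))
qed

lemma card_idx: "card (UNIV :: idx set) = 4" "card (UNIV - {k :: idx}) = 3"
proof -
  show "card (UNIV :: idx set) = 4" by (simp add: UNIV_idx)
  then show "card (UNIV - {k :: idx}) = 3" by (simp add: card_Diff_subset)
qed

text \<open>The cocycle pairs complementary sets at t = 0. In shifted terms it has degree 0, the
  degree of the central element.\<close>

lemma gdeg_psi:
  assumes "gdeg A f" "gdeg B g" "psi f g \<noteq> 0"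
  shows "\<exists>a b. A a \<and> B b \<and> a + b = 4"
proof (rule ccontr)
  assume no: "\<not> ?thesis"
  have "coeff (f $ S) 0 * coeff (g $ T) 0 = 0" if "card S + card T = 4" for S T
  proof (rule ccontr)
    assume "coeff (f $ S) 0 * coeff (g $ T) 0 \<noteq> 0"
    then have "A (2 * int 0 + int (card S))" "B (2 * int 0 + int (card T))"
      using assms(1,2) unfolding gdeg_def by (metis mult_eq_0_iff)+
    with no that show False by (metis add.left_neutral mult_zero_right of_nat_0 of_nat_add of_nat_numeral)
  qed
  note * = this
  have "coeff (f $ {}) 0 * coeff (g $ UNIV) 0 = 0" "coeff (f $ UNIV) 0 * coeff (g $ {}) 0 = 0"
    "coeff (f $ {i}) 0 * coeff (g $ (UNIV - {i})) 0 = 0" "coeff (f $ (UNIV - {i})) 0 * coeff (g $ {i}) 0 = 0" for i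
    by (rule *, simp add: card_idx)+
  then have "psi f g = 0"
    by (simp only: psi_def Let_def mult.assoc) simp
  with assms(3) show False by simp
qed

lemma deg_part_iff: "(f, z) \<in> deg_part P \<longleftrightarrow> gdeg (\<lambda>k. P (k - 2)) f \<and> (z \<noteq> 0 \<longrightarrow> P 0)"
  by (simp add: deg_part_def gdeg_def)

lemma abr_deg_part:
  assumes "a \<in> deg_part P" "b \<in> deg_part Q" "\<And>k l. P k \<Longrightarrow> Q l \<Longrightarrow> R (k + l)"
  shows "abr a b \<in> deg_part R"
proof -
  obtain f z g w where ab: "a = (f, z)" "b = (g, w)" by (cases a; cases b)
  have f: "gdeg (\<lambda>k. P (k - 2)) f" and g: "gdeg (\<lambda>k. Q (k - 2)) g"
    using assms(1,2) by (simp_all add: ab deg_part_iff)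
  have "gdeg (\<lambda>k. R (k - 2)) (Kbr f g)"
    using gdeg_Kbr[OF f g]
  proof (rule gdeg_mono)
    fix k assume "\<exists>a b. P (a - 2) \<and> Q (b - 2) \<and> k = a + b - 2"
    then obtain a b where "P (a - 2)" "Q (b - 2)" "k = a + b - 2" by blast
    moreover from this have "k - 2 = (a - 2) + (b - 2)" by simp
    ultimately show "R (k - 2)" using assms(3)[of "a - 2" "b - 2"] by metis
  qed
  moreover have "R 0" if nz: "psi f g \<noteq> 0"
  proof -
    obtain a b where "P (a - 2)" "Q (b - 2)" "a + b = 4"
      using gdeg_psi[OF f g nz] by blast
    then show ?thesis using assms(3)[of "a - 2" "b - 2"] by simp
  qed
  ultimately show ?thesis by (simp add: ab abr_def deg_part_iff)
qed

lemma deg_part_add: "a \<in> deg_part P \<Longrightarrow> b \<in> deg_part P \<Longrightarrow> a + b \<in> deg_part P"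
  by (cases a; cases b) (auto simp: deg_part_iff gdeg_add)

lemma deg_part_mono: "a \<in> deg_part P \<Longrightarrow> (\<And>k. P k \<Longrightarrow> Q k) \<Longrightarrow> a \<in> deg_part Q"
  by (cases a) (auto simp: deg_part_def)

lemma deg0_part_pos:
  assumes "a \<in> g_pos"
  shows "deg0_part a = 0"
proof -
  obtain f z where az: "a = (f, z)" by (cases a)
  have "coeff (f $ S) m = 0" if "2 * int m + int (card S) \<le> 2" for S m
    using assms that unfolding az deg_part_def by force
  from this[of 1 "{}"] this[of 0] show ?thesis
    using assms by (auto simp: az deg0_part_def deg_part_def vec_eq_iff zero_prod_def)
qed

lemma deg0_part_same: "a \<in> g_deg 0 \<Longrightarrow> deg0_part a = a"
proof -
  assume a: "a \<in> g_deg 0"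
  obtain f z where az: "a = (f, z)" by (cases a)
  have c: "coeff (f $ S) m = 0" if "2 * int m + int (card S) \<noteq> 2" for S m
    using a that by (auto simp: az deg_part_def)
  have "f $ S = (if S = {} then monom (coeff (f $ {}) 1) 1
     else if card S = 2 then [:coeff (f $ S) 0:] else 0)" for S
  proof (rule poly_eqI)
    fix m
    have "coeff (f $ S) m = 0" if "card S > 0" "m > 0"
      using that by (intro c) linarith
    then show "coeff (f $ S) m = coeff (if S = {} then monom (coeff (f $ {}) 1) 1
     else if card S = 2 then [:coeff (f $ S) 0:] else 0) m"
      using c[of m "{}"] c[of 0 S] by (auto simp: coeff_pCons card_gt_0_iff split: nat.split)
  qed
  then have "(\<chi> S. if S = {} then monom (coeff (f $ {}) 1) 1
     else if card S = 2 then [:coeff (f $ S) 0:] else 0) = f"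
    unfolding vec_eq_iff vec_lambda_beta by (intro allI) (rule sym)
  then show ?thesis by (simp only: az deg0_part_def fst_conv snd_conv)
qed

lemma nonneg_split:
  assumes "a \<in> g_nonneg"
  shows "a - deg0_part a \<in> g_pos"
proof -
  obtain f z where az: "a = (f, z)" by (cases a)
  have c: "coeff (f $ S) m = 0" if "2 * int m + int (card S) < 2" for S m
    using assms that unfolding az deg_part_def by force
  have "coeff ((f - fst (deg0_part a)) $ S) m = 0" if "2 * int m + int (card S) \<le> 2" for S m
  proof (cases "2 * int m + int (card S) < 2")
    case True
    then show ?thesis using c[of m S] c[of m "{}"]
      by (auto simp: deg0_part_def az coeff_pCons split: nat.split)
  next
    case False
    then have "m = 0 \<and> card S = 2 \<or> m = 1 \<and> S = {}" using that
      by (cases "m = 0"; cases "m = 1") auto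
    then show ?thesis by (auto simp: deg0_part_def az)
  qed
  then have "gdeg (\<lambda>k. 0 < k - 2) (f - fst (deg0_part a))"
    unfolding gdeg_def by (metis diff_gt_0_iff_gt linorder_not_le)
  moreover have "a - deg0_part a = (f - fst (deg0_part a), 0)"
    by (simp add: az deg0_part_def)
  ultimately show ?thesis by (simp add: deg_part_iff)
qed

text \<open>g_{>0} is an ideal of g_{>=0}, so the projection to degree 0 is a homomorphism there;
  hence F extended by zero is a module over g_{>=0}.\<close>

lemma deg0_part_abr:
  assumes "a \<in> g_nonneg" "b \<in> g_nonneg"
  shows "deg0_part (abr a b) = abr (deg0_part a) (deg0_part b)"
proof -
  let ?a = "deg0_part a" and ?b = "deg0_part b"
  note pa = nonneg_split[OF assms(1)] and pb = nonneg_split[OF assms(2)]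
  have "abr a b = abr ?a ?b + (abr ?a (b - ?b) + abr (a - ?a) b)"
    by (simp add: abr_diff)
  moreover have "abr ?a (b - ?b) \<in> g_pos"
    by (rule abr_deg_part[OF deg0_part_deg pb]) simp
  moreover have "abr (a - ?a) b \<in> g_pos"
    by (rule abr_deg_part[OF pa assms(2)]) simp
  moreover have "abr ?a ?b \<in> g_deg 0"
    by (rule abr_deg_part[OF deg0_part_deg deg0_part_deg]) simp
  ultimately show ?thesis
    by (simp add: deg0_part_add deg0_part_same deg0_part_pos deg_part_add)
qed

section \<open>The bracket relation on the model\<close>

lemma coeff_zeta: "coeff (fst zeta $ S) m = (if S = {} \<and> m = 0 then - 2 else 0)"
  by (auto simp: zeta_def ascale_def tmon_def coeff_pCons monom_0 split: nat.split)

lemma fst_welt: "fst (welt j) $ S = (\<Sum>k\<in>UNIV. smult (wcoef j k) (xi {k} $ S))"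
  by (simp add: welt_def sum_idx ascale_def)

lemma coeff_welt: "coeff (fst (welt j) $ S) m = (if m = 0 then (\<Sum>k\<in>UNIV. if S = {k} then wcoef j k else 0) else 0)"
  by (auto simp: fst_welt tmon_def coeff_sum sum_idx monom_0 coeff_pCons split: nat.split)

lemma snd_welt [simp]: "snd (welt j) = 0" "snd zeta = 0"
  by (simp_all add: welt_def zeta_def ascale_def sum_idx)

lemma wpart_zeta [simp]: "wpart j zeta = 0"
  by (cases j) (simp_all add: coeff_zeta)

lemma zpart_zeta [simp]: "zpart zeta = 1" "zpart (welt i) = 0"
  by (simp_all add: zpart_def coeff_zeta coeff_welt)

lemma wpart_welt: "wpart j (welt i) = (if i = j then 1 else 0)"
  by (cases i; cases j) (simp_all add: coeff_welt sum_idx)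

lemma deg0_part_neg: "deg0_part zeta = 0" "deg0_part (welt j) = 0"
proof -
  show "deg0_part zeta = 0"
    by (auto simp: deg0_part_def coeff_zeta vec_eq_iff zero_prod_def)
  have "(\<Sum>k\<in>UNIV. if S = {k} then wcoef j k else 0) = 0" if "card S = 2" for S
    using that by (intro sum.neutral) auto
  then show "deg0_part (welt j) = 0"
    by (auto simp: deg0_part_def coeff_welt vec_eq_iff zero_prod_def)
qed

lemma act0_zero [simp]: "act0 0 v = 0"
  using act0_scale_left[of 0 0 v] by (simp add: deg_part_def zero_prod_def)

lemma vac_zero [simp]: "vac 0 = 0"
  by (simp add: vac_def zero_prod_def)

lemma rho_zeta: "rho zeta x = opZ x"
proof (induction x rule: model_induct)
  case (vac v)
  show ?case by (simp add: rho_vac vact_def deg0_part_neg)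
next
  case (add x y)
  then show ?case by (simp add: linmap_add[OF bilin_linmap[OF bilin_rho]] linmap_add[OF linmap_opZ])
next
  case (W j x)
  then show ?case by (simp add: rho_opW atwist_zeta brw_zeta bilin_zero[OF bilin_rho] opW_opZ)
qed

lemmas rho_add = bilin_add[OF bilin_rho] and rho_ascale = bilin_ascale[OF bilin_rho]
  and rho_uminus = bilin_uminus[OF bilin_rho] and rho_diff = bilin_diff[OF bilin_rho]
  and rho_zero = bilin_zero[OF bilin_rho] and rho_sum = bilin_sum[OF bilin_rho]
  and rho_add_right = linmap_add[OF bilin_linmap[OF bilin_rho]]
  and rho_scl = linmap_scl[OF bilin_linmap[OF bilin_rho]]
  and rho_uminus_right = linmap_uminus[OF bilin_linmap[OF bilin_rho]]
  and rho_zero_right = linmap_zero[OF bilin_linmap[OF bilin_rho]]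
  and rho_diff_right = linmap_diff[OF bilin_linmap[OF bilin_rho]]
lemmas opW_add = linmap_add[OF linmap_opW] and opW_scl = linmap_scl[OF linmap_opW]
  and opW_uminus = linmap_uminus[OF linmap_opW] and opW_zero = linmap_zero[OF linmap_opW]
  and opW_diff = linmap_diff[OF linmap_opW]
lemmas opZ_add = linmap_add[OF linmap_opZ] and opZ_scl = linmap_scl[OF linmap_opZ]
  and opZ_uminus = linmap_uminus[OF linmap_opZ] and opZ_zero = linmap_zero[OF linmap_opZ]

text \<open>The generator as an element of the algebra and as an operator agree; the inductive step
  is the anticommutation relation, valid on both sides.\<close>

lemma rho_welt: "rho (welt i) x = opW i x"
proof (induction x rule: model_induct)
  case (vac v)
  have "(\<Sum>j\<in>UNIV. scl (wpart j (welt i)) (opW j (vac v))) = (\<Sum>j\<in>UNIV. if i = j then opW j (vac v) else 0)"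
    by (intro sum.cong refl) (simp add: wpart_welt)
  then show ?case by (simp add: rho_vac vact_def deg0_part_neg)
next
  case (add x y)
  then show ?case by (simp add: rho_add_right opW_add)
next
  case (W j x)
  then show ?case
    by (simp add: rho_opW atwist_welt brw_welt rho_uminus rho_ascale rho_zeta opW_uminus opW_opW[of i j, symmetric])
qed

definition negpart :: "ann \<Rightarrow> ann" where
  "negpart a = (\<Sum>j\<in>UNIV. ascale (wpart j a) (welt j)) + ascale (zpart a) zeta"

lemma wpart_diff: "wpart j (a - b) = wpart j a - wpart j b"
  using wpart_add[of j "a - b" b] by simp

lemma zpart_diff: "zpart (a - b) = zpart a - zpart b"
  using zpart_add[of "a - b" b] by simp

lemma nonneg_iff: "a \<in> g_nonneg \<longleftrightarrow> (\<forall>j. wpart j a = 0) \<and> zpart a = 0"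
proof
  assume "a \<in> g_nonneg"
  then have c: "coeff (fst a $ S) 0 = 0" if "card S < 2" for S
    using that unfolding deg_part_def by force
  have "wpart j a = 0" for j by (cases j) (simp_all add: c)
  then show "(\<forall>j. wpart j a = 0) \<and> zpart a = 0" by (simp add: zpart_def c)
next
  assume a: "(\<forall>j. wpart j a = 0) \<and> zpart a = 0"
  have "coeff (fst a $ {k}) 0 = 0" for k
  proof -
    have "wpart W11 a = 0" "wpart W12 a = 0" "wpart W21 a = 0" "wpart W22 a = 0" using a by auto
    then have "coeff (fst a $ {I1}) 0 = 0 \<and> coeff (fst a $ {I2}) 0 = 0 \<and> coeff (fst a $ {I3}) 0 = 0 \<and> coeff (fst a $ {I4}) 0 = 0"
      by simp
    then show ?thesis by (cases k) auto
  qed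
  moreover have "coeff (fst a $ {}) 0 = 0" using a by (simp add: zpart_def)
  moreover have "card S \<noteq> 0 \<Longrightarrow> card S \<noteq> 1 \<Longrightarrow> card S \<ge> 2" for S :: "idx set" by linarith
  ultimately have c: "coeff (fst a $ S) 0 = 0" if "card S < 2" for S
    using that by (metis card_1_singleton_iff card_0_eq finite_idx_set One_nat_def linorder_not_less)
  have "2 * int m + int (card S) - 2 \<ge> 0" if "coeff (fst a $ S) m \<noteq> 0" for S m
    using c[of S] that by (cases "card S < 2"; cases m) auto
  then show "a \<in> g_nonneg" by (auto simp: deg_part_def)
qed

lemma wpart_negpart: "wpart j (negpart a) = wpart j a" and zpart_negpart: "zpart (negpart a) = zpart a"
  by (cases j; simp add: negpart_def wpart_add zpart_add wpart_ascale zpart_ascale wpart_welt sum_widx del: wpart.simps)+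

lemma nonneg_diff: "a - negpart a \<in> g_nonneg"
  by (simp add: nonneg_iff wpart_diff zpart_diff wpart_negpart zpart_negpart del: wpart.simps)

abbreviation sgn_by :: "bool \<Rightarrow> 'a \<Rightarrow> 'a::uminus" where
  "sgn_by p x \<equiv> (if p then - x else x)"

abbreviation twist_by :: "bool \<Rightarrow> ann \<Rightarrow> ann" where
  "twist_by p a \<equiv> (if p then atwist a else a)"

text \<open>Here \<open>a\<close> is meant to be homogeneous, odd if \<open>p\<close> holds and even otherwise.\<close>

definition bracket_rel :: "bool \<Rightarrow> ann \<Rightarrow> ann \<Rightarrow> 'f::g0_module model \<Rightarrow> bool" where
  "bracket_rel p a b x \<longleftrightarrow> rho a (rho b x) = rho (twist_by p b) (rho a x) + rho (abr a b) x"

lemma bracket_rel_welt_right: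
  assumes "atwist a = sgn_by p a"
  shows "bracket_rel p a (welt j) x"
  using assms by (auto simp: bracket_rel_def rho_welt rho_opW atwist_welt rho_uminus opW_uminus brw_def)

lemma bracket_rel_zeta_right: "bracket_rel p a zeta x"
  by (simp add: bracket_rel_def rho_zeta rho_opZ atwist_zeta)

lemma bracket_rel_welt_left: "bracket_rel True (welt j) b x"
  by (simp add: bracket_rel_def rho_welt rho_opW abr_welt_left rho_uminus)

lemma bracket_rel_zeta_left: "bracket_rel False zeta b x"
  by (simp add: bracket_rel_def rho_zeta rho_opZ abr_zeta_left rho_uminus)

lemma bracket_rel_add_right: "bracket_rel p a b x \<Longrightarrow> bracket_rel p a c x \<Longrightarrow> bracket_rel p a (b + c) x"
  by (auto simp: bracket_rel_def rho_add rho_add_right abr_add_right atwist_add)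

lemma bracket_rel_ascale_right: "bracket_rel p a b x \<Longrightarrow> bracket_rel p a (ascale c b) x"
  by (auto simp: bracket_rel_def rho_ascale rho_scl abr_ascale_right atwist_ascale scl_add_right)

lemma bracket_rel_add_left: "bracket_rel p a b x \<Longrightarrow> bracket_rel p c b x \<Longrightarrow> bracket_rel p (a + c) b x"
  by (auto simp: bracket_rel_def rho_add rho_add_right abr_add_left)

lemma bracket_rel_ascale_left: "bracket_rel p a b x \<Longrightarrow> bracket_rel p (ascale c a) b x"
  by (auto simp: bracket_rel_def rho_ascale rho_scl abr_ascale_left scl_add_right)

lemma bracket_rel_zero: "bracket_rel p 0 b x" "bracket_rel p a 0 x"
  by (simp_all add: bracket_rel_def rho_zero rho_zero_right)

lemma bracket_rel_sum_right: "(\<And>i. i \<in> A \<Longrightarrow> bracket_rel p a (h i) x) \<Longrightarrow> bracket_rel p a (\<Sum>i\<in>A. h i) x"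
  by (induction A rule: infinite_finite_induct) (auto intro: bracket_rel_add_right simp: bracket_rel_zero)

lemma bracket_rel_sum_left: "(\<And>i. i \<in> A \<Longrightarrow> bracket_rel p (h i) b x) \<Longrightarrow> bracket_rel p (\<Sum>i\<in>A. h i) b x"
  by (induction A rule: infinite_finite_induct) (auto intro: bracket_rel_add_left simp: bracket_rel_zero)

lemma bracket_rel_negpart_right: "atwist a = sgn_by p a \<Longrightarrow> bracket_rel p a (negpart b) x"
  unfolding negpart_def by (intro bracket_rel_add_right bracket_rel_sum_right bracket_rel_ascale_right bracket_rel_welt_right bracket_rel_zeta_right)

lemma wpart_atwist: "wpart j (atwist a) = - wpart j a"
  by (cases j) (simp_all add: atwist_def parity_twist_def algebra_simps diff_divide_distrib add_divide_distrib)

lemma zpart_atwist: "zpart (atwist a) = zpart a"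
  by (simp add: zpart_def atwist_def parity_twist_def)

lemma wpart_uminus: "wpart j (- a) = - wpart j a" and zpart_uminus: "zpart (- a) = - zpart a"
  using wpart_ascale[of j "-1" a] zpart_ascale[of "-1" a] by (simp_all add: ascale_minus_one del: wpart.simps)

text \<open>Degree -1 is odd and degree -2 is even, so the negative part of a homogeneous element is
  of one kind only and matches a single \<open>p\<close> in \<open>bracket_rel\<close>.\<close>

lemma negpart_homogeneous:
  assumes "atwist a = sgn_by p a"
  shows "negpart a = (if p then (\<Sum>j\<in>UNIV. ascale (wpart j a) (welt j)) else ascale (zpart a) zeta)"
proof (cases p)
  case True
  then have "zpart a = 0" using assms zpart_atwist[of a] zpart_uminus[of a] by simp
  with True show ?thesis by (simp add: negpart_def)
next
  case False
  then have "wpart j a = 0" for j using assms wpart_atwist[of j a] by simp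
  with False show ?thesis by (simp add: negpart_def)
qed

lemma bracket_rel_negpart_left:
  assumes "atwist a = sgn_by p a"
  shows "bracket_rel p (negpart a) b x"
  by (auto simp: negpart_homogeneous[OF assms] bracket_rel_welt_left bracket_rel_zeta_left intro!: bracket_rel_sum_left bracket_rel_ascale_left)

lemma deg0_part_atwist: "deg0_part (atwist a) = deg0_part a"
  by (auto simp: deg0_part_def atwist_def parity_twist_def vec_eq_iff)

lemma atwist_nonneg: "a \<in> g_nonneg \<Longrightarrow> atwist a \<in> g_nonneg"
  by (simp add: nonneg_iff wpart_atwist zpart_atwist del: wpart.simps)

lemma vact_nonneg: "a \<in> g_nonneg \<Longrightarrow> vact a v = vac (act0 (deg0_part a) v)"
  by (simp add: nonneg_iff vact_def)

lemma vac_diff: "vac (v - w) = vac v - vac w"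
  using vac_add[of "v - w" w] by simp

text \<open>Only components of degree 0 act on the vacuum. They are even, so the twist on
  \<open>b\<close> is invisible and the claim is the module axiom of F.\<close>

lemma bracket_rel_nonneg_vac:
  assumes "a \<in> g_nonneg" "b \<in> g_nonneg"
  shows "bracket_rel p a b (vac v)"
proof -
  have "abr a b \<in> g_nonneg"
    by (rule abr_deg_part[OF assms]) simp
  then show ?thesis
    using assms by (simp add: bracket_rel_def rho_vac vact_nonneg atwist_nonneg deg0_part_atwist deg0_part_abr
       act0_bracket[OF deg0_part_deg deg0_part_deg] vac_diff)
qed

text \<open>For negative parts the relation is built into \<open>rho\<close>. Subtracting them
  leaves two elements of g_{>=0}, with \<open>a\<close> still homogeneous.\<close>

lemma bracket_rel_vac:
  assumes "atwist a = sgn_by p a"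
  shows "bracket_rel p a b (vac v)"
proof -
  have "atwist (negpart a) = sgn_by p (negpart a)"
    by (simp add: negpart_homogeneous[OF assms] atwist_sum atwist_ascale atwist_welt atwist_zeta ascale_uminus sum_negf)
  then have n: "atwist (a - negpart a) = sgn_by p (a - negpart a)"
    using assms atwist_add[of a "- negpart a"] by (auto simp: atwist_uminus split: if_splits)
  have "bracket_rel p (a - negpart a) (b - negpart b) (vac v)"
    by (rule bracket_rel_nonneg_vac[OF nonneg_diff nonneg_diff])
  from bracket_rel_add_right[OF this bracket_rel_negpart_right[OF n, of b]] have "bracket_rel p (a - negpart a) b (vac v)"
    by simp
  from bracket_rel_add_left[OF this bracket_rel_negpart_left[OF assms]] show ?thesis by simp
qed

text \<open>By the Jacobi identity the relation propagates along the $w_j$, so it need only be checked on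
  the vacuum.\<close>

lemma rho_bracket_rel:
  assumes "atwist a = sgn_by p a"
  shows "bracket_rel p a b x"
  using assms
proof (induction x arbitrary: p a b rule: model_induct)
  case (vac v)
  then show ?case by (rule bracket_rel_vac)
next
  case (add x y)
  from add.IH(1)[OF add.prems, of b] add.IH(2)[OF add.prems, of b] show ?case
    by (simp add: bracket_rel_def rho_add_right)
next
  case (W j x)
  \<comment> \<open>Bracketing with the odd w_j flips the parity of \<open>a\<close>; hence
    \<open>p\<close>, \<open>a\<close> and \<open>b\<close> are generalised in the
    induction.\<close>
  have R: "atwist (brw j a) = sgn_by (\<not> p) (brw j a)"
    using W.prems brw_atwist[of j a] by (auto simp: brw_uminus split: if_splits) (metis minus_minus)
  \<comment> \<open>Moving w_j past both operators yields the pairs (a, twisted b), ([a, w_j],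
    twisted b) and (a, [b, w_j]); \<open>brw_abr\<close> assembles them.\<close>
  note 1 = W.IH[OF W.prems, of "atwist b"] and 2 = W.IH[OF R, of "atwist b"] and 3 = W.IH[OF W.prems, of "brw j b"]
  show ?case
  proof (cases p)
    case True
    then show ?thesis using 1 2 3 W.prems
      by (simp add: bracket_rel_def rho_opW rho_add_right opW_add atwist_abr brw_abr rho_add brw_atwist rho_uminus opW_uminus
        rho_uminus_right abr_uminus opW_diff rho_diff_right)
  next
    case False
    then show ?thesis using 1 2 3 W.prems
      by (simp add: bracket_rel_def rho_opW rho_add_right opW_add atwist_abr brw_abr rho_add)
  qed
qed

section \<open>The action of the enveloping algebra\<close>

lemma poly_mapping_single_induct [case_names single add]:
  fixes p :: "'k \<Rightarrow>\<^sub>0 'c::comm_monoid_add"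
  assumes "\<And>k c. P (Poly_Mapping.single k c)" "\<And>p q. P p \<Longrightarrow> P q \<Longrightarrow> P (p + q)"
  shows "P p"
proof -
  have "P (\<Sum>k\<in>A. Poly_Mapping.single k (Poly_Mapping.lookup p k))" if "finite A" for A
    using that
  proof induction
    case empty
    then show ?case using assms(1)[of _ 0] by simp
  qed (simp add: assms)
  moreover have "(\<Sum>k\<in>Poly_Mapping.keys p. Poly_Mapping.single k (Poly_Mapping.lookup p k)) = p"
    by (rule poly_mapping_eqI) (simp add: lookup_sum lookup_single when_def in_keys_iff)
  ultimately show ?thesis by (metis finite_keys)
qed

text \<open>\<open>\<kappa>\<close> embeds the coefficients into the complex numbers: the identity
  for the free algebra, \<open>of_int\<close> for the free abelian group underlying Ind(F).\<close>

definition lin_ext :: "('c::comm_monoid_add \<Rightarrow> complex) \<Rightarrow> ('k \<Rightarrow> 'm) \<Rightarrow> ('k \<Rightarrow>\<^sub>0 'c) \<Rightarrow> 'm::cspace" where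
  "lin_ext \<kappa> h p = (\<Sum>k\<in>Poly_Mapping.keys p. scl (\<kappa> (Poly_Mapping.lookup p k)) (h k))"

context
  fixes \<kappa> :: "'c::comm_monoid_add \<Rightarrow> complex"
  assumes \<kappa>: "\<And>a b. \<kappa> (a + b) = \<kappa> a + \<kappa> b" "\<kappa> 0 = 0"
begin

lemma lin_ext_superset:
  assumes "finite A" "Poly_Mapping.keys p \<subseteq> A"
  shows "lin_ext \<kappa> h p = (\<Sum>k\<in>A. scl (\<kappa> (Poly_Mapping.lookup p k)) (h k))"
  unfolding lin_ext_def by (rule sum.mono_neutral_left) (use assms \<kappa>(2) in \<open>auto simp: in_keys_iff\<close>)

lemma lin_ext_add: "lin_ext \<kappa> h (p + q) = lin_ext \<kappa> h p + lin_ext \<kappa> h q"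
proof -
  let ?A = "Poly_Mapping.keys p \<union> Poly_Mapping.keys q"
  have "lin_ext \<kappa> h r = (\<Sum>k\<in>?A. scl (\<kappa> (Poly_Mapping.lookup r k)) (h k))" if "Poly_Mapping.keys r \<subseteq> ?A" for r
    using that by (intro lin_ext_superset) auto
  then show ?thesis
    using Poly_Mapping.keys_add[of p q] by (simp add: lookup_add \<kappa> scl_add_left sum.distrib)
qed

lemma lin_ext_single: "lin_ext \<kappa> h (Poly_Mapping.single k c) = scl (\<kappa> c) (h k)"
  using lin_ext_superset[of "{k}" "Poly_Mapping.single k c" h] by simp

end

fun word_act :: "ann list \<Rightarrow> 'f::g0_module model \<Rightarrow> 'f model" where
  "word_act [] x = x"
| "word_act (a # as) x = rho a (word_act as x)"

definition free_act :: "free_alg \<Rightarrow> 'f::g0_module model \<Rightarrow> 'f model" where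
  "free_act p x = lin_ext (\<lambda>c. c) (\<lambda>w. word_act (case w of Word as \<Rightarrow> as) x) p"

lemma free_act_add: "free_act (p + q) x = free_act p x + free_act q x"
  by (simp add: free_act_def lin_ext_add)

lemma free_act_single: "free_act (Poly_Mapping.single (Word as) c) x = scl c (word_act as x)"
  by (simp add: free_act_def lin_ext_single)

lemma linmap_word_act: "linmap (word_act as)"
  by (induction as) (simp_all add: linmap_def rho_add_right rho_scl)

lemma linmap_free_act: "linmap (free_act p)"
proof (induction p rule: poly_mapping_single_induct)
  case (single w c)
  then show ?case
    by (cases w) (simp add: linmap_def free_act_single linmap_add[OF linmap_word_act] linmap_scl[OF linmap_word_act]
      scl_add_right mult.commute)
next
  case (add p q)
  then show ?case by (simp add: linmap_def free_act_add scl_add_right add_ac)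
qed

lemma word_act_append: "word_act (as @ bs) x = word_act as (word_act bs x)"
  by (induction as) simp_all

lemma free_act_mult: "free_act (p * q) x = free_act p (free_act q x)"
proof (induction p rule: poly_mapping_single_induct)
  case (single w c)
  obtain as where w: "w = Word as" by (cases w)
  show ?case
  proof (induction q rule: poly_mapping_single_induct)
    case (single w' d)
    then show ?case
      by (cases w') (simp add: w mult_single free_act_single word_act_append linmap_scl[OF linmap_word_act])
  next
    case (add p q)
    then show ?case by (simp add: distrib_left free_act_add linmap_add[OF linmap_free_act])
  qed
next
  case (add p q)
  then show ?case by (simp add: distrib_right free_act_add)
qed

lemma free_act_zero: "free_act 0 x = 0"
  by (simp add: free_act_def lin_ext_def)

lemma free_act_uminus: "free_act (- p) x = - free_act p x"
  using free_act_add[of p "- p" x] by (simp add: free_act_zero eq_neg_iff_add_eq_0 add.commute)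

lemma free_act_diff: "free_act (p - q) x = free_act p x - free_act q x"
  using free_act_add[of p "- q" x] by (simp add: free_act_uminus)

lemma free_act_letter: "free_act (letter a) x = rho a x"
  by (simp add: letter_def free_act_single)

lemma free_act_fscal: "free_act (fscal c) x = scl c x"
  by (simp add: fscal_def zero_gword_def free_act_single)

lemma free_act_one: "free_act 1 x = x"
  using free_act_fscal[of 1 x] by (simp add: fscal_def)

lemma free_act_neg_one_power: "free_act ((-1) ^ n) x = scl ((-1) ^ n) x"
  by (cases "even n") (simp_all add: free_act_one free_act_uminus scl_uminus_left)

text \<open>Valid for every \<open>i\<close>, since for \<open>i\<close> at least 2 the set
  \<open>parity_part i\<close> contains only 0.\<close>

lemma parity_part_atwist: "a \<in> parity_part i \<Longrightarrow> atwist a = ascale ((-1) ^ i) a"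
proof -
  assume a: "a \<in> parity_part i"
  obtain f z where az: "a = (f, z)" by (cases a)
  have "(-1) ^ card S * f $ S = smult ((-1) ^ i) (f $ S)" for S
  proof (cases "f $ S = 0")
    case False
    then have "card S mod 2 = i" using a by (auto simp: az parity_part_def)
    then show ?thesis by (cases "even (card S)") auto
  qed simp
  moreover have "z = (-1) ^ i * z"
    using a by (cases "z = 0") (auto simp: az parity_part_def)
  ultimately show ?thesis by (simp add: az atwist_def ascale_def parity_twist_def)
qed

lemma rho_bracket:
  assumes "a \<in> parity_part i" "b \<in> parity_part j"
  shows "rho a (rho b x) - scl ((-1) ^ (i * j)) (rho b (rho a x)) = rho (abr a b) x"
proof -
  have a: "atwist a = sgn_by (odd i) a"
    using parity_part_atwist[OF assms(1)] by (cases "even i") (auto simp: ascale_minus_one)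
  have b: "atwist b = ascale ((-1) ^ j) b"
    by (rule parity_part_atwist[OF assms(2)])
  have "bracket_rel (odd i) a b x" by (rule rho_bracket_rel[OF a])
  moreover have "twist_by (odd i) b = ascale ((-1) ^ (i * j)) b"
    using b by (cases "even i"; cases "even j") auto
  ultimately show ?thesis by (simp add: bracket_rel_def rho_ascale)
qed

text \<open>The linear relations hold because \<open>rho\<close> is bilinear, the quadratic ones by
  \<open>rho_bracket\<close>. Hence the action descends to the enveloping algebra.\<close>

lemma free_act_env_ideal: "p \<in> env_ideal \<Longrightarrow> free_act p x = 0"
proof (induction arbitrary: x rule: env_ideal.induct)
  case (bracket a i b j p q)
  show ?case
    using rho_bracket[OF bracket, of "free_act q x"]
    by (simp add: free_act_mult free_act_diff free_act_letter free_act_neg_one_power linmap_zero[OF linmap_free_act])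
qed (simp_all add: free_act_zero free_act_add free_act_mult free_act_diff free_act_letter free_act_fscal
    rho_add rho_ascale linmap_zero[OF linmap_free_act])

definition env_act :: "env \<Rightarrow> 'f::g0_module model \<Rightarrow> 'f model" where
  "env_act u = free_act (rep_env u)"

lemma env_act_abs: "env_act (abs_env p) x = free_act p x"
proof -
  have "rep_env (abs_env p) - p \<in> env_ideal"
    by (rule Quotient_rep_abs[OF Quotient_env]) (simp add: env_ideal.zero)
  then have "free_act (rep_env (abs_env p) - p) x = 0" by (rule free_act_env_ideal)
  then show ?thesis by (simp add: env_act_def free_act_diff)
qed

lemma env_abs_cases: obtains p where "u = abs_env p"
  using Quotient_abs_rep[OF Quotient_env, of u] by metis

lemma env_act_mult: "env_act (u * w) x = env_act u (env_act w x)"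
  by (cases u rule: env_abs_cases; cases w rule: env_abs_cases)
    (simp add: times_env.abs_eq env_act_abs free_act_mult)
lemma env_act_add: "env_act (u + w) x = env_act u x + env_act w x"
  by (cases u rule: env_abs_cases; cases w rule: env_abs_cases)
    (simp add: plus_env.abs_eq env_act_abs free_act_add)
lemma env_act_zero: "env_act 0 x = 0"
  by (simp add: zero_env_def env_act_abs free_act_zero)
lemma env_act_one: "env_act 1 x = x"
  by (simp add: one_env_def env_act_abs free_act_one)
lemma env_act_embed: "env_act (embed a) x = rho a x"
  by (simp add: embed.abs_eq env_act_abs free_act_letter)
lemma env_act_scalar: "env_act (scalar c) x = scl c x"
  by (simp add: scalar.abs_eq env_act_abs free_act_fscal)
lemma linmap_env_act: "linmap (env_act u)"
  unfolding env_act_def by (rule linmap_free_act)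

lemma fscal_commute: "fscal c * p = p * fscal c"
proof (induction p rule: poly_mapping_single_induct)
  case (single k d)
  then show ?case by (simp add: fscal_def mult_single mult.commute)
qed (simp add: distrib_left distrib_right)

lemma abs_env_eqI: "p - q \<in> env_ideal \<Longrightarrow> abs_env p = abs_env q"
  by (simp add: env.abs_eq_iff)

lemma scalar_commute: "scalar c * u = u * scalar c"
  by (cases u rule: env_abs_cases) (simp add: scalar.abs_eq times_env.abs_eq fscal_commute)
lemma scalar_mult: "scalar c * scalar d = scalar (c * d)"
  by (simp add: scalar.abs_eq times_env.abs_eq fscal_def mult_single)
lemma scalar_add: "scalar (c + d) = scalar c + scalar d"
  by (simp add: scalar.abs_eq plus_env.abs_eq fscal_def single_add)
lemma scalar_one: "scalar 1 = 1"
  by (simp add: scalar.abs_eq one_env_def fscal_def)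
lemma embed_add: "embed (a + b) = embed a + embed b"
proof -
  have "letter (a + b) - (letter a + letter b) = 1 * (letter (a + b) - letter a - letter b) * 1"
    by simp
  then have "letter (a + b) - (letter a + letter b) \<in> env_ideal"
    using env_ideal.lin_add[of 1 a b 1] by (simp only:)
  then show ?thesis by (simp add: embed.abs_eq plus_env.abs_eq abs_env_eqI)
qed
lemma embed_ascale: "embed (ascale c a) = scalar c * embed a"
  using env_ideal.lin_scale[of 1 c a 1]
  by (simp add: embed.abs_eq scalar.abs_eq times_env.abs_eq abs_env_eqI)
lemma embed_bracket:
  assumes "a \<in> parity_part i" "b \<in> parity_part j"
  shows "embed a * embed b = scalar ((-1) ^ (i * j)) * embed b * embed a + embed (abr a b)"
proof -
  have "fscal ((-1) ^ n) = (-1) ^ n" for n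
    by (cases "even n") (simp_all add: fscal_def single_uminus)
  then have "letter a * letter b - (fscal ((-1) ^ (i * j)) * letter b * letter a + letter (abr a b)) \<in> env_ideal"
    using env_ideal.bracket[OF assms, of 1 1] by (simp add: algebra_simps)
  then show ?thesis
    by (simp add: embed.abs_eq scalar.abs_eq times_env.abs_eq plus_env.abs_eq abs_env_eqI)
qed

lemma embed_zero: "embed 0 = 0"
  using embed_add[of 0 0] by simp
lemma embed_uminus: "embed (- a) = - embed a"
  using embed_add[of a "- a"] by (simp add: embed_zero eq_neg_iff_add_eq_0 add.commute)
lemma embed_diff: "embed (a - b) = embed a - embed b"
  using embed_add[of a "- b"] by (simp add: embed_uminus)
lemma scalar_zero: "scalar 0 = 0"
  using scalar_add[of 0 0] by simp
lemma scalar_uminus: "scalar (- c) = - scalar c"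
  using scalar_add[of c "- c"] by (simp add: scalar_zero eq_neg_iff_add_eq_0 add.commute)

section \<open>The induced module and its model\<close>

declare opW.simps [simp del]

lemma abs_ind_eqI: "p - q \<in> ind_rel \<Longrightarrow> abs_ind p = abs_ind q"
  by (simp add: ind.abs_eq_iff)

lemma tensor_abs: "u \<otimes> v = abs_ind (frag_of (u, v))"
  by (simp add: tensor.abs_eq)

lemma tensor_add_left: "(u + w) \<otimes> v = u \<otimes> v + w \<otimes> v"
  using ind_rel.add_left[of u w v]
  by (simp add: tensor_abs plus_ind.abs_eq abs_ind_eqI diff_diff_add)

lemma tensor_add_right: "u \<otimes> (v + v') = u \<otimes> v + u \<otimes> v'"
  using ind_rel.add_right[of u v v']
  by (simp add: tensor_abs plus_ind.abs_eq abs_ind_eqI diff_diff_add)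

lemma tensor_scalar: "(u * scalar c) \<otimes> v = u \<otimes> fscale c v"
  using ind_rel.scalar[of u c v] by (simp add: tensor_abs abs_ind_eqI)

lemma tensor_balance: "a \<in> g_deg 0 \<Longrightarrow> b \<in> g_pos \<Longrightarrow> (u * embed (a + b)) \<otimes> v = u \<otimes> act0 a v"
  using ind_rel.balance[of a b u v] by (simp add: tensor_abs abs_ind_eqI)

lemma ind_abs_cases: obtains p where "x = abs_ind p"
  using Quotient_abs_rep[OF Quotient_ind, of x] by metis

lemma uact_add_right: "u \<cdot> (x + y) = u \<cdot> x + u \<cdot> y"
  by (cases x rule: ind_abs_cases; cases y rule: ind_abs_cases)
    (simp add: plus_ind.abs_eq uact.abs_eq frag_extend_add)

lemma uact_tensor: "u \<cdot> (w \<otimes> v) = (u * w) \<otimes> v"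
  by (simp add: tensor_abs uact.abs_eq)

lemma uact_zero_right: "u \<cdot> 0 = 0"
  using uact_add_right[of u 0 0] by simp

lemma uact_uminus_right: "u \<cdot> (- x) = - (u \<cdot> x)"
  using uact_add_right[of u x "- x"] by (simp add: uact_zero_right eq_neg_iff_add_eq_0 add.commute)

lemma uact_diff_right: "u \<cdot> (x - y) = u \<cdot> x - u \<cdot> y"
  using uact_add_right[of u x "- y"] by (simp add: uact_uminus_right)

lemma ind_induct [case_names tensor diff]:
  assumes "\<And>u v. P (u \<otimes> v)" "\<And>x y. P x \<Longrightarrow> P y \<Longrightarrow> P (x - y)"
  shows "P x"
proof -
  have P0: "P 0" using assms(2)[OF assms(1) assms(1), of undefined undefined undefined undefined] by simp
  obtain p where x: "x = abs_ind p" by (rule ind_abs_cases)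
  have "P (abs_ind p)"
    using subset_UNIV[of "Poly_Mapping.keys p"]
  proof (induction p rule: frag_induction)
    case zero
    then show ?case using P0 by (simp add: zero_ind_def)
  next
    case (one y)
    then show ?case using assms(1)[of "fst y" "snd y"] by (simp add: tensor_abs)
  next
    case (diff a b)
    then show ?case using assms(2)[of "abs_ind a" "abs_ind b"] by (simp add: minus_ind.abs_eq)
  qed
  then show ?thesis by (simp add: x)
qed

lemma uact_mult: "(u * w) \<cdot> x = u \<cdot> w \<cdot> x"
  by (induction x rule: ind_induct) (simp_all add: uact_tensor mult.assoc uact_diff_right)

lemma uact_add_left: "(u + w) \<cdot> x = u \<cdot> x + w \<cdot> x"
  by (induction x rule: ind_induct) (simp_all add: uact_tensor distrib_right tensor_add_left uact_diff_right)

lemma uact_zero_left: "0 \<cdot> x = 0"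
  using uact_add_left[of 0 0 x] by simp

lemma uact_one: "1 \<cdot> x = x"
  by (induction x rule: ind_induct) (simp_all add: uact_tensor uact_diff_right)

instantiation ind :: (g0_module) cspace
begin
definition "scl c (x :: 'a ind) = scalar c \<cdot> x"
instance
  by standard (simp_all add: scl_ind_def uact_add_right uact_add_left scalar_add uact_mult[symmetric] scalar_mult
    scalar_one uact_one)
end

lemma linmap_uact: "linmap (uact u)"
  by (simp add: linmap_def scl_ind_def uact_add_right uact_mult[symmetric] scalar_commute)

text \<open>The map sending u tensor v to u applied to \<open>vac v\<close>, given on
  representatives; \<open>to_model_abs\<close> shows independence of the choice.\<close>

definition to_model :: "'f::g0_module ind \<Rightarrow> 'f model" where
  "to_model x = lin_ext of_int (\<lambda>(u, v). env_act u (vac v)) (rep_ind x)"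

lemma to_model_abs: "to_model (abs_ind p) = lin_ext of_int (\<lambda>(u, v). env_act u (vac v)) p"
proof -
  let ?L = "lin_ext of_int (\<lambda>(u, v). env_act u (vac v)) :: _ \<Rightarrow> 'a model"
  have add: "?L (p + q) = ?L p + ?L q" for p q
    by (rule lin_ext_add) simp_all
  have diff: "?L (p - q) = ?L p - ?L q" for p q
    using add[of "p - q" q] by (simp add: algebra_simps)
  have sing: "?L (frag_of (u, v)) = env_act u (vac v)" for u v
    using lin_ext_single[of of_int "\<lambda>(u, v). env_act u (vac v) :: 'a model" "(u, v)" 1] by simp
  have "?L p = 0" if "p \<in> ind_rel" for p
    using that
  proof induction
    case zero
    then show ?case using diff[of 0 0] by simp
  next
    \<comment> \<open>On the vacuum \<open>rho\<close> sees only the component of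
      \<open>a + b\<close> of degree 0, which is \<open>a\<close>.\<close>
    case (balance a b u v)
    have "a + b \<in> g_nonneg"
      by (rule deg_part_add[OF deg_part_mono[OF balance(1)] deg_part_mono[OF balance(2)]]) simp_all
    then have "rho (a + b) (vac v) = vac (act0 a v)"
      using balance by (simp add: rho_vac vact_nonneg deg0_part_add deg0_part_same deg0_part_pos)
    then show ?case
      by (simp add: diff sing env_act_mult env_act_embed)
  qed (simp_all add: diff sing env_act_add vac_add linmap_add[OF linmap_env_act] env_act_mult env_act_scalar
      vac_scale)
  moreover have "rep_ind (abs_ind p) - p \<in> ind_rel"
    by (rule Quotient_rep_abs[OF Quotient_ind]) (simp add: ind_rel.zero)
  ultimately have "?L (rep_ind (abs_ind p) - p) = 0" by blast
  then show ?thesis by (simp add: to_model_def diff)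
qed

lemma to_model_tensor: "to_model (u \<otimes> v) = env_act u (vac v)"
  using lin_ext_single[of of_int "\<lambda>(u, v). env_act u (vac v)" "(u, v)" 1]
  by (simp add: tensor_abs to_model_abs)

lemma to_model_add: "to_model (x + y) = to_model x + to_model y"
  by (cases x rule: ind_abs_cases; cases y rule: ind_abs_cases)
    (simp add: plus_ind.abs_eq to_model_abs lin_ext_add)

lemma to_model_zero: "to_model 0 = 0"
  using to_model_add[of 0 0] by simp

lemma to_model_diff: "to_model (x - y) = to_model x - to_model y"
  using to_model_add[of "x - y" y] by simp

lemma to_model_uact: "to_model (u \<cdot> x) = env_act u (to_model x)"
  by (induction x rule: ind_induct)
    (simp_all add: uact_tensor to_model_tensor env_act_mult uact_diff_right to_model_diff linmap_diff[OF linmap_env_act])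

text \<open>\<open>from_model\<close> is built up along the generators in the same way as \<open>rho\<close>.\<close>

definition adj_map :: "widx \<Rightarrow> ('n \<Rightarrow> 'f::g0_module ind) \<Rightarrow> 'n \<times> 'n \<Rightarrow> 'f ind" where
  "adj_map k h x = h (fst x) + embed (welt k) \<cdot> h (snd x)"

primrec list_map :: "'f::g0_module list \<Rightarrow> 'f ind" where
  "list_map [] = 0"
| "list_map (v # vs) = 1 \<otimes> v + embed zeta \<cdot> list_map vs"

definition poly_map :: "'f::g0_module poly \<Rightarrow> 'f ind" where
  "poly_map q = list_map (coeffs q)"

definition from_model :: "'f::g0_module model \<Rightarrow> 'f ind" where
  "from_model = adj_map W11 (adj_map W12 (adj_map W21 (adj_map W22 poly_map)))"

lemma tensor_zero: "u \<otimes> 0 = 0"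
  using tensor_add_right[of u 0 0] by simp

lemma tensor_fscale: "u \<otimes> fscale c v = scl c (u \<otimes> v)"
  by (simp add: scl_ind_def uact_tensor scalar_commute tensor_scalar)

lemma poly_map_zero: "poly_map 0 = 0"
  by (simp add: poly_map_def)

lemma poly_map_pCons: "poly_map (pCons v q) = 1 \<otimes> v + embed zeta \<cdot> poly_map q"
  by (auto simp: poly_map_def cCons_def tensor_zero uact_zero_right)

lemma linmap_poly_map: "linmap poly_map"
proof -
  have "poly_map (p + q) = poly_map p + poly_map q" for p q :: "'a poly"
    by (induction p q rule: poly_induct2) (simp_all add: poly_map_zero poly_map_pCons tensor_add_right uact_add_right)
  moreover have "poly_map (scl c q) = scl c (poly_map q)" for c and q :: "'a poly"
    by (induction q) (simp_all add: poly_map_zero poly_map_pCons tensor_fscale scl_add_right linmap_scl[OF linmap_uact])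
  ultimately show ?thesis by (simp add: linmap_def)
qed

lemma linmap_adj_map: "linmap h \<Longrightarrow> linmap (adj_map k h)"
  by (simp add: linmap_def[of "adj_map k h"] adj_map_def linmap_add linmap_scl uact_add_right scl_prod_def
    scl_add_right linmap_scl[OF linmap_uact])

lemma embed_even_odd:
  obtains b c where "a = b + c" "b \<in> parity_part 0" "c \<in> parity_part 1"
proof
  let ?f = "fst a"
  show "a = ((\<chi> S. if even (card S) then ?f $ S else 0), snd a) + ((\<chi> S. if even (card S) then 0 else ?f $ S), 0)"
    by (simp add: prod_eq_iff vec_eq_iff)
  show "((\<chi> S. if even (card S) then ?f $ S else 0), snd a) \<in> parity_part 0"
    "((\<chi> S. if even (card S) then 0 else ?f $ S), 0) \<in> parity_part 1"
    by (auto simp: parity_part_def mod_2_eq_odd)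
qed

lemma welt_parity: "welt j \<in> parity_part 1"
proof -
  have "card S mod 2 = 1" if "fst (welt j) $ S \<noteq> 0" for S
  proof (rule ccontr)
    assume "card S mod 2 \<noteq> 1"
    then have "S \<noteq> {k}" for k by auto
    then have "fst (welt j) $ S = 0" by (simp add: fst_welt tmon_def)
    with that show False by simp
  qed
  then show ?thesis by (cases "welt j") (use snd_welt(1)[of j] in \<open>auto simp: parity_part_def\<close>)
qed

text \<open>The rule behind \<open>equivar\<close>, now inside U(g). The bracket relation has
  opposite signs for the even and the odd part of \<open>a\<close>, and \<open>atwist\<close> merges
  the two.\<close>

lemma embed_welt_right: "embed a * embed (welt j) = embed (welt j) * embed (atwist a) + embed (brw j a)"
proof -
  obtain b c where a: "a = b + c" "b \<in> parity_part 0" "c \<in> parity_part 1"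
    by (rule embed_even_odd)
  have "atwist b = b" "atwist c = - c"
    using a(2,3)[THEN parity_part_atwist] by (simp_all add: ascale_minus_one)
  then show ?thesis
    using embed_bracket[OF a(2) welt_parity, of j] embed_bracket[OF a(3) welt_parity, of j]
    by (simp add: a(1) embed_add atwist_add embed_uminus embed_diff brw_add scalar_one scalar_uminus algebra_simps)
      (simp add: brw_def)
qed

lemma embed_welt_anticommute:
  "embed (welt i) * embed (welt j) + embed (welt j) * embed (welt i) = scalar (gram i j) * embed zeta"
  using embed_welt_right[of "welt i" j]
  by (simp add: atwist_welt embed_uminus brw_welt embed_ascale algebra_simps)

lemma embed_welt_square: "embed (welt j) * embed (welt j) = 0"
proof -
  have "scalar (1/2) * (embed (welt j) * embed (welt j) + embed (welt j) * embed (welt j)) = 0"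
    unfolding embed_welt_anticommute by (simp add: scalar_zero)
  moreover have "scalar (1/2) * (x + x) = x" for x
    using scalar_add[of "1/2" "1/2"] by (simp add: distrib_left distrib_right[symmetric] scalar_one)
  ultimately show ?thesis by metis
qed

lemma embed_welt_zeta: "embed zeta * embed (welt j) = embed (welt j) * embed zeta"
  using embed_welt_right[of zeta j] by (simp add: atwist_zeta brw_zeta embed_zero)

lemma adj_map_new: "adj_map k h (adj_new x) = embed (welt k) \<cdot> adj_map k h x" if "linmap h"
  by (simp add: adj_map_def adj_new_def linmap_zero[OF that] uact_add_right uact_zero_left embed_welt_square
     flip: uact_mult)

lemma adj_map_old:
  assumes "linmap h" "\<And>x. h (e x) = embed (welt j) \<cdot> h x" "\<And>x. h (z x) = embed zeta \<cdot> h x"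
  shows "adj_map k h (adj_old (gram j k) z e x) = embed (welt j) \<cdot> adj_map k h x"
proof -
  have ac: "embed (welt k) \<cdot> embed (welt j) \<cdot> y = scl (gram j k) (embed zeta \<cdot> y) - embed (welt j) \<cdot> embed (welt k) \<cdot> y" for y
  proof -
    have "embed (welt j) \<cdot> embed (welt k) \<cdot> y + embed (welt k) \<cdot> embed (welt j) \<cdot> y = scl (gram j k) (embed zeta \<cdot> y)"
      unfolding scl_ind_def uact_mult[symmetric] uact_add_left[symmetric] embed_welt_anticommute ..
    then show ?thesis by (simp add: algebra_simps)
  qed
  show ?thesis
    by (simp add: adj_map_def adj_old_def assms(2,3) linmap_add[OF assms(1)] linmap_scl[OF assms(1)]
      linmap_uminus[OF assms(1)] uact_add_right uact_uminus_right ac)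
qed

lemma adj_map_z:
  assumes "\<And>x. h (z x) = embed zeta \<cdot> h x"
  shows "adj_map k h (map_prod z z x) = embed zeta \<cdot> adj_map k h x"
  by (simp add: adj_map_def assms uact_add_right uact_mult[symmetric] embed_welt_zeta)

lemma from_model_opW: "from_model (opW j x) = embed (welt j) \<cdot> from_model x"
proof -
  note l0 = linmap_poly_map
  note l1 = linmap_adj_map[OF l0, of W22]
  note l2 = linmap_adj_map[OF l1, of W21]
  note l3 = linmap_adj_map[OF l2, of W12]
  have z0: "poly_map (z0 x) = embed zeta \<cdot> poly_map x" for x :: "'a poly"
    by (simp add: poly_map_pCons tensor_zero)
  have z1: "adj_map W22 poly_map (z1 x) = embed zeta \<cdot> adj_map W22 poly_map x" for x :: "_ \<times> 'a poly"
    by (rule adj_map_z) (rule z0)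
  have z2: "adj_map W21 (adj_map W22 poly_map) (z2 x) = embed zeta \<cdot> adj_map W21 (adj_map W22 poly_map) x"
    for x :: "_ \<times> _ \<times> 'a poly"
    by (rule adj_map_z) (rule z1)
  have z3: "adj_map W12 (adj_map W21 (adj_map W22 poly_map)) (z3 x) =
      embed zeta \<cdot> adj_map W12 (adj_map W21 (adj_map W22 poly_map)) x" for x :: "_ \<times> _ \<times> _ \<times> 'a poly"
    by (rule adj_map_z) (rule z2)
  show ?thesis
  proof (cases j)
    case W11
    show ?thesis unfolding from_model_def W11 opW.simps by (rule adj_map_new[OF l3])
  next
    case W12
    show ?thesis unfolding from_model_def W12 opW.simps
      by (rule adj_map_old[OF l3]) (rule adj_map_new[OF l2], rule z3)
  next
    case W21
    show ?thesis unfolding from_model_def W21 opW.simps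
      by (rule adj_map_old[OF l3], rule adj_map_old[OF l2]) (rule adj_map_new[OF l1], rule z2, rule z3)
  next
    case W22
    show ?thesis unfolding from_model_def W22 opW.simps
      by (rule adj_map_old[OF l3], rule adj_map_old[OF l2], rule adj_map_old[OF l1])
        (rule adj_map_new[OF l0], rule z1, rule z2, rule z3)
  qed
qed

lemma linmap_from_model: "linmap from_model"
  unfolding from_model_def by (intro linmap_adj_map linmap_poly_map)

lemma from_model_vac: "from_model (vac v) = 1 \<otimes> v"
proof -
  show ?thesis
    unfolding from_model_def vac_def adj_map_def
    by (simp add: poly_map_pCons poly_map_zero uact_zero_right)
qed

lemma from_model_opZ: "from_model (opZ x) = embed zeta \<cdot> from_model x"
proof -
  have "opZ x = opW W11 (opW W22 x) + opW W22 (opW W11 x)"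
    unfolding opW_opW gram_simps scl_one ..
  then show ?thesis
    using embed_welt_anticommute[of W11 W22]
    by (simp add: linmap_add[OF linmap_from_model] from_model_opW scalar_one flip: uact_mult uact_add_left)
qed

text \<open>Both sides move past w_j by the same rule, so agreement on the vacuum suffices. There
  the nonnegative part of \<open>a\<close> is handled by balancing, the negative part by
  \<open>from_model_opW\<close> and \<open>from_model_opZ\<close>.\<close>

lemma from_model_rho: "from_model (rho a x) = embed a \<cdot> from_model x"
proof (induction x arbitrary: a rule: model_induct)
  case (vac v)
  let ?b = "a - negpart a"
  have "deg0_part (negpart a) = 0"
    by (simp add: negpart_def deg0_part_add deg0_part_ascale deg0_part_neg sum_widx)
  then have d: "deg0_part ?b = deg0_part a"
    using deg0_part_add[of ?b "negpart a"] by simp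
  have "embed ?b \<cdot> (1 \<otimes> v) = 1 \<otimes> act0 (deg0_part a) v"
    using tensor_balance[OF deg0_part_deg[of ?b] nonneg_split[OF nonneg_diff[of a]], where u = 1 and v = v]
    by (simp add: uact_tensor d)
  moreover have "embed (negpart a) \<cdot> (1 \<otimes> v) =
      (\<Sum>j\<in>UNIV. scl (wpart j a) (embed (welt j) \<cdot> (1 \<otimes> v))) + scl (zpart a) (embed zeta \<cdot> (1 \<otimes> v))"
    by (simp add: negpart_def embed_add embed_ascale uact_add_left sum_widx scl_ind_def uact_mult)
  moreover have "embed a \<cdot> (1 \<otimes> v) = embed ?b \<cdot> (1 \<otimes> v) + embed (negpart a) \<cdot> (1 \<otimes> v)"
    by (simp add: embed_diff flip: uact_add_left)
  ultimately show ?case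
    by (simp add: rho_vac vact_def linmap_add[OF linmap_from_model] linmap_sum[OF linmap_from_model]
      linmap_scl[OF linmap_from_model] from_model_vac from_model_opW from_model_opZ)
next
  case (add x y)
  then show ?case by (simp add: rho_add_right linmap_add[OF linmap_from_model] uact_add_right)
next
  case (W j x)
  then show ?case
    by (simp add: rho_opW linmap_add[OF linmap_from_model] from_model_opW embed_welt_right flip: uact_mult uact_add_left)
qed

lemma from_model_env_act: "from_model (env_act u x) = u \<cdot> from_model x"
proof -
  obtain p where u: "u = abs_env p" by (rule env_abs_cases)
  have "from_model (free_act p x) = abs_env p \<cdot> from_model x"
  proof (induction p arbitrary: x rule: poly_mapping_single_induct)
    case (single w c)
    obtain as where w: "w = Word as" by (cases w)
    have "from_model (word_act as x) = abs_env (Poly_Mapping.single (Word as) 1) \<cdot> from_model x" for x :: "'a model"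
    proof (induction as)
      case Nil
      have "abs_env (Poly_Mapping.single (Word []) 1) = 1"
        by (simp add: one_env_def flip: zero_gword_def)
      then show ?case by (simp add: uact_one)
    next
      case (Cons a as)
      have "Poly_Mapping.single (Word (a # as)) 1 = letter a * Poly_Mapping.single (Word as) (1 :: complex)"
        by (simp add: letter_def mult_single)
      then have "abs_env (Poly_Mapping.single (Word (a # as)) 1) = embed a * abs_env (Poly_Mapping.single (Word as) 1)"
        by (simp add: embed.abs_eq times_env.abs_eq)
      then show ?case using Cons by (simp add: from_model_rho uact_mult)
    qed
    moreover have "Poly_Mapping.single (Word as) c = fscal c * Poly_Mapping.single (Word as) 1"
      by (simp add: fscal_def mult_single)
    then have "abs_env (Poly_Mapping.single (Word as) c) = scalar c * abs_env (Poly_Mapping.single (Word as) 1)"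
      by (simp add: scalar.abs_eq times_env.abs_eq)
    ultimately show ?case
      by (simp add: w free_act_single linmap_scl[OF linmap_from_model] scl_ind_def uact_mult)
  next
    case (add p q)
    then show ?case
      by (simp add: free_act_add linmap_add[OF linmap_from_model] uact_add_left flip: plus_env.abs_eq)
  qed
  then show ?thesis by (simp add: u env_act_abs)
qed

text \<open>This left inverse makes \<open>to_model\<close> injective, so equations in Ind(F) can be
  tested in the model.\<close>

lemma from_model_to_model: "from_model (to_model x) = x"
  by (induction x rule: ind_induct)
    (simp_all add: to_model_tensor from_model_env_act from_model_vac uact_tensor to_model_diff
      linmap_diff[OF linmap_from_model])

lemma to_model_eq_iff: "to_model x = to_model y \<longleftrightarrow> x = y"
  by (metis from_model_to_model)

section \<open>Brackets in low degree\<close>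

lemma ascale_diff: "ascale c (a - b) = ascale c a - ascale c b"
  using ascale_add_right[of c "a - b" b] by simp

text \<open>Coordinates in the basis xi_ij, t, C of g_0, which reduce the brackets below to
  arithmetic of eight complex numbers.\<close>

definition g0v :: "complex \<Rightarrow> complex \<Rightarrow> complex \<Rightarrow> complex \<Rightarrow> complex \<Rightarrow> complex \<Rightarrow> complex \<Rightarrow> complex \<Rightarrow> ann" where
  "g0v c12 c13 c14 c23 c24 c34 ct cC = ascale c12 (xi2 I1 I2) + ascale c13 (xi2 I1 I3) + ascale c14 (xi2 I1 I4)
     + ascale c23 (xi2 I2 I3) + ascale c24 (xi2 I2 I4) + ascale c34 (xi2 I3 I4) + ascale ct tt + ascale cC central"

definition g1v :: "complex \<Rightarrow> complex \<Rightarrow> complex \<Rightarrow> complex \<Rightarrow> ann" where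
  "g1v c1 c2 c3 c4 = ascale c1 (elt (xi {I1})) + ascale c2 (elt (xi {I2})) + ascale c3 (elt (xi {I3})) + ascale c4 (elt (xi {I4}))"

lemma g0v_add: "g0v a b c d e f g h + g0v a' b' c' d' e' f' g' h' =
    g0v (a + a') (b + b') (c + c') (d + d') (e + e') (f + f') (g + g') (h + h')"
  by (simp add: g0v_def ascale_add_left algebra_simps)

lemma g0v_ascale: "ascale k (g0v a b c d e f g h) = g0v (k * a) (k * b) (k * c) (k * d) (k * e) (k * f) (k * g) (k * h)"
  by (simp add: g0v_def ascale_add_right)

lemma g0v_zero: "0 = g0v 0 0 0 0 0 0 0 0"
  by (simp add: g0v_def)

lemma g1v_add: "g1v a b c d + g1v a' b' c' d' = g1v (a + a') (b + b') (c + c') (d + d')"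
  by (simp add: g1v_def ascale_add_left algebra_simps)

lemma g1v_ascale: "ascale k (g1v a b c d) = g1v (k * a) (k * b) (k * c) (k * d)"
  by (simp add: g1v_def ascale_add_right)

lemma g1v_zero: "0 = g1v 0 0 0 0"
  by (simp add: g1v_def)

text \<open>The element t w_j; together with \<open>dualelt\<close> these span g_1.\<close>

definition twelt :: "widx \<Rightarrow> ann" where
  "twelt j = (\<Sum>k\<in>UNIV. ascale (wcoef j k) (elt (tmon 1 {k})))"

text \<open>The Hodge dual of w_j, under the map from xi_k to the derivative of xi_1234 by xi_k. The
  cocycle pairs it with degree -1, which is how C enters the equations.\<close>

definition dualelt :: "widx \<Rightarrow> ann" where
  "dualelt j = (\<Sum>k\<in>UNIV. ascale (wcoef j k) (elt (pd k (xi UNIV))))"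

lemma g0_g0v:
  "hx = g0v (- \<i>) 0 0 0 0 \<i> 0 0"
  "hy = g0v (- \<i>) 0 0 0 0 (- \<i>) 0 0"
  "ex = g0v 0 (- 1/2) (- \<i>/2) (\<i>/2) (- 1/2) 0 0 0"
  "fx = g0v 0 (1/2) (- \<i>/2) (\<i>/2) (1/2) 0 0 0"
  "ey = g0v 0 (- 1/2) (\<i>/2) (\<i>/2) (1/2) 0 0 0"
  "fy = g0v 0 (1/2) (\<i>/2) (\<i>/2) (- 1/2) 0 0 0"
  "tt = g0v 0 0 0 0 0 0 1 0"
  "central = g0v 0 0 0 0 0 0 0 1"
  unfolding g0v_def hx_def hy_def ex_def fx_def ey_def fy_def ascale_add_right ascale_diff ascale_uminus ascale_ascale
  by (simp_all add: ascale_uminus)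

lemma brxi_axis: "brxi k (elt (axis S p)) =
    (- adxi k (axis S ((-1) ^ card S * p)), - poly (ximul k (axis S p) $ UNIV) 0)"
  by (simp add: brxi_def abr_def Kbr_xi_right psi_xi_right psi_xi_left parity_twist_axis)

lemma set_eq_UNIV_idx: "A = UNIV \<longleftrightarrow> I1 \<in> A \<and> I2 \<in> A \<and> I3 \<in> A \<and> I4 \<in> A"
  "UNIV = A \<longleftrightarrow> I1 \<in> A \<and> I2 \<in> A \<and> I3 \<in> A \<and> I4 \<in> A"
  by (metis UNIV_I UNIV_eq_I idx.exhaust)+

lemma ascale_axis: "ascale c (axis S p, z) = (axis S (smult c p), c * z)"
  by (simp add: ascale_def vec_eq_iff axis_def)

lemma axis_component: "axis S p $ T = (if T = S then p else 0)" for p :: "complex poly"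
  by (simp add: axis_def)

lemma insert_order_idx: "insert I2 (insert I1 S) = insert I1 (insert I2 S)" "insert I3 (insert I1 S) = insert I1 (insert I3 S)"
    "insert I4 (insert I1 S) = insert I1 (insert I4 S)" "insert I3 (insert I2 S) = insert I2 (insert I3 S)"
    "insert I4 (insert I2 S) = insert I2 (insert I4 S)" "insert I4 (insert I3 S) = insert I3 (insert I4 S)"
  by auto

lemma pderiv_monom1: "pderiv (monom 1 (Suc 0)) = 1" "pderiv (- monom 1 (Suc 0)) = - 1"
  by (simp_all add: monom_altdef pderiv_pCons one_pCons)

lemma poly_const_one: "[:1:] = (1 :: complex poly)" "[:- 1:] = (- 1 :: complex poly)" "monom 1 0 = (1 :: complex poly)"
  by (simp_all add: one_pCons)

lemma brxi_elt_uminus: "brxi k (elt (- f)) = - brxi k (elt f)"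
  using brxi_uminus[of k "elt f"] by simp

lemma ascale_central: "ascale c (0, z) = (0, c * z)"
  by (simp add: ascale_def vec_eq_iff)

lemmas brxi_eval = tmon_axis brxi_axis adxi_def grass_axis lsign_insert insert_order_idx insert_Diff_if
  pderiv_monom1 axis_component ascale_axis axis_zero set_eq_UNIV_idx axis_uminus grass_uminus poly_const_one brxi_elt_uminus ascale_central

lemma brxi_txi:
  "brxi I1 (elt (tmon 1 {I1})) = g0v 0 0 0 0 0 0 (- 1) 0"
  "brxi I2 (elt (tmon 1 {I1})) = g0v (- 1) 0 0 0 0 0 0 0"
  "brxi I3 (elt (tmon 1 {I1})) = g0v 0 (- 1) 0 0 0 0 0 0"
  "brxi I4 (elt (tmon 1 {I1})) = g0v 0 0 (- 1) 0 0 0 0 0"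
  "brxi I1 (elt (tmon 1 {I2})) = g0v 1 0 0 0 0 0 0 0"
  "brxi I2 (elt (tmon 1 {I2})) = g0v 0 0 0 0 0 0 (- 1) 0"
  "brxi I3 (elt (tmon 1 {I2})) = g0v 0 0 0 (- 1) 0 0 0 0"
  "brxi I4 (elt (tmon 1 {I2})) = g0v 0 0 0 0 (- 1) 0 0 0"
  "brxi I1 (elt (tmon 1 {I3})) = g0v 0 1 0 0 0 0 0 0"
  "brxi I2 (elt (tmon 1 {I3})) = g0v 0 0 0 1 0 0 0 0"
  "brxi I3 (elt (tmon 1 {I3})) = g0v 0 0 0 0 0 0 (- 1) 0"
  "brxi I4 (elt (tmon 1 {I3})) = g0v 0 0 0 0 0 (- 1) 0 0"
  "brxi I1 (elt (tmon 1 {I4})) = g0v 0 0 1 0 0 0 0 0"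
  "brxi I2 (elt (tmon 1 {I4})) = g0v 0 0 0 0 1 0 0 0"
  "brxi I3 (elt (tmon 1 {I4})) = g0v 0 0 0 0 0 1 0 0"
  "brxi I4 (elt (tmon 1 {I4})) = g0v 0 0 0 0 0 0 (- 1) 0"
  by (simp_all add: brxi_eval g0v_def tt_def central_def zero_prod_def)

lemma pd_xi_UNIV:
  "pd I1 (xi UNIV) = axis {I2, I3, I4} 1" "pd I2 (xi UNIV) = axis {I1, I3, I4} (- 1)"
  "pd I3 (xi UNIV) = axis {I1, I2, I4} 1" "pd I4 (xi UNIV) = axis {I1, I2, I3} (- 1)"
  by (simp_all add: tmon_axis pd_axis UNIV_idx insert_Diff_if lsign_insert)

lemma brxi_xi3:
  "brxi I1 (elt (pd I1 (xi UNIV))) = g0v 0 0 0 0 0 0 0 (- 1)"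
  "brxi I2 (elt (pd I1 (xi UNIV))) = g0v 0 0 0 0 0 (- 1) 0 0"
  "brxi I3 (elt (pd I1 (xi UNIV))) = g0v 0 0 0 0 1 0 0 0"
  "brxi I4 (elt (pd I1 (xi UNIV))) = g0v 0 0 0 (- 1) 0 0 0 0"
  "brxi I1 (elt (pd I2 (xi UNIV))) = g0v 0 0 0 0 0 1 0 0"
  "brxi I2 (elt (pd I2 (xi UNIV))) = g0v 0 0 0 0 0 0 0 (- 1)"
  "brxi I3 (elt (pd I2 (xi UNIV))) = g0v 0 0 (- 1) 0 0 0 0 0"
  "brxi I4 (elt (pd I2 (xi UNIV))) = g0v 0 1 0 0 0 0 0 0"
  "brxi I1 (elt (pd I3 (xi UNIV))) = g0v 0 0 0 0 (- 1) 0 0 0"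
  "brxi I2 (elt (pd I3 (xi UNIV))) = g0v 0 0 1 0 0 0 0 0"
  "brxi I3 (elt (pd I3 (xi UNIV))) = g0v 0 0 0 0 0 0 0 (- 1)"
  "brxi I4 (elt (pd I3 (xi UNIV))) = g0v (- 1) 0 0 0 0 0 0 0"
  "brxi I1 (elt (pd I4 (xi UNIV))) = g0v 0 0 0 1 0 0 0 0"
  "brxi I2 (elt (pd I4 (xi UNIV))) = g0v 0 (- 1) 0 0 0 0 0 0"
  "brxi I3 (elt (pd I4 (xi UNIV))) = g0v 1 0 0 0 0 0 0 0"
  "brxi I4 (elt (pd I4 (xi UNIV))) = g0v 0 0 0 0 0 0 0 (- 1)"
  unfolding pd_xi_UNIV by (simp_all add: brxi_eval g0v_def central_def zero_prod_def)

lemma brxi_xi2: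
  "brxi I1 (xi2 I1 I2) = g1v 0 1 0 0"
  "brxi I2 (xi2 I1 I2) = g1v (- 1) 0 0 0"
  "brxi I3 (xi2 I1 I2) = g1v 0 0 0 0"
  "brxi I4 (xi2 I1 I2) = g1v 0 0 0 0"
  "brxi I1 (xi2 I1 I3) = g1v 0 0 1 0"
  "brxi I2 (xi2 I1 I3) = g1v 0 0 0 0"
  "brxi I3 (xi2 I1 I3) = g1v (- 1) 0 0 0"
  "brxi I4 (xi2 I1 I3) = g1v 0 0 0 0"
  "brxi I1 (xi2 I1 I4) = g1v 0 0 0 1"
  "brxi I2 (xi2 I1 I4) = g1v 0 0 0 0"
  "brxi I3 (xi2 I1 I4) = g1v 0 0 0 0"
  "brxi I4 (xi2 I1 I4) = g1v (- 1) 0 0 0"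
  "brxi I1 (xi2 I2 I3) = g1v 0 0 0 0"
  "brxi I2 (xi2 I2 I3) = g1v 0 0 1 0"
  "brxi I3 (xi2 I2 I3) = g1v 0 (- 1) 0 0"
  "brxi I4 (xi2 I2 I3) = g1v 0 0 0 0"
  "brxi I1 (xi2 I2 I4) = g1v 0 0 0 0"
  "brxi I2 (xi2 I2 I4) = g1v 0 0 0 1"
  "brxi I3 (xi2 I2 I4) = g1v 0 0 0 0"
  "brxi I4 (xi2 I2 I4) = g1v 0 (- 1) 0 0"
  "brxi I1 (xi2 I3 I4) = g1v 0 0 0 0"
  "brxi I2 (xi2 I3 I4) = g1v 0 0 0 0"
  "brxi I3 (xi2 I3 I4) = g1v 0 0 0 1"
  "brxi I4 (xi2 I3 I4) = g1v 0 0 (- 1) 0"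
  by (simp_all add: brxi_eval g1v_def zero_prod_def)

lemma brxi_tt:
  "brxi I1 tt = g1v (- 1) 0 0 0"
  "brxi I2 tt = g1v 0 (- 1) 0 0"
  "brxi I3 tt = g1v 0 0 (- 1) 0"
  "brxi I4 tt = g1v 0 0 0 (- 1)"
  by (simp_all add: tt_def brxi_eval g1v_def zero_prod_def)

lemma brxi_central: "brxi k central = 0"
  by (simp add: brxi_def)

lemma welt_g1v:
  "welt W11 = g1v \<i> 1 0 0"
  "welt W12 = g1v 0 0 \<i> (- 1)"
  "welt W21 = g1v 0 0 \<i> 1"
  "welt W22 = g1v (- \<i>) 1 0 0"
  by (simp_all add: welt_def sum_idx g1v_def)

lemma brw_g0v: "brw j (g0v a b c d e f g h) =
   (\<Sum>k\<in>UNIV. ascale (wcoef j k) (ascale a (brxi k (xi2 I1 I2)) + ascale b (brxi k (xi2 I1 I3)) + ascale c (brxi k (xi2 I1 I4))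
     + ascale d (brxi k (xi2 I2 I3)) + ascale e (brxi k (xi2 I2 I4)) + ascale f (brxi k (xi2 I3 I4)) + ascale g (brxi k tt)))"
  by (simp add: brw_sum g0v_def brxi_add brxi_ascale brxi_central)

section \<open>Bracket tables of g_1 and g_0 with the w_j\<close>

lemma brw_twelt:
  "brw W11 (twelt W11) = 0"
  "brw W12 (twelt W11) = ascale (- 2) ex"
  "brw W21 (twelt W11) = ascale (- 2) ey"
  "brw W22 (twelt W11) = hx + hy + ascale (- 2) tt"
  "brw W11 (twelt W12) = ascale 2 ex"
  "brw W12 (twelt W12) = 0"
  "brw W21 (twelt W12) = ascale (- 1) hx + hy + ascale 2 tt"
  "brw W22 (twelt W12) = ascale 2 fy"
  "brw W11 (twelt W21) = ascale 2 ey"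
  "brw W12 (twelt W21) = hx + ascale (- 1) hy + ascale 2 tt"
  "brw W21 (twelt W21) = 0"
  "brw W22 (twelt W21) = ascale 2 fx"
  "brw W11 (twelt W22) = ascale (- 1) hx + ascale (- 1) hy + ascale (- 2) tt"
  "brw W12 (twelt W22) = ascale (- 2) fy"
  "brw W21 (twelt W22) = ascale (- 2) fx"
  "brw W22 (twelt W22) = 0"
  unfolding twelt_def brw_sum sum_idx brxi_add brxi_ascale wcoef.simps idx.case brxi_txi g0_g0v g0v_ascale g0v_add
  by (simp_all add: g0v_zero[symmetric])

lemma brw_dualelt:
  "brw W11 (dualelt W11) = 0"
  "brw W12 (dualelt W11) = ascale 2 ex"
  "brw W21 (dualelt W11) = ascale (- 2) ey"
  "brw W22 (dualelt W11) = ascale (- 1) hx + hy + ascale (- 2) central"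
  "brw W11 (dualelt W12) = ascale (- 2) ex"
  "brw W12 (dualelt W12) = 0"
  "brw W21 (dualelt W12) = hx + hy + ascale 2 central"
  "brw W22 (dualelt W12) = ascale 2 fy"
  "brw W11 (dualelt W21) = ascale 2 ey"
  "brw W12 (dualelt W21) = ascale (- 1) hx + ascale (- 1) hy + ascale 2 central"
  "brw W21 (dualelt W21) = 0"
  "brw W22 (dualelt W21) = ascale (- 2) fx"
  "brw W11 (dualelt W22) = hx + ascale (- 1) hy + ascale (- 2) central"
  "brw W12 (dualelt W22) = ascale (- 2) fy"
  "brw W21 (dualelt W22) = ascale 2 fx"
  "brw W22 (dualelt W22) = 0"
  unfolding dualelt_def brw_sum sum_idx brxi_add brxi_ascale wcoef.simps idx.case brxi_xi3 g0_g0v g0v_ascale g0v_add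
  by (simp_all add: g0v_zero[symmetric])

lemma brw_g0:
  "brw W11 ex = 0"
  "brw W12 ex = 0"
  "brw W21 ex = welt W11"
  "brw W22 ex = welt W12"
  "brw W11 fx = welt W21"
  "brw W12 fx = welt W22"
  "brw W21 fx = 0"
  "brw W22 fx = 0"
  "brw W11 hx = welt W11"
  "brw W12 hx = welt W12"
  "brw W21 hx = ascale (- 1) (welt W21)"
  "brw W22 hx = ascale (- 1) (welt W22)"
  "brw W11 ey = 0"
  "brw W12 ey = welt W11"
  "brw W21 ey = 0"
  "brw W22 ey = welt W21"
  "brw W11 fy = welt W12"
  "brw W12 fy = 0"
  "brw W21 fy = welt W22"
  "brw W22 fy = 0"
  "brw W11 hy = welt W11"
  "brw W12 hy = ascale (- 1) (welt W12)"
  "brw W21 hy = welt W21"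
  "brw W22 hy = ascale (- 1) (welt W22)"
  "brw W11 tt = ascale (- 1) (welt W11)"
  "brw W12 tt = ascale (- 1) (welt W12)"
  "brw W21 tt = ascale (- 1) (welt W21)"
  "brw W22 tt = ascale (- 1) (welt W22)"
  "brw W11 central = 0"
  "brw W12 central = 0"
  "brw W21 central = 0"
  "brw W22 central = 0"
  unfolding g0_g0v brw_g0v sum_idx wcoef.simps idx.case brxi_xi2 brxi_tt[unfolded g0_g0v] welt_g1v g1v_ascale g1v_add
  by (simp_all add: g1v_zero[symmetric] g1v_ascale g1v_add)

lemma atwist_g0: "atwist hx = hx" "atwist hy = hy" "atwist ex = ex" "atwist fx = fx" "atwist ey = ey" "atwist fy = fy"
  "atwist tt = tt" "atwist central = central"
proof -
  have "atwist (xi2 i j) = xi2 i j" if "i \<noteq> j" for i j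
    using that by (simp add: atwist_def tmon_axis grass_axis)
  moreover have "atwist tt = tt" "atwist central = central"
    by (simp_all add: tt_def central_def atwist_def tmon_axis grass_axis)
  ultimately have "atwist (g0v a b c d e f g h) = g0v a b c d e f g h" for a b c d e f g h
    by (simp add: g0v_def atwist_add atwist_ascale)
  then show "atwist hx = hx" "atwist hy = hy" "atwist ex = ex" "atwist fx = fx" "atwist ey = ey" "atwist fy = fy"
    "atwist tt = tt" "atwist central = central"
    by (simp_all add: g0_g0v)
qed

lemma atwist_twelt: "atwist (twelt j) = - twelt j"
proof -
  have "atwist (elt (tmon 1 {k})) = - elt (tmon 1 {k})" for k
    by (simp add: atwist_def tmon_axis grass_axis axis_uminus)
  then show ?thesis
    by (simp add: twelt_def atwist_sum atwist_ascale ascale_uminus(1)[symmetric] flip: sum_negf)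
qed

lemma atwist_dualelt: "atwist (dualelt j) = - dualelt j"
proof -
  have "atwist (elt (pd k (xi UNIV))) = - elt (pd k (xi UNIV))" for k
    by (cases k) (simp_all only: pd_xi_UNIV, simp_all add: atwist_def grass_axis grass_uminus axis_uminus)
  then show ?thesis
    by (simp add: dualelt_def atwist_sum atwist_ascale ascale_uminus(1)[symmetric] flip: sum_negf)
qed

text \<open>The factor 4 is the product of [t xi_k, 1] = -2 xi_k and zeta = -2.\<close>

lemma abr_twelt_zeta: "abr (twelt j) zeta = ascale 4 (welt j)"
proof -
  have "abr (elt (tmon 1 {k})) zeta = ascale 4 (elt (xi {k}))" for k
  proof -
    have "poly (tmon 1 {k} $ UNIV) 0 = 0" by (simp add: tmon_def set_eq_UNIV_idx poly_monom)
    then show ?thesis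
      by (simp add: zeta_def abr_ascale_right abr_elt_uminus abr_one_right)
        (simp add: tmon_axis dt_axis pderiv_monom1 poly_const_one ascale_def vec_eq_iff axis_component numeral_poly)
  qed
  then show ?thesis
    by (simp add: twelt_def welt_def sum_idx abr_add_left abr_ascale_left ascale_add_right mult.commute)
qed

lemma abr_dualelt_zeta: "abr (dualelt j) zeta = 0"
proof -
  have "abr (elt (pd k (xi UNIV))) zeta = 0" for k
    by (cases k) (simp_all only: pd_xi_UNIV, simp_all add: zeta_def abr_ascale_right abr_elt_uminus abr_one_right
      axis_uminus grass_uminus dt_axis axis_component set_eq_UNIV_idx axis_zero zero_prod_def vec_eq_iff ascale_central)
  then show ?thesis
    by (simp add: dualelt_def sum_idx abr_add_left abr_ascale_left)
qed

lemma elt_axis_deg: "(\<And>m. coeff p m \<noteq> 0 \<Longrightarrow> P (2 * int m + int (card S) - 2)) \<Longrightarrow> elt (axis S p) \<in> deg_part P"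
  by (auto simp: deg_part_def axis_component)

lemma deg_part_ascale: "a \<in> deg_part P \<Longrightarrow> ascale c a \<in> deg_part P"
  by (auto simp: deg_part_def ascale_def)

lemma deg_part_zero: "0 \<in> deg_part P"
  by (simp add: deg_part_def zero_prod_def)

lemma deg_part_sum: "(\<And>i. i \<in> A \<Longrightarrow> h i \<in> deg_part P) \<Longrightarrow> (\<Sum>i\<in>A. h i) \<in> deg_part P"
  by (induction A rule: infinite_finite_induct) (auto simp: deg_part_zero deg_part_add)

lemma twelt_pos: "twelt j \<in> g_pos"
  unfolding twelt_def tmon_axis by (intro deg_part_sum deg_part_ascale elt_axis_deg) (auto split: if_splits)

lemma dualelt_pos: "dualelt j \<in> g_pos"
proof -
  have "elt (pd k (xi UNIV)) \<in> g_pos" for k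
    by (cases k) (simp_all only: pd_xi_UNIV, (rule elt_axis_deg, simp)+)
  then show ?thesis
    unfolding dualelt_def by (intro deg_part_sum deg_part_ascale)
qed

lemma g0v_deg: "g0v a b c d e f g h \<in> g_deg 0"
proof -
  have "xi2 i j \<in> g_deg 0" if "i \<noteq> j" for i j
    unfolding tmon_axis using that by (intro elt_axis_deg) (auto simp: poly_const_one split: if_splits)
  moreover have "tt \<in> g_deg 0" unfolding tt_def tmon_axis by (intro elt_axis_deg) (auto split: if_splits)
  moreover have "central \<in> g_deg 0" by (simp add: central_def deg_part_def)
  ultimately show ?thesis
    unfolding g0v_def by (intro deg_part_add deg_part_ascale) auto
qed

lemma g0_deg: "hx \<in> g_deg 0" "hy \<in> g_deg 0" "ex \<in> g_deg 0" "fx \<in> g_deg 0" "ey \<in> g_deg 0" "fy \<in> g_deg 0"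
  "tt \<in> g_deg 0" "central \<in> g_deg 0"
  by (simp_all only: g0_g0v g0v_deg)

lemma rho_vac_deg0: "a \<in> g_deg 0 \<Longrightarrow> rho a (vac v) = vac (act0 a v)"
  by (simp add: rho_vac vact_nonneg[OF deg_part_mono[of a "\<lambda>k. k = 0"]] deg0_part_same)

lemma rho_vac_pos: "a \<in> g_pos \<Longrightarrow> rho a (vac v) = 0"
  by (simp add: rho_vac vact_nonneg[OF deg_part_mono[of a "\<lambda>k. k > 0"]] deg0_part_pos)

lemma abr_ex_zeta: "abr ex zeta = 0" "abr ey zeta = 0"
proof -
  have "abr (xi2 i j) zeta = 0" for i j
  proof -
    have "UNIV \<noteq> {i, j}" by (cases i; cases j) (simp_all add: set_eq_UNIV_idx)
    then have "xi {i, j} $ UNIV = 0" by (simp add: tmon_def)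
    then show ?thesis
      by (simp add: zeta_def abr_ascale_right abr_elt_uminus abr_one_right dt_xi ascale_central zero_prod_def)
  qed
  then have "abr (g0v a b c d e f 0 0) zeta = 0" for a b c d e f
    by (simp add: g0v_def abr_add_left abr_ascale_left)
  then show "abr ex zeta = 0" "abr ey zeta = 0"
    by (simp_all only: g0_g0v)
qed

lemma scl_diff_right: "scl c (x - y) = scl c x - scl c y"
  using scl_add_right[of c "x - y" y] by (simp add: algebra_simps)

text \<open>Rewriting that drives an operator rightwards through all w_j and zeta until it meets the
  vacuum. \<open>rho_opW\<close> is instantiated at named elements, so that only brackets from the
  tables arise.\<close>

lemmas rho_eval = rho_opW[of "twelt i" for i] rho_opW[of "dualelt i" for i] rho_opW[of hx] rho_opW[of hy] rho_opW[of ex] rho_opW[of fx] rho_opW[of ey] rho_opW[of fy] rho_opW[of tt] rho_opW[of central]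
  rho_opZ atwist_twelt atwist_dualelt atwist_g0 brw_twelt brw_dualelt brw_g0 abr_twelt_zeta abr_dualelt_zeta abr_ex_zeta
  rho_add rho_ascale rho_uminus rho_zero rho_welt rho_add_right rho_scl rho_uminus_right rho_zero_right
  opW_add opW_scl opW_uminus opW_zero opZ_add opZ_scl opZ_uminus opZ_zero
  rho_vac_deg0[OF g0_deg(1)] rho_vac_deg0[OF g0_deg(2)] rho_vac_deg0[OF g0_deg(3)] rho_vac_deg0[OF g0_deg(4)]
  rho_vac_deg0[OF g0_deg(5)] rho_vac_deg0[OF g0_deg(6)] rho_vac_deg0[OF g0_deg(7)] rho_vac_deg0[OF g0_deg(8)]
  rho_vac_pos[OF twelt_pos] rho_vac_pos[OF dualelt_pos]
  opW_diff scl_add_right scl_diff_right scl_uminus_left scl_uminus_right rho_diff_right linmap_diff[OF linmap_opZ]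

text \<open>The coefficient \<open>bij\<close> belongs to the cubic monomial that omits $w_{ij}$.\<close>

definition cubic :: "'f \<Rightarrow> 'f \<Rightarrow> 'f \<Rightarrow> 'f \<Rightarrow> 'f \<Rightarrow> 'f \<Rightarrow> 'f \<Rightarrow> 'f \<Rightarrow> 'f::g0_module model" where
  "cubic a11 a12 a21 a22 b11 b12 b21 b22 =
    opZ (opW W11 (vac a11) + opW W12 (vac a12) + opW W21 (vac a21) + opW W22 (vac a22))
    + opW W11 (opW W12 (opW W21 (vac b22))) + opW W11 (opW W12 (opW W22 (vac b21)))
    + opW W11 (opW W21 (opW W22 (vac b12))) + opW W12 (opW W21 (opW W22 (vac b11)))"

section \<open>The component of degree 3\<close>

text \<open>zeta has weight 2, and each w will have weight 1. Degrees are integers so that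
  subtraction is not truncated: in weight 3 the product of all four w's needs a coefficient of
  weight -1, which must be 0.\<close>

definition pdeg :: "int \<Rightarrow> 'f::g0_module poly \<Rightarrow> bool" where
  "pdeg d q \<longleftrightarrow> (\<forall>k. coeff q k \<noteq> 0 \<longrightarrow> 2 * int k = d)"

definition adj_deg :: "(int \<Rightarrow> 'n \<Rightarrow> bool) \<Rightarrow> int \<Rightarrow> 'n \<times> 'n \<Rightarrow> bool" where
  "adj_deg P d x \<longleftrightarrow> P d (fst x) \<and> P (d - 1) (snd x)"

definition mdeg :: "int \<Rightarrow> 'f::g0_module model \<Rightarrow> bool" where
  "mdeg = adj_deg (adj_deg (adj_deg (adj_deg pdeg)))"

lemma pdeg_zero: "pdeg d 0"
  by (simp add: pdeg_def)

lemma pdeg_add: "pdeg d p \<Longrightarrow> pdeg d q \<Longrightarrow> pdeg d (p + q)"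
  unfolding pdeg_def by (metis add.right_neutral coeff_add)

lemma pdeg_uminus: "pdeg d p \<Longrightarrow> pdeg d (- p)"
  by (simp add: pdeg_def)

lemma pdeg_diff: "pdeg d p \<Longrightarrow> pdeg d q \<Longrightarrow> pdeg d (p - q)"
  using pdeg_add[of d p "- q"] pdeg_uminus[of d q] by simp

lemma pdeg_scl: "pdeg d p \<Longrightarrow> pdeg d (scl c p)"
  unfolding pdeg_def by (metis coeff_scl fs.scale_zero_right)

lemma pdeg_Z: "pdeg e (pCons 0 p) \<longleftrightarrow> pdeg (e - 2) p"
proof
  assume p: "pdeg e (pCons 0 p)"
  show "pdeg (e - 2) p"
    unfolding pdeg_def
  proof (intro allI impI)
    fix k assume "coeff p k \<noteq> 0"
    then have "2 * int (Suc k) = e"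
      using p unfolding pdeg_def by (metis coeff_pCons_Suc)
    then show "2 * int k = e - 2" by simp
  qed
qed (auto simp: pdeg_def coeff_pCons split: nat.splits)

lemmas mdeg_simps = mdeg_def adj_deg_def

lemma mdeg_vac: "mdeg 0 (vac v)"
  by (simp add: mdeg_simps vac_def pdeg_zero) (simp add: pdeg_def coeff_pCons split: nat.split)

lemma mdeg_zero: "mdeg d 0"
  by (simp add: mdeg_simps pdeg_zero)

lemma mdeg_add: "mdeg d x \<Longrightarrow> mdeg d y \<Longrightarrow> mdeg d (x + y)"
  by (simp add: mdeg_simps pdeg_add)

lemma mdeg_scl: "mdeg d x \<Longrightarrow> mdeg d (scl c x)"
  by (simp add: mdeg_simps scl_prod_def pdeg_scl)

lemma mdeg_sum: "(\<And>i. i \<in> A \<Longrightarrow> mdeg d (h i)) \<Longrightarrow> mdeg d (\<Sum>i\<in>A. h i)"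
  by (induction A rule: infinite_finite_induct) (auto simp: mdeg_zero mdeg_add)

lemma mdeg_opW: "mdeg d x \<Longrightarrow> mdeg (d + 1) (opW j x)"
  by (cases j) (simp_all add: mdeg_simps opW.simps adj_new_def adj_old_def scl_uminus_left
    pdeg_zero pdeg_add pdeg_diff pdeg_uminus pdeg_Z)

lemma mdeg_opZ: "mdeg d x \<Longrightarrow> mdeg (d + 2) (opZ x)"
  by (simp add: mdeg_simps opZ_def pdeg_Z)

lemma pdeg_cases:
  "pdeg 3 p \<Longrightarrow> p = 0" "pdeg 1 p \<Longrightarrow> p = 0" "pdeg (- 1) p \<Longrightarrow> p = 0"
  "pdeg 2 p \<Longrightarrow> \<exists>v. p = [:0, v:]" "pdeg 0 p \<Longrightarrow> \<exists>v. p = [:v:]"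
proof -
  have *: "pdeg d p \<Longrightarrow> \<forall>k. 2 * int k \<noteq> d \<Longrightarrow> p = 0" for d
    by (auto simp: pdeg_def poly_eq_iff)
  have "\<forall>k. 2 * int k \<noteq> 3" "\<forall>k. 2 * int k \<noteq> 1" "\<forall>k. 2 * int k \<noteq> - 1"
    by presburger+
  then show "pdeg 3 p \<Longrightarrow> p = 0" "pdeg 1 p \<Longrightarrow> p = 0" "pdeg (- 1) p \<Longrightarrow> p = 0"
    using * by blast+
  assume "pdeg 2 p"
  then have "p = [:0, coeff p 1:]"
    unfolding pdeg_def poly_eq_iff by (auto simp: coeff_pCons split: nat.split)
  then show "\<exists>v. p = [:0, v:]" ..
next
  assume "pdeg 0 p"
  then have "p = [:coeff p 0:]"
    unfolding pdeg_def poly_eq_iff by (auto simp: coeff_pCons split: nat.split)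
  then show "\<exists>v. p = [:v:]" ..
qed

text \<open>The weight is odd, so the number of w's is odd: one with a single zeta, or three
  without. The other eight components vanish.\<close>

lemma mdeg_cubic:
  assumes "mdeg 3 x"
  obtains a11 a12 a21 a22 b11 b12 b21 b22 where "x = cubic a11 a12 a21 a22 b11 b12 b21 b22"
proof -
  obtain p0 p22 p21 p2122 p12 p1222 p1221 p122122 p11 p1122 p1121 p112122 p1112 p111222 p111221 p11122122
    where x: "x = ((((p0, p22), (p21, p2122)), ((p12, p1222), (p1221, p122122))),
        (((p11, p1122), (p1121, p112122)), ((p1112, p111222), (p111221, p11122122))))"
    by (metis prod.exhaust)
  have z: "p0 = 0" "p2122 = 0" "p1222 = 0" "p1221 = 0" "p1122 = 0" "p1121 = 0" "p1112 = 0" "p11122122 = 0"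
    using assms by (simp_all add: x mdeg_simps pdeg_cases)
  obtain a22 a21 a12 a11 where a: "p22 = [:0, a22:]" "p21 = [:0, a21:]" "p12 = [:0, a12:]" "p11 = [:0, a11:]"
    using assms by (simp add: x mdeg_simps) (metis pdeg_cases(4))
  obtain b11 b12 b21 b22 where b: "p122122 = [:b11:]" "p112122 = [:b12:]" "p111222 = [:b21:]" "p111221 = [:b22:]"
    using assms by (simp add: x mdeg_simps) (metis pdeg_cases(5))
  have "x = cubic a11 a12 a21 a22 b11 b12 b21 b22"
    by (simp add: x z a b cubic_def opZ_def opW.simps adj_new_def adj_old_def vac_def zero_prod_def)
  then show thesis by (rule that)
qed

section \<open>Degrees in the induced module and in the model\<close>

lemma deg_part_disjoint: "a \<in> deg_part P \<Longrightarrow> a \<in> deg_part Q \<Longrightarrow> (\<And>k. P k \<Longrightarrow> Q k \<Longrightarrow> False) \<Longrightarrow> a = 0"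
  by (cases a) (force simp: deg_part_def vec_eq_iff poly_eq_iff zero_prod_def)

lemma welt_deg: "welt j \<in> g_deg (- 1)" and zeta_deg: "zeta \<in> g_deg (- 2)"
proof -
  show "welt j \<in> g_deg (- 1)"
    unfolding welt_def tmon_axis
    by (intro deg_part_sum deg_part_ascale elt_axis_deg) (auto simp: poly_const_one split: if_splits)
  have "elt (- xi {}) \<in> g_deg (- 2)"
    unfolding tmon_axis axis_uminus[symmetric]
    by (intro elt_axis_deg) (auto simp: poly_const_one split: if_splits)
  then show "zeta \<in> g_deg (- 2)"
    unfolding zeta_def by (rule deg_part_ascale)
qed

lemma neg_eq_negpart:
  assumes "a \<in> deg_part (\<lambda>k. k < 0)"
  shows "a = negpart a"
proof -
  have "negpart a \<in> deg_part (\<lambda>k. k < 0)"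
    unfolding negpart_def
    by (intro deg_part_add deg_part_sum deg_part_ascale deg_part_mono[OF welt_deg] deg_part_mono[OF zeta_deg]) auto
  from deg_part_add[OF assms deg_part_ascale[OF this, of "-1"]]
  have "a - negpart a \<in> deg_part (\<lambda>k. k < 0)" by (simp add: ascale_minus_one)
  from deg_part_disjoint[OF this nonneg_diff] show ?thesis by simp
qed

lemma rho_negpart: "rho (negpart a) x = (\<Sum>j\<in>UNIV. scl (wpart j a) (opW j x)) + scl (zpart a) (opZ x)"
  by (simp add: negpart_def rho_add rho_sum rho_ascale rho_welt rho_zeta)

text \<open>\<open>neg_env\<close> admits arbitrary factors from g_{-k}. Such a factor is a
  combination of the w_j for k = 1, a multiple of zeta for k = 2, and 0 for larger k.\<close>

lemma mdeg_rho_neg: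
  assumes "a \<in> g_deg (- int k)" "k > 0" "mdeg d x"
  shows "mdeg (d + int k) (rho a x)"
proof -
  have a: "a = negpart a"
    by (rule neg_eq_negpart) (use assms in \<open>auto intro: deg_part_mono\<close>)
  have c: "coeff (fst a $ S) 0 = 0" if "int (card S) - 2 \<noteq> - int k" for S
    using assms(1) that unfolding deg_part_def by force
  have z: "zpart a = 0" if "k \<noteq> 2" using c[of "{}"] that by (simp add: zpart_def)
  have w: "wpart j a = 0" if "k \<noteq> 1" for j using that by (cases j) (simp_all add: c)
  have "mdeg (d + int k) (scl (wpart j a) (opW j x))" for j
    using mdeg_scl[OF mdeg_opW[OF assms(3)], of "wpart j a" j] w by (cases "k = 1") (auto simp: mdeg_zero)
  moreover have "mdeg (d + int k) (scl (zpart a) (opZ x))"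
    using mdeg_scl[OF mdeg_opZ[OF assms(3)], of "zpart a"] z by (cases "k = 2") (auto simp: mdeg_zero)
  ultimately show ?thesis
    by (subst a) (simp only: rho_negpart mdeg_add mdeg_sum)
qed

lemma env_act_neg_env: "u \<in> neg_env d \<Longrightarrow> mdeg (int d) (env_act u (vac v))"
proof (induction rule: neg_env.induct)
  case zero
  then show ?case by (simp add: env_act_zero mdeg_zero)
next
  case (add u w)
  then show ?case by (simp add: env_act_add mdeg_add)
next
  case (prod as ks c)
  have "mdeg (int (sum_list ks)) (env_act (prod_list (map embed as)) (vac v))"
    using prod(1)
  proof (induction rule: list_all2_induct)
    case Nil
    then show ?case by (simp add: env_act_one mdeg_vac)
  next
    case (Cons a as k ks)
    then show ?case
      using mdeg_rho_neg[of a k "int (sum_list ks)"] by (simp add: env_act_mult env_act_embed add.commute)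
  qed
  then show ?case using prod(2) by (simp add: env_act_mult env_act_scalar mdeg_scl)
qed

lemma to_model_ind_deg: "x \<in> ind_deg d \<Longrightarrow> mdeg (int d) (to_model x)"
  by (induction rule: ind_deg.induct)
    (simp_all add: to_model_zero mdeg_zero to_model_add mdeg_add to_model_tensor env_act_neg_env)

lemma w_embed: "w11 = embed (welt W11)" "w22 = embed (welt W22)" "w12 = embed (welt W12)" "w21 = embed (welt W21)"
  by (simp_all add: w11_def w22_def w12_def w21_def eta_def welt_def sum_idx embed_add embed_ascale scalar_one scalar_zero
    scalar_uminus add.commute)

lemma triple_neg_env: "scalar c * (embed (welt i) * embed (welt j) * embed (welt k)) \<in> neg_env 3"
proof -
  have "scalar c * prod_list (map embed [welt i, welt j, welt k]) \<in> neg_env 3"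
    by (rule neg_env.prod[where ks = "[1, 1, 1]"]) (simp_all add: welt_deg)
  then show ?thesis by (simp add: mult.assoc)
qed

lemma embed_uact_zero_iff: "embed a \<cdot> x = 0 \<longleftrightarrow> rho a (to_model x) = 0"
  using to_model_eq_iff[of "embed a \<cdot> x" 0] by (simp add: to_model_uact env_act_embed to_model_zero)

lemma singular_iff: "singular x \<longleftrightarrow> (\<forall>a\<in>g_pos. rho a (to_model x) = 0)"
  by (simp add: singular_def embed_uact_zero_iff)

section \<open>Generators of $\mathfrak g_{>0}$\<close>

lemma txi_twelt: "\<exists>c. elt (tmon 1 {k}) = (\<Sum>j\<in>UNIV. ascale (c j) (twelt j))"
  and xi3_dualelt: "\<exists>c. elt (pd k (xi UNIV)) = (\<Sum>j\<in>UNIV. ascale (c j) (dualelt j))"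
proof -
  \<comment> \<open>The inverse of the matrix \<open>wcoef\<close>. The same coefficients serve both
    families, as each is the image of the w_j under a linear map.\<close>
  define c where "c = (\<lambda>k j. case k of I1 \<Rightarrow> (case j of W11 \<Rightarrow> - \<i>/2 | W22 \<Rightarrow> \<i>/2 | _ \<Rightarrow> 0)
    | I2 \<Rightarrow> (case j of W11 \<Rightarrow> 1/2 | W22 \<Rightarrow> 1/2 | _ \<Rightarrow> 0)
    | I3 \<Rightarrow> (case j of W12 \<Rightarrow> - \<i>/2 | W21 \<Rightarrow> - \<i>/2 | _ \<Rightarrow> 0)
    | I4 \<Rightarrow> (case j of W12 \<Rightarrow> - 1/2 | W21 \<Rightarrow> 1/2 | _ \<Rightarrow> (0::complex)))"
  have *: "(\<Sum>j\<in>UNIV. ascale (c k j) (\<Sum>l\<in>UNIV. ascale (wcoef j l) (e l))) = e k" for e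
  proof -
    have "(\<Sum>j\<in>UNIV. ascale (c k j) (\<Sum>l\<in>UNIV. ascale (wcoef j l) (e l))) =
        (\<Sum>l\<in>UNIV. ascale (\<Sum>j\<in>UNIV. c k j * wcoef j l) (e l))"
      unfolding ascale_sum ascale_ascale ascale_sum_left by (rule sum.swap)
    also have "\<dots> = (\<Sum>l\<in>UNIV. if l = k then e k else 0)"
    proof (rule sum.cong)
      fix l show "ascale (\<Sum>j\<in>UNIV. c k j * wcoef j l) (e l) = (if l = k then e k else 0)"
        by (cases k; cases l) (simp_all add: sum_widx c_def)
    qed simp
    finally show ?thesis by simp
  qed
  show "\<exists>c. elt (tmon 1 {k}) = (\<Sum>j\<in>UNIV. ascale (c j) (twelt j))"
    by (rule exI[of _ "c k"]) (simp only: twelt_def *)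
  show "\<exists>c. elt (pd k (xi UNIV)) = (\<Sum>j\<in>UNIV. ascale (c j) (dualelt j))"
    by (rule exI[of _ "c k"]) (simp only: dualelt_def *)
qed

lemma dt_tmon1: "dt (tmon 1 {i}) = xi {i}"
  by (simp add: tmon_axis dt_axis pderiv_monom1 poly_const_one)

lemma euler_txi: "2 *s tmon 1 {i} - euler (tmon 1 {i}) = tmon 1 {i}"
  by (auto simp: vec_eq_iff euler_nth tmon_def)

lemma psi_t: assumes "\<And>S. coeff (f $ S) 0 = 0" shows "psi f g = 0"
  using assms by (simp add: psi_def)

lemma abr_txi:
  "abr (elt (tmon 1 {i})) (elt g) =
    elt (gmul (tmon 1 {i}) (dt g) - ximul i (2 *s g - euler g) - gmul (tmon 1 {}) (pd i g))"
proof -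
  have "pd j (parity_twist (tmon 1 {i})) = (if j = i then - tmon 1 {} else 0)" for j
    by (simp add: tmon_axis grass_axis grass_uminus axis_uminus)
  then have "(\<Sum>j\<in>UNIV. gmul (pd j (parity_twist (tmon 1 {i}))) (pd j g)) =
      (\<Sum>j\<in>UNIV. if j = i then - gmul (tmon 1 {}) (pd i g) else 0)"
    by (intro sum.cong refl) (simp add: grass_uminus)
  moreover have "psi (tmon 1 {i}) g = 0"
    by (rule psi_t) (simp add: tmon_def)
  ultimately show ?thesis
    by (simp only: abr_def fst_conv Kbr_def euler_txi dt_tmon1 gmul_xi_left) simp
qed

lemma sign_unit: "\<exists>c. lsign k S = [:c:] \<and> c \<noteq> 0"
proof -
  consider "lsign k S = [:1:]" | "lsign k S = [:- 1:]"
    using xi_sign_cases[of "{k}" S] unfolding lsign_def poly_const_one by blast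
  then show ?thesis by cases (metis zero_neq_one, metis neg_equal_0_iff_equal zero_neq_one)
qed

text \<open>Up to nonzero factors $[t\xi_i, t^m\xi_{i}\xi_S] = t^{m+1}\xi_S$ and
  $[t^2, t^m\xi_{1234}] = t^{m+1}\xi_{1234}$, so that induction on $m$ generates all of
  $\mathfrak g_{>0}$.\<close>

lemma abr_txi_lower:
  assumes "i \<notin> S"
  shows "\<exists>c. c \<noteq> 0 \<and> abr (elt (tmon 1 {i})) (elt (tmon m (insert i S))) = ascale c (elt (tmon (Suc m) S))"
proof -
  obtain c where c: "lsign i S = [:c:]" "c \<noteq> 0" using sign_unit by blast
  have g: "2 *s tmon m (insert i S) - euler (tmon m (insert i S)) = axis (insert i S) ((2 - of_nat (card (insert i S))) * monom 1 m)"
    by (auto simp: vec_eq_iff euler_nth tmon_def axis_def algebra_simps)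
  have "abr (elt (tmon 1 {i})) (elt (tmon m (insert i S))) = elt (- axis S (monom 1 1 * ([:c:] * monom 1 m)))"
    unfolding abr_txi g using assms
    by (simp add: tmon_axis dt_axis gmul_axis ximul_axis pd_axis_insert c)
  also have "\<dots> = ascale (- c) (elt (tmon (Suc m) S))"
    by (simp add: tmon_axis ascale_axis axis_uminus[symmetric] mult_monom smult_monom minus_monom)
  finally show ?thesis using c by (intro exI[of _ "- c"]) simp
qed

text \<open>The way to reach xi_1234, which \<open>abr_txi_lower\<close> cannot produce because it
  removes an index.\<close>

lemma abr_txi_xi3: "\<exists>c. c \<noteq> 0 \<and> abr (elt (tmon 1 {i})) (elt (xi (UNIV - {i}))) = ascale c (elt (xi UNIV))"
proof -
  obtain c where c: "lsign i (UNIV - {i}) = [:c:]" "c \<noteq> 0" using sign_unit by blast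
  have g: "2 *s xi (UNIV - {i}) - euler (xi (UNIV - {i})) = axis (UNIV - {i}) (- 1)"
    by (auto simp: vec_eq_iff euler_nth tmon_def axis_def card_idx)
  have u: "insert i (UNIV - {i}) = UNIV" by auto
  have "abr (elt (tmon 1 {i})) (elt (xi (UNIV - {i}))) = elt (axis UNIV [:c:])"
    unfolding abr_txi g
    by (simp add: dt_xi ximul_axis u c axis_uminus grass_uminus) (simp add: tmon_axis pd_axis ximul_axis u c)
  also have "\<dots> = ascale c (elt (xi UNIV))"
    by (simp add: tmon_axis ascale_axis poly_const_one)
  finally show ?thesis using c by blast
qed

text \<open>In the factor, 2m comes from differentiating t^m and 4 from the value 2 - 4 = -2 of 2 -
  euler on xi_1234. It never vanishes.\<close>

lemma abr_t2: "abr (elt (tmon 2 {})) (elt (tmon m UNIV)) = ascale (2 * of_nat m + 4) (elt (tmon (Suc m) UNIV))"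
proof -
  have 1: "2 *s tmon 2 {} - euler (tmon 2 {}) = axis {} (2 * monom 1 2)"
    and 2: "2 *s tmon m UNIV - euler (tmon m UNIV) = axis UNIV (- 2 * monom 1 m)"
    by (auto simp: vec_eq_iff euler_nth tmon_def axis_def card_idx)
  have p: "pd i (parity_twist (tmon 2 {})) = 0" for i by (simp add: tmon_axis grass_axis)
  have d: "pderiv (monom 1 n :: complex poly) = of_nat n * monom 1 (n - 1)" for n
    by (simp add: pderiv_monom of_nat_poly smult_monom)
  have e: "2 * monom 1 2 * (of_nat m * monom 1 (m - 1)) - (2 * monom 1 1) * (- 2 * monom 1 m)
      = smult (2 * of_nat m + 4) (monom 1 (Suc m) :: complex poly)"
  proof (cases m)
    case 0
    then show ?thesis by (simp add: mult_monom numeral_poly smult_monom minus_monom)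
  next
    case (Suc n)
    have "monom 1 2 * monom 1 n = (monom 1 (Suc m) :: complex poly)" "monom 1 1 * monom 1 m = (monom 1 (Suc m) :: complex poly)"
      by (simp_all add: mult_monom Suc)
    then have "2 * monom 1 2 * (of_nat m * monom 1 (m - 1)) - (2 * monom 1 1) * (- 2 * monom 1 m)
       = (2 * of_nat m + 4) * (monom 1 (Suc m) :: complex poly)"
      by (simp add: Suc algebra_simps)
    also have "\<dots> = smult (2 * of_nat m + 4) (monom 1 (Suc m))"
      by (simp add: of_nat_poly numeral_poly mult.commute)
    finally show ?thesis .
  qed
  have psi: "psi (tmon 2 {}) g = 0" for g by (rule psi_t) (simp add: tmon_def)
  have "Kbr (tmon 2 {}) (tmon m UNIV) = axis UNIV (2 * monom 1 2 * (of_nat m * monom 1 (m - 1)) - (2 * monom 1 1) * (- 2 * monom 1 m))"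
  proof -
    have "dt (tmon m UNIV) = axis UNIV (of_nat m * monom 1 (m - 1))" "dt (tmon 2 {}) = axis {} (2 * monom 1 1)"
      by (simp_all add: tmon_axis dt_axis d)
    moreover have "axis UNIV q - axis UNIV r = (axis UNIV (q - r) :: grass)" for q r
      using axis_add[of UNIV "q - r" r] by simp
    ultimately show ?thesis
      unfolding Kbr_def 1 2 p by (simp add: gmul_axis)
  qed
  then have "Kbr (tmon 2 {}) (tmon m UNIV) = axis UNIV (smult (2 * of_nat m + 4) (monom 1 (Suc m)))"
    unfolding e .
  then show ?thesis by (simp only: abr_def fst_conv psi) (simp add: tmon_axis ascale_axis)
qed

lemma rho_bracket_zero:
  assumes "atwist a = sgn_by p a" "rho a x = 0" "rho b x = 0"
  shows "rho (abr a b) x = 0"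
  using rho_bracket_rel[OF assms(1), of b x] assms(2,3) by (simp add: bracket_rel_def rho_zero_right)

lemma rho_ascale_cancel: "c \<noteq> 0 \<Longrightarrow> rho (ascale c a) x = 0 \<Longrightarrow> rho a x = 0"
  using rho_ascale[of "1 / c" "ascale c a" x] by simp

text \<open>The annihilator of \<open>x\<close> is closed under brackets, hence contains everything
  that g_1 generates; an element of g_{>0} is a finite combination of monomials of positive
  degree.\<close>

lemma rho_pos_zero:
  assumes twelt: "\<And>j. rho (twelt j) x = 0" and dualelt: "\<And>j. rho (dualelt j) x = 0" and a: "a \<in> g_pos"
  shows "rho a x = 0"
proof -
  have t: "rho (elt (tmon 1 {k})) x = 0" for k
    using txi_twelt[of k] twelt by (auto simp: rho_sum rho_ascale)
  have tw: "atwist (elt (tmon 1 {k})) = sgn_by True (elt (tmon 1 {k}))" for k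
    by (simp add: atwist_def tmon_axis grass_axis axis_uminus)
  have t2w: "atwist (elt (tmon 2 {})) = sgn_by False (elt (tmon 2 {}))"
    by (simp add: atwist_def tmon_axis grass_axis)
  have x3: "rho (elt (xi (UNIV - {k}))) x = 0" for k
  proof -
    obtain c where c: "lsign k (UNIV - {k}) = [:c:]" "c \<noteq> 0" using sign_unit by blast
    then have "elt (pd k (xi UNIV)) = ascale c (elt (xi (UNIV - {k})))"
      by (simp add: tmon_axis pd_axis ascale_axis poly_const_one)
    then show ?thesis
      using xi3_dualelt[of k] dualelt c(2) by (auto simp: rho_sum rho_ascale intro: rho_ascale_cancel[of c])
  qed
  have lower: "rho (elt (tmon (Suc m) S)) x = 0" if "i \<notin> S" "rho (elt (tmon m (insert i S))) x = 0" for i m S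
    using abr_txi_lower[OF that(1), of m] rho_bracket_zero[OF tw t that(2), of i] rho_ascale_cancel by metis
  have xU: "rho (elt (xi UNIV)) x = 0"
    using abr_txi_xi3[of I1] rho_bracket_zero[OF tw t x3, of I1 I1] rho_ascale_cancel by metis
  have t2: "rho (elt (tmon 2 {})) x = 0"
    using lower[of I1 "{}" 1] t[of I1] by (simp add: numeral_2_eq_2)
  have tU: "rho (elt (tmon m UNIV)) x = 0" for m
  proof (induction m)
    case (Suc m)
    have "2 * of_nat m + 4 \<noteq> (0 :: complex)"
    proof -
      have "2 * of_nat m + 4 = (of_nat (2 * m + 4) :: complex)" by simp
      also have "\<dots> \<noteq> 0" unfolding of_nat_eq_0_iff by simp
      finally show ?thesis .
    qed
    then show ?case
      using rho_bracket_zero[OF t2w t2 Suc] unfolding abr_t2 by (rule rho_ascale_cancel)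
  qed (rule xU)
  have mono: "rho (elt (tmon m S)) x = 0" if "2 * m + card S > 2" for m S
    using that
  proof (induction m arbitrary: S)
    case 0
    show ?case
    proof (cases "S = UNIV")
      case False
      then obtain k where "S \<subseteq> UNIV - {k}" by blast
      moreover have "card (UNIV - {k}) \<le> card S" using 0 by (simp add: card_idx)
      ultimately have "S = UNIV - {k}" by (simp add: card_seteq)
      then show ?thesis using x3 by simp
    qed (simp add: xU)
  next
    case (Suc m)
    show ?case
    proof (cases "S = UNIV")
      case False
      \<comment> \<open>The bracket with t xi_k reduces t^(m+1) xi_S to t^m xi_{insert k S}. That
        monomial fails to have positive degree only for m = 0 and |S| = 1, when the original
        monomial is itself a generator.\<close>
      then obtain k where k: "k \<notin> S" by blast
      show ?thesis
      proof (cases "2 * m + card (insert k S) > 2")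
        case True
        show ?thesis by (rule lower[OF k Suc.IH[OF True]])
      next
        case False
        with k Suc.prems have "m = 0" "card S = 1" by simp_all
        then show ?thesis using t by (auto simp: card_1_singleton_iff)
      qed
    qed (simp add: tU)
  qed
  obtain f z where "a = (f, z)" by (cases a)
  \<comment> \<open>C has degree 0, so an element of g_{>0} has no central part.\<close>
  with a have af: "a = elt f" and f: "\<And>S m. 2 * m + card S \<le> 2 \<Longrightarrow> coeff (f $ S) m = 0"
    unfolding deg_part_def by force+
  have "rho (elt (axis S (f $ S))) x = 0" for S
  proof -
    have e_sum: "(\<Sum>i\<in>A. elt (axis S (h i))) = elt (axis S (\<Sum>i\<in>A. h i))" for A :: "nat set" and h
      by (induction A rule: infinite_finite_induct) (auto simp: zero_prod_def axis_zero axis_add)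
    have "elt (axis S (f $ S)) = (\<Sum>m\<le>degree (f $ S). elt (axis S (monom (coeff (f $ S) m) m)))"
      unfolding e_sum poly_as_sum_of_monoms ..
    also have "\<dots> = (\<Sum>m\<le>degree (f $ S). ascale (coeff (f $ S) m) (elt (tmon m S)))"
      by (simp add: tmon_axis ascale_axis smult_monom)
    finally have "rho (elt (axis S (f $ S))) x = (\<Sum>m\<le>degree (f $ S). scl (coeff (f $ S) m) (rho (elt (tmon m S)) x))"
      by (simp add: rho_sum rho_ascale)
    also have "\<dots> = 0"
    proof (intro sum.neutral ballI)
      fix m show "scl (coeff (f $ S) m) (rho (elt (tmon m S)) x) = 0"
        using f[of m S] mono[of m S] by (cases "2 * m + card S \<le> 2") auto
    qed
    finally show ?thesis .
  qed
  moreover have "elt f = (\<Sum>S\<in>UNIV. elt (axis S (f $ S)))"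
  proof -
    have e_sum: "(\<Sum>i\<in>A. elt (h i)) = elt (\<Sum>i\<in>A. h i)" for A :: "idx set set" and h
      by (induction A rule: infinite_finite_induct) (auto simp: zero_prod_def)
    have "f = (\<Sum>S\<in>UNIV. axis S (f $ S))"
      by (simp add: vec_eq_iff axis_def sum.delta)
    then show ?thesis by (simp add: e_sum)
  qed
  ultimately show ?thesis by (simp add: af rho_sum)
qed

section \<open>The equations of a singular vector\<close>

lemma fscale_two: "fscale 2 v = v + (v :: 'f::g0_module)"
  using fscale_add_left[of 1 1 v] by (simp add: fscale_one)

lemma fscale_four: "fscale 4 v = v + v + (v + (v :: 'f::g0_module))"
  using fscale_add_left[of 2 2 v] by (simp add: fscale_two)

lemmas tuple_eval = opZ_def opW.simps adj_new_def adj_old_def vac_def zero_prod_def scl_uminus_left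

text \<open>Here and in the following lemmas, \<open>rho_eval\<close> normalises the image and
  \<open>tuple_eval\<close> splits its vanishing into components; those needed for the
  classification are recorded.\<close>

lemma cubic_ex:
  assumes "rho (ex) (cubic a11 a12 a21 a22 b11 b12 b21 b22) = 0"
  shows "act0 ex b21 = b11"
    "act0 ex b22 = b12"
    "act0 ex b12 = 0"
  using assms unfolding cubic_def by (simp_all add: rho_eval) (simp_all add: tuple_eval)

lemma cubic_ey:
  assumes "rho (ey) (cubic a11 a12 a21 a22 b11 b12 b21 b22) = 0"
  shows "act0 ey b12 + b11 = 0"
    "act0 ey b21 = 0"
    "act0 ey b22 + b21 = 0"
  using assms unfolding cubic_def by (simp_all add: rho_eval) (simp_all add: tuple_eval)

lemma cubic_cc11:
  assumes "rho (dualelt W11) (cubic a11 a12 a21 a22 b11 b12 b21 b22) = 0"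
  shows "fscale 2 (act0 ey b12) - fscale 2 (act0 ex b21) + fscale 2 b11 = 0"
    "act0 hy b12 - act0 hx b12 - fscale 2 (act0 central b12) + fscale 2 b12 = fscale 2 (act0 ex b22)"
    "act0 hy b21 - act0 hx b21 - fscale 2 (act0 central b21) - fscale 2 b21 = fscale 2 (act0 ey b22)"
  using assms unfolding cubic_def by (simp_all add: rho_eval) (simp_all add: tuple_eval)

lemma cubic_cc12:
  assumes "rho (dualelt W12) (cubic a11 a12 a21 a22 b11 b12 b21 b22) = 0"
  shows "b12 - act0 hx b12 + (b12 - act0 hy b12) - fscale 2 (act0 central b12) = fscale 2 b12"
    "act0 fy b12 = 0"
  using assms unfolding cubic_def by (simp_all add: rho_eval) (simp_all add: tuple_eval)

lemma cubic_cc21: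
  assumes "rho (dualelt W21) (cubic a11 a12 a21 a22 b11 b12 b21 b22) = 0"
  shows "act0 hx b21 - b21 + (act0 hy b21 - b21) - fscale 2 (act0 central b21) + fscale 2 b21 = 0"
    "act0 fx b21 = 0"
  using assms unfolding cubic_def by (simp_all add: rho_eval) (simp_all add: tuple_eval)

lemma cubic_cc22:
  assumes "rho (dualelt W22) (cubic a11 a12 a21 a22 b11 b12 b21 b22) = 0"
  shows "act0 hx b12 - b12 - b12 - act0 hy b12 - fscale 2 (act0 central b12) = fscale 2 (act0 fy b11)"
    "act0 hx b21 + (b21 - act0 hy b21 + b21) - fscale 2 (act0 central b21) = fscale 2 (act0 fx b11)"
    "act0 hx b22 - act0 hy b22 = fscale 2 (act0 central b22)"
    "fscale 2 b22 + fscale 2 (act0 fy b21) = fscale 2 (act0 fx b12)"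
    "act0 fy b22 = 0"
    "act0 fx b22 = 0"
  using assms unfolding cubic_def by (simp_all add: rho_eval) (simp_all add: tuple_eval)

lemma cubic_uu11:
  assumes "rho (twelt W11) (cubic a11 a12 a21 a22 b11 b12 b21 b22) = 0"
  shows "fscale 4 a22 + fscale 2 (act0 ex b21) + fscale 2 (act0 ey b12) = fscale 2 b11"
  using assms unfolding cubic_def by (simp_all add: rho_eval) (simp_all add: tuple_eval)

lemma cubic_uu12:
  assumes "rho (twelt W12) (cubic a11 a12 a21 a22 b11 b12 b21 b22) = 0"
  shows "fscale 4 a21 + fscale 2 (act0 ex b22) - fscale 2 b12 + fscale 2 (act0 fy b11) = 0"
    "act0 hx b12 - act0 hy b12 + (fscale 2 b12 - fscale 2 (act0 tt b12)) + fscale 2 b12 = 0"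
  using assms unfolding cubic_def by (simp_all add: rho_eval) (simp_all add: tuple_eval)

lemma cubic_uu21:
  assumes "rho (twelt W21) (cubic a11 a12 a21 a22 b11 b12 b21 b22) = 0"
  shows "fscale 2 (act0 ey b22) - fscale 4 a12 + fscale 2 b21 + fscale 2 (act0 fx b11) = 0"
    "act0 hy b21 - act0 hx b21 + (fscale 2 b21 - fscale 2 (act0 tt b21)) + fscale 2 b21 = 0"
  using assms unfolding cubic_def by (simp_all add: rho_eval) (simp_all add: tuple_eval)

lemma cubic_uu22:
  assumes "rho (twelt W22) (cubic a11 a12 a21 a22 b11 b12 b21 b22) = 0"
  shows "- act0 hx b22 - act0 hy b22 + (fscale 2 b22 - fscale 2 (act0 tt b22) + fscale 2 b22) = 0"
    "fscale 2 b22 - fscale 4 a11 + fscale 2 (act0 fy b21) + fscale 2 (act0 fx b12) = 0"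
  using assms unfolding cubic_def by (simp_all add: rho_eval) (simp_all add: tuple_eval)

lemma act0_zero_right: "a \<in> g_deg 0 \<Longrightarrow> act0 a 0 = 0"
  using act0_scale_right[of a 0 0] by simp

lemma sum_diff_eigen:
  assumes "h - k = fscale a v" "h + k = fscale b (v :: 'f::g0_module)"
  shows "h = fscale ((a + b) / 2) v" "k = fscale ((b - a) / 2) v"
proof -
  have "fscale 2 h = fscale (a + b) v" "fscale 2 k = fscale (b - a) v"
    by (simp_all add: fscale_two fs.scale_left_distrib fs.scale_left_diff_distrib flip: assms)
  then have "fscale (1/2) (fscale 2 h) = fscale (1/2) (fscale (a + b) v)"
    "fscale (1/2) (fscale 2 k) = fscale (1/2) (fscale (b - a) v)" by simp_all
  then show "h = fscale ((a + b) / 2) v" "k = fscale ((b - a) / 2) v" by simp_all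
qed

text \<open>The operators e_x and e_y tie neighbouring coefficients together, the dual elements give
  b11 = 0 and the lowering relations, the t w_j express the a's through the b's, and the diagonal
  brackets yield the eigenvalues of h_x and h_y.\<close>

lemma cubic_equations:
  fixes a11 a12 a21 a22 b11 b12 b21 b22 :: "'f::g0_module"
  defines "x \<equiv> cubic a11 a12 a21 a22 b11 b12 b21 b22"
  assumes tau: "\<And>v :: 'f. act0 tt v = fscale \<tau> v" and gamma: "\<And>v :: 'f. act0 central v = fscale \<gamma> v"
    and twelt: "\<And>j. rho (twelt j) x = 0" and dualelt: "\<And>j. rho (dualelt j) x = 0"
    and ex: "rho ex x = 0" and ey: "rho ey x = 0"
  shows "b11 = 0" "a11 = b22 + act0 fy b21" "a12 = 0" "a21 = 0" "a22 = 0"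
    "b22 + act0 fy b21 = act0 fx b12" "act0 fy b22 = 0" "act0 fx b22 = 0" "act0 ex b22 = b12" "act0 ey b22 = - b21"
    "act0 ex b12 = 0" "act0 ey b12 = 0" "act0 fy b12 = 0"
    "act0 ex b21 = 0" "act0 ey b21 = 0" "act0 fx b21 = 0"
    "act0 hx b12 = fscale (\<tau> - 2 - \<gamma>) b12" "act0 hy b12 = fscale (2 - \<tau> - \<gamma>) b12"
    "act0 hx b21 = fscale (2 - \<tau> + \<gamma>) b21" "act0 hy b21 = fscale (\<tau> - 2 + \<gamma>) b21"
    "act0 hx b22 = fscale (2 - \<tau> + \<gamma>) b22" "act0 hy b22 = fscale (2 - \<tau> - \<gamma>) b22"
    "b12 \<noteq> 0 \<Longrightarrow> \<tau> = 5/2 \<and> \<gamma> = - 1/2" "b21 \<noteq> 0 \<Longrightarrow> \<tau> = 5/2 \<and> \<gamma> = 1/2"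
proof -
  note twelt = twelt[unfolded x_def] and dualelt = dualelt[unfolded x_def]
  note e = cubic_ex[OF ex[unfolded x_def]] and e' = cubic_ey[OF ey[unfolded x_def]]
  note c11 = cubic_cc11[OF dualelt] and c12 = cubic_cc12[OF dualelt] and c21 = cubic_cc21[OF dualelt] and c22 = cubic_cc22[OF dualelt]
  note u11 = cubic_uu11[OF twelt] and u12 = cubic_uu12[OF twelt] and u21 = cubic_uu21[OF twelt] and u22 = cubic_uu22[OF twelt]
  have e'': "act0 ey b12 = - b11" "act0 ey b22 = - b21"
    using e'(1,3) by (simp_all add: eq_neg_iff_add_eq_0)
  \<comment> \<open>With e_x b21 = b11 and e_y b12 = -b11 the equation reads -2 b11 = 0.\<close>
  show b11: "b11 = 0"
    using c11(1) by (simp add: e(1) e''(1))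
  show "act0 ex b22 = b12" "act0 ex b12 = 0" "act0 ey b21 = 0" "act0 ey b22 = - b21"
    "act0 ex b21 = 0" "act0 ey b12 = 0"
    using e e' e'' b11 by simp_all
  show "act0 fy b22 = 0" "act0 fx b22 = 0" "act0 fy b12 = 0" "act0 fx b21 = 0"
    using c22(5,6) c12(2) c21(2) by simp_all
  show "a22 = 0"
    using u11 by (simp add: e e'' b11)
  show "a21 = 0"
    using u12(1) by (simp add: e b11 act0_zero_right g0_deg)
  show "a12 = 0"
    using u21(1) by (simp add: e'' b11 act0_zero_right g0_deg)
  have "fscale 2 (b22 + act0 fy b21) = fscale 2 (act0 fx b12)"
    using c22(4) by (simp add: fs.scale_right_distrib)
  then show f: "b22 + act0 fy b21 = act0 fx b12" by simp
  have "fscale 4 a11 = fscale 4 (b22 + act0 fy b21)"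
    using u22(2) unfolding f[symmetric] by (simp add: fscale_four fscale_two algebra_simps)
  then show "a11 = b22 + act0 fy b21" by simp
  have 1: "act0 hx b12 - act0 hy b12 = fscale (2 * \<tau> - 4) b12"
    using u12(2) by (simp add: tau fs.scale_left_diff_distrib fscale_four fscale_two algebra_simps)
  have 2: "act0 hx b12 + act0 hy b12 = fscale (- 2 * \<gamma>) b12"
    using c12(1) by (simp add: gamma fscale_two algebra_simps eq_neg_iff_add_eq_0)
  show "act0 hx b12 = fscale (\<tau> - 2 - \<gamma>) b12" "act0 hy b12 = fscale (2 - \<tau> - \<gamma>) b12"
    using sum_diff_eigen[OF 1 2] by (simp_all add: diff_divide_distrib)
  \<comment> \<open>Two further values of h_x - h_y on b12, besides 2 tau - 4; comparing the three
    determines tau and gamma.\<close>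
  have "act0 hx b12 - act0 hy b12 = fscale (2 + 2 * \<gamma>) b12"
    using c22(1) by (simp add: b11 act0_zero_right g0_deg gamma fs.scale_left_distrib fscale_two algebra_simps)
  moreover have "act0 hx b12 - act0 hy b12 = fscale (- 2 * \<gamma>) b12"
    using c11(2) by (simp add: e gamma fscale_two algebra_simps)
  ultimately have "2 * \<tau> - 4 = 2 + 2 * \<gamma>" "2 * \<tau> - 4 = - 2 * \<gamma>" if "b12 \<noteq> 0"
    using that fs.scale_right_imp_eq unfolding 1 by blast+
  moreover have "t = 5/2 \<and> g = - 1/2" if "2 * t - 4 = 2 + 2 * g" "2 * t - 4 = - 2 * g" for t g :: complex
  proof -
    have g: "4 * g = - 2" using that by algebra
    have "g = (4 * g) / 4" by simp
    then have "g = - 1/2" unfolding g by simp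
    with that show ?thesis by (simp add: eq_divide_eq algebra_simps)
  qed
  ultimately show "b12 \<noteq> 0 \<Longrightarrow> \<tau> = 5/2 \<and> \<gamma> = - 1/2" by blast
  have 1: "act0 hx b21 - act0 hy b21 = fscale (4 - 2 * \<tau>) b21"
    using u21(2) by (simp add: tau fs.scale_left_diff_distrib fscale_four fscale_two algebra_simps)
  have 2: "act0 hx b21 + act0 hy b21 = fscale (2 * \<gamma>) b21"
    using c21(1) by (simp add: gamma fscale_two algebra_simps)
  show "act0 hx b21 = fscale (2 - \<tau> + \<gamma>) b21" "act0 hy b21 = fscale (\<tau> - 2 + \<gamma>) b21"
    using sum_diff_eigen[OF 1 2] by (simp_all add: diff_divide_distrib add_divide_distrib)
  \<comment> \<open>The same comparison with the two copies of sl_2 exchanged and gamma replaced by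
    -gamma.\<close>
  have "act0 hx b21 - act0 hy b21 = fscale (2 * \<gamma> - 2) b21"
    using c22(2) by (simp add: b11 act0_zero_right g0_deg gamma fs.scale_left_diff_distrib fscale_two algebra_simps)
  moreover have "act0 hx b21 - act0 hy b21 = fscale (- 2 * \<gamma>) b21"
    using c11(3) by (simp add: e'' gamma fscale_two algebra_simps)
  ultimately have "4 - 2 * \<tau> = 2 * \<gamma> - 2" "4 - 2 * \<tau> = - 2 * \<gamma>" if "b21 \<noteq> 0"
    using that fs.scale_right_imp_eq unfolding 1 by blast+
  moreover have "t = 5/2 \<and> g = 1/2" if "4 - 2 * t = 2 * g - 2" "4 - 2 * t = - 2 * g" for t g :: complex
  proof -
    have g: "4 * g = 2" using that by algebra
    have "g = (4 * g) / 4" by simp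
    then have "g = 1/2" unfolding g by simp
    with that show ?thesis by (simp add: eq_divide_eq algebra_simps)
  qed
  ultimately show "b21 \<noteq> 0 \<Longrightarrow> \<tau> = 5/2 \<and> \<gamma> = 1/2" by blast
  have 1: "act0 hx b22 - act0 hy b22 = fscale (2 * \<gamma>) b22"
    using c22(3) by (simp add: gamma)
  have 2: "act0 hx b22 + act0 hy b22 = fscale (4 - 2 * \<tau>) b22"
    using u22(1) by (simp add: tau fs.scale_left_diff_distrib fscale_four fscale_two algebra_simps)
  show "act0 hx b22 = fscale (2 - \<tau> + \<gamma>) b22" "act0 hy b22 = fscale (2 - \<tau> - \<gamma>) b22"
    using sum_diff_eigen[OF 1 2] by (simp_all add: diff_divide_distrib add_divide_distrib)
qed

section \<open>Irreducible modules and their polynomial realization\<close>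

lemma fst_g0v_nth: "fst (g0v c12 c13 c14 c23 c24 c34 ct cC) $ S =
   (if S = {I1, I2} then [:c12:] else 0) + (if S = {I1, I3} then [:c13:] else 0) + (if S = {I1, I4} then [:c14:] else 0)
   + (if S = {I2, I3} then [:c23:] else 0) + (if S = {I2, I4} then [:c24:] else 0) + (if S = {I3, I4} then [:c34:] else 0)
   + (if S = {} then monom ct 1 else 0)"
  by (simp add: g0v_def ascale_def tmon_def tt_def central_def smult_monom monom_0)

lemma g0_span:
  assumes "a \<in> g_deg 0"
  obtains c12 c13 c14 c23 c24 c34 ct cC where "a = g0v c12 c13 c14 c23 c24 c34 ct cC"
proof -
  let ?c = "\<lambda>S. coeff (fst a $ S) 0"
  let ?g = "g0v (?c {I1, I2}) (?c {I1, I3}) (?c {I1, I4}) (?c {I2, I3}) (?c {I2, I4}) (?c {I3, I4}) (coeff (fst a $ {}) 1) (snd a)"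
  have "fst ?g $ S = (if S = {} then monom (coeff (fst a $ {}) 1) 1 else if card S = 2 then [:?c S:] else 0)" for S
  proof (cases "card S = 2")
    case True
    then obtain i j where ij: "S = {i, j}" "i \<noteq> j" by (auto simp: card_2_iff)
    then show ?thesis
      unfolding fst_g0v_nth by (cases i; cases j) (simp_all add: doubleton_eq_iff insert_order_idx)
  next
    case False
    then have "S \<noteq> {i, j}" if "i \<noteq> j" for i j using that by auto
    with False show ?thesis unfolding fst_g0v_nth by simp
  qed
  then have "fst (deg0_part a) = fst ?g"
    by (simp only: deg0_part_def fst_conv vec_eq_iff vec_lambda_beta) simp
  moreover have "snd (deg0_part a) = snd ?g"
    by (simp add: deg0_part_def g0v_def ascale_def central_def tt_def)
  ultimately have "a = ?g"
    using deg0_part_same[OF assms] by (metis prod.collapse)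
  then show thesis by (rule that)
qed

lemma g0v_cong: "a = a' \<Longrightarrow> b = b' \<Longrightarrow> c = c' \<Longrightarrow> d = d' \<Longrightarrow> e = e' \<Longrightarrow> f = f' \<Longrightarrow> g = g' \<Longrightarrow> h = h' \<Longrightarrow>
    g0v a b c d e f g h = g0v a' b' c' d' e' f' g' h'"
  by simp

text \<open>The coefficients invert \<open>g0_g0v\<close>, so stability under g_0 can be tested on
  the eight named elements.\<close>

lemma g0v_chevalley: "g0v a b c d e f g h =
    ascale ((\<i> * a - \<i> * f) / 2) hx + ascale ((\<i> * a + \<i> * f) / 2) hy
    + ascale ((\<i> * (c - d) - (b + e)) / 2) ex + ascale ((b + e + \<i> * (c - d)) / 2) fx
    + ascale ((- \<i> * (c + d) - (b - e)) / 2) ey + ascale ((b - e - \<i> * (c + d)) / 2) fy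
    + ascale g tt + ascale h central"
  unfolding g0_g0v g0v_ascale g0v_add
  by (rule g0v_cong) (simp_all add: field_simps)

lemma abr_tt: "a \<in> g_deg 0 \<Longrightarrow> abr a tt = 0"
proof -
  have x: "abr (xi2 i j) tt = 0" if "i \<noteq> j" for i j
  proof -
    have "2 *s xi {i, j} - euler (xi {i, j}) = 0"
      using that by (auto simp: vec_eq_iff euler_nth tmon_def)
    moreover have "pd k (tmon 1 {}) = 0" for k by (simp add: tmon_axis grass_axis)
    moreover have "psi f (tmon 1 {}) = 0" for f
    proof -
      have "coeff (tmon 1 {} $ S) 0 = 0" for S by (simp add: tmon_def)
      then show ?thesis unfolding psi_def Let_def by simp
    qed
    ultimately show ?thesis by (simp add: tt_def abr_def Kbr_def dt_xi zero_prod_def)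
  qed
  have "abr tt tt = 0"
  proof -
    have "pd k (tmon 1 {}) = 0" for k by (simp add: tmon_axis grass_axis)
    moreover have "psi f (tmon 1 {}) = 0" for f
    proof -
      have "coeff (tmon 1 {} $ S) 0 = 0" for S by (simp add: tmon_def)
      then show ?thesis unfolding psi_def Let_def by simp
    qed
    moreover have "2 *s tmon 1 {} - euler (tmon 1 {}) = 2 *s tmon 1 {}"
      by (auto simp: vec_eq_iff euler_nth tmon_def)
    moreover have "dt (tmon 1 {}) = xi {}" by (simp add: tmon_axis dt_axis pderiv_monom1 poly_const_one)
    ultimately show ?thesis by (simp add: tt_def abr_def Kbr_def gmul_one zero_prod_def)
  qed
  then have "abr (g0v c12 c13 c14 c23 c24 c34 ct cC) tt = 0" for c12 c13 c14 c23 c24 c34 ct cC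
    by (simp add: g0v_def abr_add_left abr_ascale_left x)
  then show "a \<in> g_deg 0 \<Longrightarrow> abr a tt = 0" by (metis g0_span)
qed

lemma irreducible_invariant:
  assumes "irreducible_module TYPE('f::g0_module)" "(v :: 'f) \<in> W" "v \<noteq> 0"
    and "0 \<in> W" "\<And>x y. x \<in> W \<Longrightarrow> y \<in> W \<Longrightarrow> x + y \<in> W" "\<And>c x. x \<in> W \<Longrightarrow> fscale c x \<in> W"
    and "\<And>a x. a \<in> g_deg 0 \<Longrightarrow> x \<in> W \<Longrightarrow> act0 a x \<in> W"
  shows "W = UNIV"
proof -
  have "module.subspace fscale W" using assms(4-6) by (simp add: fs.subspace_def)
  then have "W = {0} \<or> W = UNIV"
    using assms(1,7) unfolding irreducible_module_def by blast
  then show ?thesis using assms(2,3) by auto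
qed

text \<open>Schur's lemma with the eigenvector supplied: an eigenspace of a central element is a
  submodule, hence everything once it is nonzero.\<close>

lemma irreducible_scalar:
  assumes "irreducible_module TYPE('f::g0_module)" "z \<in> g_deg 0" "\<And>a. a \<in> g_deg 0 \<Longrightarrow> abr a z = 0"
    and "(v :: 'f) \<noteq> 0" "act0 z v = fscale c v"
  shows "act0 z w = fscale c (w :: 'f)"
proof -
  have "{w :: 'f. act0 z w = fscale c w} = UNIV"
  proof (rule irreducible_invariant[OF assms(1) _ assms(4)])
    fix a and x :: 'f assume a: "a \<in> g_deg 0" and x: "x \<in> {w. act0 z w = fscale c w}"
    have "act0 a (act0 z x) - act0 z (act0 a x) = 0"
      using act0_bracket[OF a assms(2), of x] assms(3)[OF a] by simp
    then show "act0 a x \<in> {w. act0 z w = fscale c w}"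
      using x a by (simp add: act0_scale_right)
  qed (use assms(2,5) in \<open>auto simp: act0_zero_right act0_add_right act0_scale_right fscale_add_right mult.commute\<close>)
  then show ?thesis by auto
qed

lemma irreducible_chevalley:
  assumes "irreducible_module TYPE('f::g0_module)" "(v :: 'f) \<in> W" "v \<noteq> 0"
    and W: "0 \<in> W" "\<And>x y. x \<in> W \<Longrightarrow> y \<in> W \<Longrightarrow> x + y \<in> W" "\<And>c x. x \<in> W \<Longrightarrow> fscale c x \<in> W"
    and g: "\<And>a x. a \<in> {hx, hy, ex, fx, ey, fy, tt, central} \<Longrightarrow> x \<in> W \<Longrightarrow> act0 a x \<in> W"
  shows "W = UNIV"
proof (rule irreducible_invariant[OF assms(1-3) W])
  fix a x assume "a \<in> g_deg 0" and x: "x \<in> W"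
  then obtain a1 a2 a3 a4 a5 a6 a7 a8 where a: "a = ascale a1 hx + ascale a2 hy + ascale a3 ex + ascale a4 fx
      + ascale a5 ey + ascale a6 fy + ascale a7 tt + ascale a8 central"
    by (metis g0_span g0v_chevalley)
  have "act0 a x = fscale a1 (act0 hx x) + fscale a2 (act0 hy x) + fscale a3 (act0 ex x) + fscale a4 (act0 fx x)
      + fscale a5 (act0 ey x) + fscale a6 (act0 fy x) + fscale a7 (act0 tt x) + fscale a8 (act0 central x)"
    unfolding a by (simp add: act0_add_left act0_scale_left deg_part_add deg_part_ascale g0_deg)
  also have "\<dots> \<in> W"
    by (intro W g x) simp_all
  finally show "act0 a x \<in> W" .
qed

text \<open>The span of \<open>p\<close> and \<open>q\<close> is a nonzero submodule. This is where
  irreducibility bounds the dimension of F by 2.\<close>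

lemma span_pair:
  assumes irr: "irreducible_module TYPE('f::g0_module)" and "(p :: 'f) \<noteq> 0"
    and act: "\<And>a. a \<in> {hx, hy, ex, fx, ey, fy, tt, central} \<Longrightarrow>
      (\<exists>\<alpha> \<beta>. act0 a p = fscale \<alpha> p + fscale \<beta> q) \<and> (\<exists>\<alpha> \<beta>. act0 a q = fscale \<alpha> p + fscale \<beta> q)"
  obtains \<alpha> \<beta> where "(v :: 'f) = fscale \<alpha> p + fscale \<beta> q"
proof -
  let ?W = "{fscale \<alpha> p + fscale \<beta> q |\<alpha> \<beta>. True}"
  have W: "fscale \<alpha> p + fscale \<beta> q \<in> ?W" for \<alpha> \<beta> by blast
  have add: "x + y \<in> ?W" if xy: "x \<in> ?W" "y \<in> ?W" for x y
  proof -
    obtain \<alpha> \<beta> \<alpha>' \<beta>' where "x = fscale \<alpha> p + fscale \<beta> q" "y = fscale \<alpha>' p + fscale \<beta>' q" using xy by blast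
    then have "x + y = fscale (\<alpha> + \<alpha>') p + fscale (\<beta> + \<beta>') q" by (simp add: fs.scale_left_distrib algebra_simps)
    then show ?thesis using W by simp
  qed
  have sc: "fscale c x \<in> ?W" if x: "x \<in> ?W" for c x
  proof -
    obtain \<alpha> \<beta> where "x = fscale \<alpha> p + fscale \<beta> q" using x by blast
    then have "fscale c x = fscale (c * \<alpha>) p + fscale (c * \<beta>) q" by (simp add: fs.scale_right_distrib)
    then show ?thesis using W by simp
  qed
  have "?W = UNIV"
  proof (rule irreducible_chevalley[OF irr _ assms(2)])
    show "p \<in> ?W" using W[of 1 0] by simp
    show "0 \<in> ?W" using W[of 0 0] by simp
    fix a x assume a: "a \<in> {hx, hy, ex, fx, ey, fy, tt, central}" and "x \<in> ?W"
    then obtain \<alpha> \<beta> where x: "x = fscale \<alpha> p + fscale \<beta> q" by blast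
    have "a \<in> g_deg 0" using a g0_deg by auto
    then have "act0 a x = fscale \<alpha> (act0 a p) + fscale \<beta> (act0 a q)"
      by (simp add: x act0_add_right act0_scale_right)
    moreover have "act0 a p \<in> ?W" "act0 a q \<in> ?W" using act[OF a] by blast+
    ultimately show "act0 a x \<in> ?W" using add sc by simp
  qed (use add sc in auto)
  then have "v \<in> ?W" by blast
  then show thesis using that by blast
qed

section \<open>Linear forms in the polynomial realization\<close>

abbreviation vkey :: "var \<Rightarrow> var \<Rightarrow>\<^sub>0 nat" where
  "vkey x \<equiv> Poly_Mapping.single x 1"

lemma D_superset:
  assumes "finite A" "Poly_Mapping.keys p \<subseteq> A"
  shows "D x p = (\<Sum>k\<in>A. Poly_Mapping.single (k - vkey x) (of_nat (Poly_Mapping.lookup k x) * Poly_Mapping.lookup p k))"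
  unfolding D_def by (rule sum.mono_neutral_left) (use assms in \<open>auto simp: in_keys_iff\<close>)

lemma D_add: "D x (p + q) = D x p + D x q"
proof -
  let ?A = "Poly_Mapping.keys p \<union> Poly_Mapping.keys q"
  have "D x r = (\<Sum>k\<in>?A. Poly_Mapping.single (k - vkey x) (of_nat (Poly_Mapping.lookup k x) * Poly_Mapping.lookup r k))"
    if "Poly_Mapping.keys r \<subseteq> ?A" for r
    by (rule D_superset) (use that in auto)
  then show ?thesis
    using Poly_Mapping.keys_add[of p q] by (simp add: lookup_add algebra_simps single_add sum.distrib)
qed

lemma D_single: "D x (Poly_Mapping.single k c) = Poly_Mapping.single (k - vkey x) (of_nat (Poly_Mapping.lookup k x) * c)"
  using D_superset[of "{k}" "Poly_Mapping.single k c" x] by simp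

lemma D_vkey: "D x (Poly_Mapping.single (vkey y) c) = (if x = y then Poly_Mapping.single 0 c else 0)"
  by (simp add: D_single lookup_single)

lemma V_mult: "V x * Poly_Mapping.single 0 c = Poly_Mapping.single (vkey x) c"
  by (simp add: V_def mult_single)

lemma vkey_inject: "vkey x = vkey y \<longleftrightarrow> x = y"
  by (metis lookup_single_eq lookup_single_not_eq zero_neq_one)

lemma bihom_vkey:
  "Poly_Mapping.single (vkey X1) \<alpha> + Poly_Mapping.single (vkey X2) \<beta> \<in> bihom 1 0"
  "Poly_Mapping.single (vkey Y1) \<alpha> + Poly_Mapping.single (vkey Y2) \<beta> \<in> bihom 0 1"
proof -
  have "k = vkey x \<or> k = vkey y" if "k \<in> Poly_Mapping.keys (Poly_Mapping.single (vkey x) \<alpha> + Poly_Mapping.single (vkey y) \<beta>)" for k x y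
    using Poly_Mapping.keys_add[of "Poly_Mapping.single (vkey x) \<alpha>" "Poly_Mapping.single (vkey y) \<beta>"] that
    by (auto split: if_splits)
  then show "Poly_Mapping.single (vkey X1) \<alpha> + Poly_Mapping.single (vkey X2) \<beta> \<in> bihom 1 0"
    "Poly_Mapping.single (vkey Y1) \<alpha> + Poly_Mapping.single (vkey Y2) \<beta> \<in> bihom 0 1"
    by (fastforce simp: bihom_def lookup_single)+
qed

lemma pm_one_cases:
  fixes k :: "var \<Rightarrow>\<^sub>0 nat"
  assumes "Poly_Mapping.lookup k x + Poly_Mapping.lookup k y = 1" "x \<noteq> y"
    "\<And>z. z \<noteq> x \<Longrightarrow> z \<noteq> y \<Longrightarrow> Poly_Mapping.lookup k z = 0"
  shows "k = vkey x \<or> k = vkey y"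
proof -
  consider "Poly_Mapping.lookup k x = 1" "Poly_Mapping.lookup k y = 0" | "Poly_Mapping.lookup k x = 0" "Poly_Mapping.lookup k y = 1"
    using assms(1) by linarith
  then show ?thesis
  proof cases
    case 1
    have "Poly_Mapping.lookup k z = (if z = x then 1 else 0)" for z
      using 1 assms(2) assms(3)[of z] by (cases "z = x"; cases "z = y") auto
    then have "k = vkey x" by (intro poly_mapping_eqI) (simp add: lookup_single when_def)
    then show ?thesis ..
  next
    case 2
    have "Poly_Mapping.lookup k z = (if z = y then 1 else 0)" for z
      using 2 assms(2) assms(3)[of z] by (cases "z = x"; cases "z = y") auto
    then have "k = vkey y" by (intro poly_mapping_eqI) (simp add: lookup_single when_def)
    then show ?thesis ..
  qed
qed

lemma keys_pair:
  fixes p :: xypoly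
  assumes "\<And>k. k \<in> Poly_Mapping.keys p \<Longrightarrow> k = vkey x \<or> k = vkey y" "x \<noteq> y"
  shows "p = Poly_Mapping.single (vkey x) (Poly_Mapping.lookup p (vkey x)) + Poly_Mapping.single (vkey y) (Poly_Mapping.lookup p (vkey y))"
proof (rule poly_mapping_eqI)
  fix k
  show "Poly_Mapping.lookup p k = Poly_Mapping.lookup (Poly_Mapping.single (vkey x) (Poly_Mapping.lookup p (vkey x)) + Poly_Mapping.single (vkey y) (Poly_Mapping.lookup p (vkey y))) k"
    using assms(1)[of k] assms(2) vkey_inject[of x y]
    by (cases "k \<in> Poly_Mapping.keys p") (auto simp: lookup_add lookup_single when_def in_keys_iff)
qed

lemma bihom_cases:
  "p \<in> bihom 1 0 \<Longrightarrow> \<exists>\<alpha> \<beta>. p = Poly_Mapping.single (vkey X1) \<alpha> + Poly_Mapping.single (vkey X2) \<beta>"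
  "p \<in> bihom 0 1 \<Longrightarrow> \<exists>\<alpha> \<beta>. p = Poly_Mapping.single (vkey Y1) \<alpha> + Poly_Mapping.single (vkey Y2) \<beta>"
proof -
  assume p: "p \<in> bihom 1 0"
  have "k = vkey X1 \<or> k = vkey X2" if "k \<in> Poly_Mapping.keys p" for k
  proof (rule pm_one_cases)
    fix z show "z \<noteq> X1 \<Longrightarrow> z \<noteq> X2 \<Longrightarrow> Poly_Mapping.lookup k z = 0"
      using p that by (cases z) (auto simp: bihom_def)
  qed (use p that in \<open>auto simp: bihom_def\<close>)
  then show "\<exists>\<alpha> \<beta>. p = Poly_Mapping.single (vkey X1) \<alpha> + Poly_Mapping.single (vkey X2) \<beta>"
    using keys_pair[of p X1 X2] by blast
next
  assume p: "p \<in> bihom 0 1"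
  have "k = vkey Y1 \<or> k = vkey Y2" if "k \<in> Poly_Mapping.keys p" for k
  proof (rule pm_one_cases)
    fix z show "z \<noteq> Y1 \<Longrightarrow> z \<noteq> Y2 \<Longrightarrow> Poly_Mapping.lookup k z = 0"
      using p that by (cases z) (auto simp: bihom_def)
  qed (use p that in \<open>auto simp: bihom_def\<close>)
  then show "\<exists>\<alpha> \<beta>. p = Poly_Mapping.single (vkey Y1) \<alpha> + Poly_Mapping.single (vkey Y2) \<beta>"
    using keys_pair[of p Y1 Y2] by blast
qed

declare One_nat_def [simp del]

text \<open>\<open>p\<close> and \<open>q\<close> behave like x_1, x_2 or y_1, y_2: the natural
  module of one sl_2-triple, on which the commuting triple acts by 0.\<close>

definition doublet :: "ann \<Rightarrow> ann \<Rightarrow> ann \<Rightarrow> ann \<Rightarrow> ann \<Rightarrow> ann \<Rightarrow> 'f::g0_module \<Rightarrow> 'f \<Rightarrow> bool" where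
  "doublet e f h e' f' h' p q \<longleftrightarrow> act0 e p = 0 \<and> act0 e q = p \<and> act0 f p = q \<and> act0 f q = 0 \<and> act0 h p = p \<and> act0 h q = - q
     \<and> act0 e' p = 0 \<and> act0 e' q = 0 \<and> act0 f' p = 0 \<and> act0 f' q = 0 \<and> act0 h' p = 0 \<and> act0 h' q = 0"

lemma doublet_span:
  assumes "irreducible_module TYPE('f::g0_module)" "(p :: 'f) \<noteq> 0"
    and d: "doublet ex fx hx ey fy hy p q \<or> doublet ey fy hy ex fx hx p q"
    and tau: "\<And>v :: 'f. act0 tt v = fscale \<tau> v" and gamma: "\<And>v :: 'f. act0 central v = fscale \<gamma> v"
  obtains \<alpha> \<beta> where "v = fscale \<alpha> p + fscale \<beta> q"
proof (rule span_pair[OF assms(1,2)])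
  define S where "S v \<longleftrightarrow> (\<exists>\<alpha> \<beta>. v = fscale \<alpha> p + fscale \<beta> q)" for v
  have S: "S (fscale \<alpha> p + fscale \<beta> q)" for \<alpha> \<beta> unfolding S_def by blast
  have p: "S (fscale c p)" and q: "S (fscale c q)" for c using S[of c 0] S[of 0 c] by simp_all
  have "S 0" "S p" "S q" "S (- q)" using p[of 0] p[of 1] q[of 1] q[of "-1"] by simp_all
  fix a assume a: "a \<in> {hx, hy, ex, fx, ey, fy, tt, central}"
  have "S (act0 a p) \<and> S (act0 a q)"
    using a d \<open>S 0\<close> \<open>S p\<close> \<open>S q\<close> \<open>S (- q)\<close> p q unfolding doublet_def by (elim disjE insertE emptyE) (simp_all add: tau gamma)
  then show "(\<exists>\<alpha> \<beta>. act0 a p = fscale \<alpha> p + fscale \<beta> q) \<and> (\<exists>\<alpha> \<beta>. act0 a q = fscale \<alpha> p + fscale \<beta> q)"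
    unfolding S_def .
qed (use that in blast)

text \<open>Applying the raising operator kills \<open>p\<close> and sends \<open>q\<close> to
  \<open>p\<close>, which isolates the second coefficient.\<close>

lemma doublet_independent:
  assumes d: "doublet ex fx hx ey fy hy p q \<or> doublet ey fy hy ex fx hx p q" and "p \<noteq> 0"
    and "fscale \<alpha> p + fscale \<beta> q = fscale \<alpha>' p + fscale \<beta>' q"
  shows "\<alpha> = \<alpha>' \<and> \<beta> = \<beta>'"
proof -
  obtain e where e: "e \<in> g_deg 0" "act0 e p = 0" "act0 e q = p"
    using d g0_deg unfolding doublet_def by blast
  have "act0 e (fscale \<alpha> p + fscale \<beta> q) = act0 e (fscale \<alpha>' p + fscale \<beta>' q)" using assms(3) by simp
  then have "fscale \<beta> p = fscale \<beta>' p" using e by (simp add: act0_add_right act0_scale_right)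
  then have "\<beta> = \<beta>'" using assms(2) by simp
  then show ?thesis using assms(2,3) by simp
qed

lemma single_zero_mult: "Poly_Mapping.single 0 c * Poly_Mapping.single k (d :: complex) = Poly_Mapping.single k (c * d)"
  by (simp add: mult_single)

definition pair_map :: "var \<Rightarrow> var \<Rightarrow> 'f \<Rightarrow> 'f \<Rightarrow> xypoly \<Rightarrow> 'f::g0_module" where
  "pair_map x y p q r = fscale (Poly_Mapping.lookup r (vkey x)) p + fscale (Poly_Mapping.lookup r (vkey y)) q"

lemma pair_map_eval:
  assumes "x \<noteq> y"
  shows "pair_map x y p q (Poly_Mapping.single (vkey x) \<alpha> + Poly_Mapping.single (vkey y) \<beta>) = fscale \<alpha> p + fscale \<beta> q"
    "pair_map x y p q (Poly_Mapping.single (vkey x) \<alpha>) = fscale \<alpha> p"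
    "pair_map x y p q (Poly_Mapping.single (vkey y) \<beta>) = fscale \<beta> q"
    "pair_map x y p q 0 = 0"
    "pair_map x y p q (Poly_Mapping.single (vkey x) \<alpha> - Poly_Mapping.single (vkey y) \<beta>) = fscale \<alpha> p - fscale \<beta> q"
  using assms by (simp_all add: pair_map_def lookup_add lookup_minus lookup_single when_def vkey_inject)

lemma realization_doublet:
  assumes irr: "irreducible_module TYPE('f::g0_module)" and p: "(p :: 'f) \<noteq> 0"
    and tau: "\<And>v :: 'f. act0 tt v = fscale \<tau> v" and gamma: "\<And>v :: 'f. act0 central v = fscale \<gamma> v"
  shows "doublet ex fx hx ey fy hy p q \<Longrightarrow> realization 1 0 \<tau> \<gamma> (pair_map X1 X2 p q)"
    and "doublet ey fy hy ex fx hx p q \<Longrightarrow> realization 0 1 \<tau> \<gamma> (pair_map Y1 Y2 p q)"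
proof -
  have bij: "bij_betw (pair_map x y p q) B UNIV"
    if d: "doublet ex fx hx ey fy hy p q \<or> doublet ey fy hy ex fx hx p q" and xy: "x \<noteq> y"
      and B: "\<And>r. r \<in> B \<longleftrightarrow> (\<exists>\<alpha> \<beta>. r = Poly_Mapping.single (vkey x) \<alpha> + Poly_Mapping.single (vkey y) \<beta>)" for x y B
  proof (rule bij_betw_imageI)
    show "inj_on (pair_map x y p q) B"
    proof (rule inj_onI)
      fix r s assume "r \<in> B" "s \<in> B" and eq: "pair_map x y p q r = pair_map x y p q s"
      then obtain \<alpha> \<beta> \<alpha>' \<beta>' where rs: "r = Poly_Mapping.single (vkey x) \<alpha> + Poly_Mapping.single (vkey y) \<beta>"
        "s = Poly_Mapping.single (vkey x) \<alpha>' + Poly_Mapping.single (vkey y) \<beta>'"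
        unfolding B by blast
      then show "r = s"
        using doublet_independent[OF d p, of \<alpha> \<beta> \<alpha>' \<beta>'] eq by (simp add: pair_map_eval[OF xy])
    qed
    have "v \<in> pair_map x y p q ` B" for v
    proof -
      obtain \<alpha> \<beta> where v: "v = fscale \<alpha> p + fscale \<beta> q"
        by (rule doublet_span[OF irr p d tau gamma])
      show ?thesis
        by (rule image_eqI[where x = "Poly_Mapping.single (vkey x) \<alpha> + Poly_Mapping.single (vkey y) \<beta>"])
          (use B in \<open>auto simp: v pair_map_eval[OF xy]\<close>)
    qed
    then show "pair_map x y p q ` B = UNIV" by blast
  qed
  have lin: "pair_map x y p q (r + s) = pair_map x y p q r + pair_map x y p q s" for x y r s
    by (simp add: pair_map_def lookup_add fs.scale_left_distrib)
  show "realization 1 0 \<tau> \<gamma> (pair_map X1 X2 p q)" if d: "doublet ex fx hx ey fy hy p q"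
  proof -
    let ?\<phi> = "pair_map X1 X2 p q"
    have xy: "X1 \<noteq> X2" by simp
    have B: "r \<in> bihom 1 0 \<longleftrightarrow> (\<exists>\<alpha> \<beta>. r = Poly_Mapping.single (vkey X1) \<alpha> + Poly_Mapping.single (vkey X2) \<beta>)" for r
      using bihom_vkey(1) bihom_cases(1) by blast
    show ?thesis
      unfolding realization_def
    proof (intro conjI ballI allI)
      show "bij_betw ?\<phi> (bihom 1 0) UNIV" by (rule bij[OF _ xy B]) (use d in blast)
      show "?\<phi> (r + s) = ?\<phi> r + ?\<phi> s" for r s by (rule lin)
      fix r assume "r \<in> bihom 1 0"
      then obtain \<alpha> \<beta> where r: "r = Poly_Mapping.single (vkey X1) \<alpha> + Poly_Mapping.single (vkey X2) \<beta>" using B by blast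
      note ev = r D_add D_vkey V_mult pair_map_eval[OF xy] act0_add_right act0_scale_right g0_deg fs.scale_right_distrib
      show "?\<phi> (Poly_Mapping.single 0 c * r) = fscale c (?\<phi> r)" for c
        by (simp add: ev distrib_left single_zero_mult)
      show "act0 ex (?\<phi> r) = ?\<phi> (V X1 * D X2 r)" "act0 fx (?\<phi> r) = ?\<phi> (V X2 * D X1 r)"
        "act0 hx (?\<phi> r) = ?\<phi> (V X1 * D X1 r - V X2 * D X2 r)" "act0 ey (?\<phi> r) = ?\<phi> (V Y1 * D Y2 r)"
        "act0 fy (?\<phi> r) = ?\<phi> (V Y2 * D Y1 r)" "act0 hy (?\<phi> r) = ?\<phi> (V Y1 * D Y1 r - V Y2 * D Y2 r)"
        "act0 tt (?\<phi> r) = fscale \<tau> (?\<phi> r)" "act0 central (?\<phi> r) = fscale \<gamma> (?\<phi> r)"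
        using d unfolding doublet_def by (simp_all add: ev tau gamma)
    qed
  qed
  show "realization 0 1 \<tau> \<gamma> (pair_map Y1 Y2 p q)" if d: "doublet ey fy hy ex fx hx p q"
  proof -
    let ?\<phi> = "pair_map Y1 Y2 p q"
    have xy: "Y1 \<noteq> Y2" by simp
    have B: "r \<in> bihom 0 1 \<longleftrightarrow> (\<exists>\<alpha> \<beta>. r = Poly_Mapping.single (vkey Y1) \<alpha> + Poly_Mapping.single (vkey Y2) \<beta>)" for r
      using bihom_vkey(2) bihom_cases(2) by blast
    show ?thesis
      unfolding realization_def
    proof (intro conjI ballI allI)
      show "bij_betw ?\<phi> (bihom 0 1) UNIV" by (rule bij[OF _ xy B]) (use d in blast)
      show "?\<phi> (r + s) = ?\<phi> r + ?\<phi> s" for r s by (rule lin)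
      fix r assume "r \<in> bihom 0 1"
      then obtain \<alpha> \<beta> where r: "r = Poly_Mapping.single (vkey Y1) \<alpha> + Poly_Mapping.single (vkey Y2) \<beta>" using B by blast
      note ev = r D_add D_vkey V_mult pair_map_eval[OF xy] act0_add_right act0_scale_right g0_deg fs.scale_right_distrib
      show "?\<phi> (Poly_Mapping.single 0 c * r) = fscale c (?\<phi> r)" for c
        by (simp add: ev distrib_left single_zero_mult)
      show "act0 ex (?\<phi> r) = ?\<phi> (V X1 * D X2 r)" "act0 fx (?\<phi> r) = ?\<phi> (V X2 * D X1 r)"
        "act0 hx (?\<phi> r) = ?\<phi> (V X1 * D X1 r - V X2 * D X2 r)" "act0 ey (?\<phi> r) = ?\<phi> (V Y1 * D Y2 r)"
        "act0 fy (?\<phi> r) = ?\<phi> (V Y2 * D Y1 r)" "act0 hy (?\<phi> r) = ?\<phi> (V Y1 * D Y1 r - V Y2 * D Y2 r)"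
        "act0 tt (?\<phi> r) = fscale \<tau> (?\<phi> r)" "act0 central (?\<phi> r) = fscale \<gamma> (?\<phi> r)"
        using d unfolding doublet_def by (simp_all add: ev tau gamma)
    qed
  qed
qed

lemma V_single: "V x = Poly_Mapping.single (vkey x) 1"
  by (simp add: V_def)

lemma pair_map_V: "x \<noteq> y \<Longrightarrow> pair_map x y p q (V x) = p" "x \<noteq> y \<Longrightarrow> pair_map x y p q (V y) = q"
  by (simp_all add: V_single pair_map_eval)

lemma doublet_realization:
  fixes \<phi> :: "xypoly \<Rightarrow> 'f::g0_module"
  shows "realization 1 0 \<tau> \<gamma> \<phi> \<Longrightarrow> doublet ex fx hx ey fy hy (\<phi> (V X1)) (\<phi> (V X2)) \<and> \<phi> (V X1) \<noteq> 0"
    "realization 0 1 \<tau> \<gamma> \<phi> \<Longrightarrow> doublet ey fy hy ex fx hx (\<phi> (V Y1)) (\<phi> (V Y2)) \<and> \<phi> (V Y1) \<noteq> 0"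
    "realization k l \<tau> \<gamma> \<phi> \<Longrightarrow> act0 tt v = fscale \<tau> (v :: 'f) \<and> act0 central v = fscale \<gamma> v"
proof -
  have neg: "\<phi> (- V x) = - \<phi> (V x)" and zero: "\<phi> 0 = 0"
    if r: "realization k l \<tau> \<gamma> \<phi>" and x: "V x \<in> bihom k l" for k l x
  proof -
    have s: "\<phi> (Poly_Mapping.single 0 c * V x) = fscale c (\<phi> (V x))" for c
      using r x unfolding realization_def by blast
    show "\<phi> (- V x) = - \<phi> (V x)" using s[of "-1"] by (simp add: V_single single_zero_mult single_uminus)
    show "\<phi> 0 = 0" using s[of 0] by (simp add: V_single)
  qed
  have V: "V X1 \<in> bihom 1 0" "V X2 \<in> bihom 1 0" "V Y1 \<in> bihom 0 1" "V Y2 \<in> bihom 0 1"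
    using bihom_vkey(1)[of 1 0] bihom_vkey(1)[of 0 1] bihom_vkey(2)[of 1 0] bihom_vkey(2)[of 0 1] by (simp_all add: V_single)
  have DV: "D x (V y) = (if x = y then 1 else 0)" for x y
    by (simp add: V_single D_vkey)
  have V0: "V x \<noteq> 0" for x
    by (metis V_single lookup_single_eq lookup_zero zero_neq_one)
  have nz: "\<phi> (V x) \<noteq> 0" if r: "realization k l \<tau> \<gamma> \<phi>" and x: "V x \<in> bihom k l" for k l x
  proof -
    have "inj_on \<phi> (bihom k l)" using r unfolding realization_def bij_betw_def by blast
    moreover have "0 \<in> bihom k l" by (simp add: bihom_def)
    ultimately show ?thesis using zero[OF r x] x V0 by (metis inj_onD)
  qed
  show "doublet ex fx hx ey fy hy (\<phi> (V X1)) (\<phi> (V X2)) \<and> \<phi> (V X1) \<noteq> 0" if r: "realization 1 0 \<tau> \<gamma> \<phi>"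
    using r V(1,2) nz[OF r V(1)] unfolding realization_def doublet_def
    by (simp add: DV neg[OF r V(2)] zero[OF r V(1)])
  show "doublet ey fy hy ex fx hx (\<phi> (V Y1)) (\<phi> (V Y2)) \<and> \<phi> (V Y1) \<noteq> 0" if r: "realization 0 1 \<tau> \<gamma> \<phi>"
    using r V(3,4) nz[OF r V(3)] unfolding realization_def doublet_def
    by (simp add: DV neg[OF r V(4)] zero[OF r V(3)])
  show "act0 tt v = fscale \<tau> (v :: 'f) \<and> act0 central v = fscale \<gamma> v" if r: "realization k l \<tau> \<gamma> \<phi>"
  proof -
    have "v \<in> \<phi> ` bihom k l" using r unfolding realization_def bij_betw_def by blast
    then show ?thesis using r unfolding realization_def by blast
  qed
qed

text \<open>Reordering gives w11 w22 w21 = -w11 w21 w22, w11 w22 w12 = -w11 w12 w22, w12 w21 w11 =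
  w11 w12 w21 and w21 w12 w11 = -w11 w12 w21 - zeta w11. The last one, due to gram(W21, W12) = -1,
  is the source of the coefficient a11 in case (a).\<close>

lemma to_model_w:
  "to_model (w11 * w22 * w21 \<otimes> p + w21 * w12 * w11 \<otimes> q) = cubic (- q) 0 0 0 0 (- p) 0 (- q)"
  "to_model (w11 * w22 * w12 \<otimes> p + w12 * w21 * w11 \<otimes> q) = cubic 0 0 0 0 0 0 (- p) q"
  by (simp_all add: w_embed to_model_add to_model_tensor env_act_mult env_act_embed rho_welt)
    (simp_all add: cubic_def tuple_eval)

text \<open>5 is twice the eigenvalue 5/2 of t. Small multiples are expanded into repeated sums so
  that they cancel additively.\<close>

lemma fscale_five: "fscale 5 v = v + v + (v + (v + (v :: 'f::g0_module)))"
  using fscale_add_left[of 4 1 v] by (simp add: fscale_four add_ac)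

lemma cubic_a:
  fixes p q :: "'f::g0_module"
  assumes "doublet ex fx hx ey fy hy p q" "\<And>v :: 'f. act0 tt v = fscale (5/2) v" "\<And>v :: 'f. act0 central v = fscale (- 1/2) v"
  defines "x \<equiv> cubic (- q) 0 0 0 0 (- p) 0 (- q)"
  shows "rho (twelt j) x = 0" "rho (dualelt j) x = 0" "rho ex x = 0" "rho ey x = 0"
proof -
  have neg: "act0 a (- v) = - act0 a v" if "a \<in> g_deg 0" for a and v :: 'f
    using act0_scale_right[OF that, of "-1" v] by (simp add: fs.scale_minus_left)
  note ev = tuple_eval assms(1)[unfolded doublet_def] assms(2,3) act0_zero_right neg g0_deg
  show "rho ex x = 0" "rho ey x = 0"
    unfolding x_def cubic_def by (simp_all add: rho_eval) (simp_all add: ev)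
  show "rho (twelt j) x = 0"
    unfolding x_def cubic_def by (cases j) (simp_all add: rho_eval, simp_all add: ev, simp_all add: fscale_two fscale_four fscale_five)
  show "rho (dualelt j) x = 0"
    unfolding x_def cubic_def by (cases j) (simp_all add: rho_eval, simp_all add: ev, simp_all add: fscale_two fscale_four fscale_five)
qed

lemma cubic_b:
  fixes p q :: "'f::g0_module"
  assumes "doublet ey fy hy ex fx hx p q" "\<And>v :: 'f. act0 tt v = fscale (5/2) v" "\<And>v :: 'f. act0 central v = fscale (1/2) v"
  defines "x \<equiv> cubic 0 0 0 0 0 0 (- p) q"
  shows "rho (twelt j) x = 0" "rho (dualelt j) x = 0" "rho ex x = 0" "rho ey x = 0"
proof -
  have neg: "act0 a (- v) = - act0 a v" if "a \<in> g_deg 0" for a and v :: 'f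
    using act0_scale_right[OF that, of "-1" v] by (simp add: fs.scale_minus_left)
  note ev = tuple_eval assms(1)[unfolded doublet_def] assms(2,3) act0_zero_right neg g0_deg
  show "rho ex x = 0" "rho ey x = 0"
    unfolding x_def cubic_def by (simp_all add: rho_eval) (simp_all add: ev)
  show "rho (twelt j) x = 0"
    unfolding x_def cubic_def by (cases j) (simp_all add: rho_eval, simp_all add: ev, simp_all add: fscale_two fscale_four fscale_five)
  show "rho (dualelt j) x = 0"
    unfolding x_def cubic_def by (cases j) (simp_all add: rho_eval, simp_all add: ev, simp_all add: fscale_two fscale_four fscale_five)
qed

section \<open>The classification\<close>

text \<open>Reduces the converse direction to finitely many equations in the model, for the elements
  spanning g_1 and for e_x and e_y.\<close>

lemma hw_singularI:
  fixes x :: "'f::g0_module ind"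
  assumes "to_model x = y" "x \<in> ind_deg 3" "y \<noteq> 0" "c \<noteq> 0"
    "\<And>j. rho (twelt j) y = 0" "\<And>j. rho (dualelt j) y = 0" "rho ex y = 0" "rho ey y = 0"
  shows "nontrivial_hw_singular (scalar c \<cdot> x) \<and> scalar c \<cdot> x \<in> ind_deg 3"
proof -
  have m: "to_model (scalar c \<cdot> x) = scl c y"
    by (simp add: to_model_uact env_act_scalar assms(1))
  have "singular (scalar c \<cdot> x)"
    unfolding singular_iff m by (simp add: rho_scl rho_pos_zero[OF assms(5,6)])
  moreover have "scalar c \<cdot> x \<noteq> 0"
  proof
    assume "scalar c \<cdot> x = 0"
    then have "scl (1 / c) (scl c y) = 0" unfolding m[symmetric] by (simp add: to_model_zero)
    then show False using assms(3,4) by simp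
  qed
  moreover have "scalar c \<cdot> x \<in> ind_deg 3"
    using assms(2)
  proof induction
    case zero
    show ?case by (simp add: uact_zero_right ind_deg.zero)
  next
    case (add x y)
    then show ?case by (simp add: uact_add_right ind_deg.add)
  next
    case (tensor u v)
    have "scalar c * u \<in> neg_env 3"
      using tensor
    proof induction
      case (add u w)
      then show ?case by (simp add: distrib_left neg_env.add)
    next
      case (prod as ks d)
      show ?case
        using neg_env.prod[OF prod, of "c * d"] by (simp add: scalar_mult flip: mult.assoc)
    qed (simp add: neg_env.zero)
    then show ?case by (simp add: uact_tensor ind_deg.tensor)
  qed
  ultimately show ?thesis
    unfolding nontrivial_hw_singular_def nontrivial_singular_def embed_uact_zero_iff m
    by (auto simp: rho_scl assms(7,8) intro!: exI[of _ 3])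
qed

lemma ind_deg_w:
  "w11 * w22 * w21 \<otimes> p + w21 * w12 * w11 \<otimes> q \<in> ind_deg 3"
  "w11 * w22 * w12 \<otimes> p + w12 * w21 * w11 \<otimes> q \<in> ind_deg 3"
  unfolding w_embed using triple_neg_env[of 1] by (auto simp: scalar_one intro!: ind_deg.add ind_deg.tensor)

lemma cubic_zero: "cubic 0 0 0 0 0 0 0 0 = 0"
  by (simp add: cubic_def tuple_eval)

lemma cubic_nonzero: "b12 \<noteq> 0 \<or> b21 \<noteq> 0 \<Longrightarrow> cubic a11 a12 a21 a22 b11 b12 b21 b22 \<noteq> 0"
  by (auto simp: cubic_def tuple_eval)

theorem theorem6p8:
  fixes v :: "'f::g0_module ind" and m n mt mC :: complex
  assumes "irreducible_module TYPE('f)" and "finite_dimensional TYPE('f)"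
    and "highest_weight TYPE('f) (m, n, mt, mC)"
  shows "nontrivial_hw_singular v \<and> v \<in> ind_deg 3 \<longleftrightarrow>
    ((m, n, mt, mC) = (1, 0, 5/2, -1/2) \<and>
      (\<exists>\<phi> c. realization 1 0 (5/2) (-1/2) \<phi> \<and> c \<noteq> 0 \<and>
        v = scalar c \<cdot> (w11 * w22 * w21 \<otimes> \<phi> (V X1) + w21 * w12 * w11 \<otimes> \<phi> (V X2)))) \<or>
    ((m, n, mt, mC) = (0, 1, 5/2, 1/2) \<and>
      (\<exists>\<phi> c. realization 0 1 (5/2) (1/2) \<phi> \<and> c \<noteq> 0 \<and>
        v = scalar c \<cdot> (w11 * w22 * w12 \<otimes> \<phi> (V Y1) + w12 * w21 * w11 \<otimes> \<phi> (V Y2))))"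
    (is "?L \<longleftrightarrow> ?A \<or> ?B")
proof
  assume ?L
  obtain v0 :: 'f where v0: "v0 \<noteq> 0" "act0 ex v0 = 0" "act0 ey v0 = 0" "act0 hx v0 = fscale m v0" "act0 hy v0 = fscale n v0"
    "act0 tt v0 = fscale mt v0" "act0 central v0 = fscale mC v0"
    using assms(3) unfolding highest_weight_def by auto
  have tau: "act0 tt w = fscale mt w" for w :: 'f
    by (rule irreducible_scalar[OF assms(1) g0_deg(7) abr_tt v0(1,6)])
  have gamma: "act0 central w = fscale mC w" for w :: 'f
    by (rule irreducible_scalar[OF assms(1) g0_deg(8) abr_central(2) v0(1,7)])
  have neg: "act0 a (- w) = - act0 a w" if "a \<in> g_deg 0" for a and w :: 'f
    using act0_scale_right[OF that, of "-1" w] by (simp add: fs.scale_minus_left)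
  have "mdeg 3 (to_model v)"
    using \<open>?L\<close> to_model_ind_deg[of v 3] by simp
  then obtain a11 a12 a21 a22 b11 b12 b21 b22 where x: "to_model v = cubic a11 a12 a21 a22 b11 b12 b21 b22"
    by (rule mdeg_cubic)
  have sing: "rho a (cubic a11 a12 a21 a22 b11 b12 b21 b22) = 0" if "a \<in> g_pos" for a
    using \<open>?L\<close> that unfolding nontrivial_hw_singular_def nontrivial_singular_def singular_iff x by blast
  have "rho ex (cubic a11 a12 a21 a22 b11 b12 b21 b22) = 0" "rho ey (cubic a11 a12 a21 a22 b11 b12 b21 b22) = 0"
    using \<open>?L\<close> unfolding nontrivial_hw_singular_def embed_uact_zero_iff x by blast+
  note eqs = cubic_equations[OF tau gamma sing[OF twelt_pos] sing[OF dualelt_pos] this]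
  have "to_model v \<noteq> 0"
    using \<open>?L\<close> to_model_eq_iff[of v 0] by (simp add: nontrivial_hw_singular_def nontrivial_singular_def to_model_zero)
  \<comment> \<open>Otherwise b22 = f_x b12 - f_y b21 vanishes too, and with it the coefficients at
    zeta.\<close>
  have "b12 \<noteq> 0 \<or> b21 \<noteq> 0"
  proof (rule ccontr)
    assume "\<not> ?thesis"
    then have "b12 = 0" "b21 = 0" by auto
    then have "b22 = 0" using eqs(6) by (simp add: act0_zero_right g0_deg)
    then have "to_model v = 0"
      using eqs(1-5) \<open>b12 = 0\<close> \<open>b21 = 0\<close> by (simp add: x act0_zero_right g0_deg cubic_zero)
    with \<open>to_model v \<noteq> 0\<close> show False ..
  qed
  then show "?A \<or> ?B"
  proof
    assume b12: "b12 \<noteq> 0"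
    then have t: "mt = 5/2" "mC = - 1/2" using eqs(23) by auto
    \<comment> \<open>A nonzero b21 would force the value 1/2 for C.\<close>
    have b21: "b21 = 0" using eqs(24) t by auto
    \<comment> \<open>The signs are dictated by \<open>to_model_w\<close>: the vector of case (a)
      has b12 = -p and b22 = -q.\<close>
    let ?p = "- b12" and ?q = "- b22"
    have d: "doublet ex fx hx ey fy hy ?p ?q"
      unfolding doublet_def using eqs t b21 by (simp add: neg g0_deg act0_zero_right)
    obtain \<alpha> \<beta> where e: "v0 = fscale \<alpha> ?p + fscale \<beta> ?q"
      by (rule doublet_span[OF assms(1) _ disjI1[OF d] tau gamma]) (use b12 in simp_all)
    have lin: "act0 a v0 = fscale \<alpha> (act0 a ?p) + fscale \<beta> (act0 a ?q)" if "a \<in> g_deg 0" for a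
      unfolding e using that by (simp only: act0_add_right act0_scale_right)
    \<comment> \<open>e_x kills the highest weight vector but sends q to p. So \<open>v0\<close> is
      a multiple of p and has its weight (1, 0).\<close>
    have "fscale \<beta> ?p = 0"
      using lin[OF g0_deg(3)] v0(2) d unfolding doublet_def by simp
    then have "\<beta> = 0" using b12 by simp
    then have "fscale m v0 = v0" "fscale n v0 = 0"
      using lin[OF g0_deg(1)] lin[OF g0_deg(2)] v0(4,5) d e unfolding doublet_def by simp_all
    then have "m = 1" "n = 0" using v0(1) fs.scale_right_imp_eq[of v0 m 1] by simp_all
    moreover have "realization 1 0 (5/2) (-1/2) (pair_map X1 X2 ?p ?q)"
      using realization_doublet(1)[OF assms(1) _ tau gamma d] b12 by (simp add: t)
    \<comment> \<open>The scalar is 1 because the identification \<open>pair_map\<close> absorbs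
      it.\<close>
    moreover have "v = scalar 1 \<cdot> (w11 * w22 * w21 \<otimes> pair_map X1 X2 ?p ?q (V X1) + w21 * w12 * w11 \<otimes> pair_map X1 X2 ?p ?q (V X2))"
      unfolding scalar_one uact_one to_model_eq_iff[symmetric] to_model_w x
      using eqs(1-5) b21 by (simp add: pair_map_V act0_zero_right g0_deg)
    ultimately have ?A using t by (metis zero_neq_one)
    then show ?thesis ..
  next
    assume b21: "b21 \<noteq> 0"
    then have t: "mt = 5/2" "mC = 1/2" using eqs(24) by auto
    have b12: "b12 = 0" using eqs(23) t by auto
    \<comment> \<open>In case (b) \<open>to_model_w\<close> gives b21 = -p but b22 = q. Moreover a11
      = f_x b12 = 0, in accordance with w12 w21 w11 having no zeta term.\<close>
    let ?p = "- b21" and ?q = "b22"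
    have f: "act0 fy b21 = - b22"
      using eqs(6) b12 by (simp add: act0_zero_right g0_deg eq_neg_iff_add_eq_0 add.commute)
    have d: "doublet ey fy hy ex fx hx ?p ?q"
      unfolding doublet_def using eqs t b12 f by (simp add: neg g0_deg act0_zero_right)
    obtain \<alpha> \<beta> where e: "v0 = fscale \<alpha> ?p + fscale \<beta> ?q"
      by (rule doublet_span[OF assms(1) _ disjI2[OF d] tau gamma]) (use b21 in simp_all)
    have lin: "act0 a v0 = fscale \<alpha> (act0 a ?p) + fscale \<beta> (act0 a ?q)" if "a \<in> g_deg 0" for a
      unfolding e using that by (simp only: act0_add_right act0_scale_right)
    have "fscale \<beta> ?p = 0"
      using lin[OF g0_deg(5)] v0(3) d unfolding doublet_def by simp
    then have "\<beta> = 0" using b21 by simp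
    then have "fscale n v0 = v0" "fscale m v0 = 0"
      using lin[OF g0_deg(1)] lin[OF g0_deg(2)] v0(4,5) d e unfolding doublet_def by simp_all
    then have "n = 1" "m = 0" using v0(1) fs.scale_right_imp_eq[of v0 n 1] by simp_all
    moreover have "realization 0 1 (5/2) (1/2) (pair_map Y1 Y2 ?p ?q)"
      using realization_doublet(2)[OF assms(1) _ tau gamma d] b21 by (simp add: t)
    moreover have "v = scalar 1 \<cdot> (w11 * w22 * w12 \<otimes> pair_map Y1 Y2 ?p ?q (V Y1) + w12 * w21 * w11 \<otimes> pair_map Y1 Y2 ?p ?q (V Y2))"
      unfolding scalar_one uact_one to_model_eq_iff[symmetric] to_model_w x
      using eqs(1-5) b12 f by (simp add: pair_map_V)
    ultimately have ?B using t by (metis zero_neq_one)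
    then show ?thesis ..
  qed
next
  assume "?A \<or> ?B"
  then show ?L
  proof
    assume ?A
    then obtain \<phi> :: "xypoly \<Rightarrow> 'f" and c where r: "realization 1 0 (5/2) (-1/2) \<phi>" and "c \<noteq> 0"
      and v: "v = scalar c \<cdot> (w11 * w22 * w21 \<otimes> \<phi> (V X1) + w21 * w12 * w11 \<otimes> \<phi> (V X2))" by blast
    note d = doublet_realization(1)[OF r] and s = doublet_realization(3)[OF r]
    show ?L
      unfolding v
      by (rule hw_singularI[OF to_model_w(1) ind_deg_w(1) cubic_nonzero \<open>c \<noteq> 0\<close>])
        (use d s in \<open>auto intro!: cubic_a\<close>)
  next
    assume ?B
    then obtain \<phi> :: "xypoly \<Rightarrow> 'f" and c where r: "realization 0 1 (5/2) (1/2) \<phi>" and "c \<noteq> 0"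
      and v: "v = scalar c \<cdot> (w11 * w22 * w12 \<otimes> \<phi> (V Y1) + w12 * w21 * w11 \<otimes> \<phi> (V Y2))" by blast
    note d = doublet_realization(2)[OF r] and s = doublet_realization(3)[OF r]
    show ?L
      unfolding v
      by (rule hw_singularI[OF to_model_w(2) ind_deg_w(2) cubic_nonzero \<open>c \<noteq> 0\<close>])
        (use d s in \<open>auto intro!: cubic_b\<close>)
  qed
qed

end
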